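(* Let $V$ be a finite-dimensional graded vector space over a field of characteristic $0$ with a symmetric, non-degenerate bilinear form $b$ (of degree $0$). Then the space $\mathcal P(V)=\mathcal S(V)\otimes\mathcal C^2$ of bi-symmetric forms on $V$ is a (graded) Lie algebra for the Pinczon bracket $$\{\Omega\otimes\alpha,\Omega'\otimes\alpha'\}=\Omega\cdot\{\alpha,\Omega'\}\otimes\alpha'+\Omega'\cdot\{\Omega,\alpha'\}\otimes\alpha+\Omega\cdot\Omega'\otimes\{\alpha,\alpha'\},$$ for $\Omega,\Omega'\in\mathcal S(V)$ and $\alpha,\alpha'\in\mathcal C^2$.
   Context: Degrees and signs. $|x|$ is the degree of $x$ in $V$; $V[1]$ is $V$ with shifted degree $\deg(x)=|x|-1$; scalars have degree $0$. All formulas use Koszul's sign rule: in any relation between homogeneous objects, the first term has sign $+$ and every other term is implicitly multiplied by the sign of the permutation of the odd letters relating it to the first term. $b$ symmetric of degree $0$: $b(x,y)=(-1)^{|x||y|}b(y,x)$, and $b(x,y)=0$ unless $|x|+|y|=0$. Forms. $\mathcal S(V)$ is the space of (graded) symmetric multilinear forms on $V[1]$, in any number $k\ge0$ of variables; it is a commutative algebra for the symmetric product $(\Omega\cdot\Omega')(x_1,\dots,x_{k+k'})=\sum_{I\sqcup J=[1,k+k'],\,\#I=k}\Omega(x_I)\Omega'(x_J)$ for $\Omega$ $k$-linear, $\Omega'$ $k'$-linear. $\mathcal C^2$ is the space of symmetric bilinear forms on $V[1]$. A bi-symmetric form is a multilinear form on $V[1]$ in $k+2$ variables, $k\ge0$,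 separately symmetric in its first $k$ variables and in its last two; $\mathcal P_k$ denotes the space of these and $\mathcal P(V)=\sum_{k\ge0}\mathcal P_k=\mathcal S(V)\otimes\mathcal C^2$. Pinczon bracket. For cyclic forms (i.e. $\Omega(x_{k+1},x_1,\dots,x_k)=\Omega(x_1,\dots,x_{k+1})$; symmetric forms are cyclic), $\{\Omega,\Omega'\}=\sum_i(\iota_{e_i}\Omega\otimes\iota_{e'_i}\Omega')^{Cycl}$, where $(e_i),(e'_i)$ are homogeneous bases of $V$ with $b(e_i,e'_j)=\delta_{ij}$, $\iota_x\Omega=\Omega(x,\cdot,\dots,\cdot)$, and $Cycl$ means sum over all cyclic permutations of the variables. $\mathcal C^2$ is a Lie algebra for this bracket (for the grading $\deg-2$), and it acts on $\mathcal S(V)$ by $(\alpha,\Omega)\mapsto\{\alpha,\Omega\}$. *)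

theory Defs
  imports Complex_Main "HOL-Library.Function_Algebras"
begin

section \<open>Graded vector spaces and the Koszul sign rule\<close>

definition is_decomposition :: "(int \<Rightarrow> 'v::ab_group_add set) \<Rightarrow> 'v \<Rightarrow> (int \<Rightarrow> 'v) \<Rightarrow> bool" where
  "is_decomposition L v c \<longleftrightarrow>
     (\<forall>d. c d \<in> L d) \<and> finite {d. c d \<noteq> 0} \<and> v = (\<Sum>d | c d \<noteq> 0. c d)"

definition is_grading ::
  "('k::field \<Rightarrow> 'v::ab_group_add \<Rightarrow> 'v) \<Rightarrow> 'v set \<Rightarrow> (int \<Rightarrow> 'v set) \<Rightarrow> bool" where
  "is_grading s A L \<longleftrightarrow>
     module.subspace s A \<and> (\<forall>d. module.subspace s (L d) \<and> L d \<subseteq> A) \<and>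
     (\<forall>v\<in>A. \<exists>!c. is_decomposition L v c)"

definition hom_comp :: "(int \<Rightarrow> 'v::ab_group_add set) \<Rightarrow> 'v \<Rightarrow> int \<Rightarrow> 'v" where
  "hom_comp L v = (THE c. is_decomposition L v c)"

text \<open>Only meaningful for nonzero homogeneous vectors.\<close>

definition hom_deg :: "(int \<Rightarrow> 'v set) \<Rightarrow> 'v \<Rightarrow> int" where
  "hom_deg L v = (THE d. v \<in> L d)"

text \<open>The shifted space \<open>V[1]\<close>: a vector of degree \<open>d + 1\<close> in \<open>V\<close> has degree \<open>d\<close> in \<open>V[1]\<close>.\<close>

definition shift :: "(int \<Rightarrow> 'v set) \<Rightarrow> int \<Rightarrow> 'v set" where
  "shift V d = V (d + 1)"

definition ksign :: "int \<Rightarrow> int \<Rightarrow> 'k::comm_ring_1" where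
  "ksign i j = (if odd i \<and> odd j then - 1 else 1)"

text \<open>Letters are numbered \<open>0, 1, \<dots>\<close> in the order in which they occur in the first term of a
  relation, \<open>ds\<close> lists their degrees, and \<open>p\<close> is the word in which they occur in another term.
  The value is the sign of the permutation of the odd letters.\<close>

definition koszul :: "int list \<Rightarrow> nat list \<Rightarrow> 'k::comm_ring_1" where
  "koszul ds p =
     (\<Prod>(i, j) \<in> {(i, j). i < j \<and> j < length p \<and> p ! j < p ! i}. ksign (ds ! (p ! i)) (ds ! (p ! j)))"

definition pick :: "'a list \<Rightarrow> nat list \<Rightarrow> 'a list" where
  "pick xs p = map ((!) xs) p"

definition is_perm_of :: "nat list \<Rightarrow> nat set \<Rightarrow> bool" where
  "is_perm_of p A \<longleftrightarrow> distinct p \<and> set p = A"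


section \<open>Multilinear forms\<close>

text \<open>A function on lists stands for a sum of multilinear forms, one for each number of
  variables: its restriction to lists of length \<open>k\<close> is the \<open>k\<close>-linear component. In this section
  and the next one, \<open>W\<close> is the grading of the space on which the forms live; it is
  instantiated with \<open>V[1]\<close>.\<close>

type_synonym ('v, 'k) form = "'v list \<Rightarrow> 'k"

definition form_scale :: "'k \<Rightarrow> ('v, 'k::times) form \<Rightarrow> ('v, 'k) form" where
  "form_scale c f = (\<lambda>xs. c * f xs)"

definition multilinear :: "('k::field \<Rightarrow> 'v::ab_group_add \<Rightarrow> 'v) \<Rightarrow> ('v, 'k) form \<Rightarrow> bool" where
  "multilinear scale f \<longleftrightarrow>
     (\<forall>xs ys. Vector_Spaces.linear scale (*) (\<lambda>v. f (xs @ v # ys)))"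

definition finite_arity :: "('v, 'k::zero) form \<Rightarrow> bool" where
  "finite_arity f \<longleftrightarrow> (\<exists>N. \<forall>xs. N \<le> length xs \<longrightarrow> f xs = 0)"

definition homs :: "(int \<Rightarrow> 'v set) \<Rightarrow> int list \<Rightarrow> 'v list \<Rightarrow> bool" where
  "homs W ds xs \<longleftrightarrow> list_all2 (\<lambda>d x. x \<in> W d) ds xs"

definition symmetric_form :: "(int \<Rightarrow> 'v set) \<Rightarrow> ('v, 'k::comm_ring_1) form \<Rightarrow> bool" where
  "symmetric_form W f \<longleftrightarrow>
     (\<forall>ds xs p. homs W ds xs \<and> is_perm_of p {..<length xs} \<longrightarrow>
        f xs = koszul ds p * f (pick xs p))"

definition bisymmetric_form :: "(int \<Rightarrow> 'v set) \<Rightarrow> ('v, 'k::comm_ring_1) form \<Rightarrow> bool" where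
  "bisymmetric_form W f \<longleftrightarrow>
     (\<forall>k ds xs p q. homs W ds xs \<and> length xs = k + 2 \<and>
        is_perm_of p {..<k} \<and> is_perm_of q {k, k + 1} \<longrightarrow>
        f xs = koszul ds (p @ q) * f (pick xs (p @ q)))"

definition sym_forms ::
  "('k::field \<Rightarrow> 'v::ab_group_add \<Rightarrow> 'v) \<Rightarrow> (int \<Rightarrow> 'v set) \<Rightarrow> ('v, 'k) form set" where
  "sym_forms scale W = {f. multilinear scale f \<and> finite_arity f \<and> symmetric_form W f}"

definition sym_bilinear_forms ::
  "('k::field \<Rightarrow> 'v::ab_group_add \<Rightarrow> 'v) \<Rightarrow> (int \<Rightarrow> 'v set) \<Rightarrow> ('v, 'k) form set" where
  "sym_bilinear_forms scale W = {f \<in> sym_forms scale W. \<forall>xs. length xs \<noteq> 2 \<longrightarrow> f xs = 0}"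

definition bisym_forms ::
  "('k::field \<Rightarrow> 'v::ab_group_add \<Rightarrow> 'v) \<Rightarrow> (int \<Rightarrow> 'v set) \<Rightarrow> ('v, 'k) form set" where
  "bisym_forms scale W =
     {f. multilinear scale f \<and> finite_arity f \<and> bisymmetric_form W f \<and>
         (\<forall>xs. length xs < 2 \<longrightarrow> f xs = 0)}"

text \<open>Scalars have degree \<open>0\<close>, so a form of degree \<open>d\<close> can be nonzero only on arguments of
  total degree \<open>- d\<close>.\<close>

definition form_deg :: "(int \<Rightarrow> 'v set) \<Rightarrow> int \<Rightarrow> ('v, 'k::zero) form \<Rightarrow> bool" where
  "form_deg W d f \<longleftrightarrow> (\<forall>ds xs. homs W ds xs \<and> f xs \<noteq> 0 \<longrightarrow> d = - sum_list ds)"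


section \<open>Operations on forms\<close>

text \<open>Formulas with Koszul signs make sense only on homogeneous arguments: \<open>\<Phi> ds xs\<close> is the value
  on vectors \<open>xs\<close> of degrees \<open>ds\<close>, and \<open>multi_ext\<close> extends it multilinearly.

  In the definitions below the forms are themselves letters with a degree. When \<open>f\<close> is evaluated
  on arguments of total degree \<open>n\<close>, only its homogeneous component of degree \<open>- n\<close>
  contributes, so that \<open>- n\<close> is the degree of the letter \<open>f\<close>. This extends the formulas
  bilinearly to inhomogeneous forms. Likewise, forms pick out their own number of arguments, so the
  sums run over all ways of distributing the variables.\<close>

definition multi_ext ::
  "(int \<Rightarrow> 'v::ab_group_add set) \<Rightarrow> (int list \<Rightarrow> ('v, 'k) form) \<Rightarrow> ('v, 'k::comm_ring_1) form" where
  "multi_ext W \<Phi> xs =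
     (\<Sum>ds | length ds = length xs \<and> (\<forall>i<length xs. hom_comp W (xs ! i) (ds ! i) \<noteq> 0).
        \<Phi> ds (map2 (hom_comp W) xs ds))"

text \<open>Letters \<open>f, g, x\<^sub>1, \<dots>, x\<^sub>n\<close>, reordered as \<open>f, x\<^sub>I, g, x\<^sub>J\<close>.\<close>

definition sym_prod ::
  "(int \<Rightarrow> 'v::ab_group_add set) \<Rightarrow> ('v, 'k) form \<Rightarrow> ('v, 'k) form \<Rightarrow> ('v, 'k::comm_ring_1) form" where
  "sym_prod W f g = multi_ext W (\<lambda>ds xs.
     \<Sum>A \<in> Pow {..<length xs}.
       let I = filter (\<lambda>i. i \<in> A) [0..<length xs];
           J = filter (\<lambda>i. i \<notin> A) [0..<length xs]
       in koszul ([- sum_list (pick ds I), - sum_list (pick ds J)] @ ds)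
            ([0] @ map ((+) 2) I @ [1] @ map ((+) 2) J)
          * f (pick xs I) * g (pick xs J))"

text \<open>Letters \<open>f, g, x\<^sub>1, \<dots>, x\<^sub>n\<close>, reordered as \<open>f, x\<^sub>1, \<dots>, x\<^sub>k, g, x\<^sub>k\<^sub>+\<^sub>1, \<dots>, x\<^sub>n\<close>.\<close>

definition tensor ::
  "(int \<Rightarrow> 'v::ab_group_add set) \<Rightarrow> ('v, 'k) form \<Rightarrow> ('v, 'k) form \<Rightarrow> ('v, 'k::comm_ring_1) form" where
  "tensor W f g = multi_ext W (\<lambda>ds xs.
     \<Sum>k \<le> length xs.
       koszul ([- sum_list (take k ds), - sum_list (drop k ds)] @ ds)
         ([0] @ map ((+) 2) [0..<k] @ [1] @ map ((+) 2) [k..<length xs])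
       * f (take k xs) * g (drop k xs))"

definition hom_basis ::
  "('k::field \<Rightarrow> 'v::ab_group_add \<Rightarrow> 'v) \<Rightarrow> (int \<Rightarrow> 'v set) \<Rightarrow> 'v list \<Rightarrow> bool" where
  "hom_basis scale W es \<longleftrightarrow>
     distinct es \<and> \<not> module.dependent scale (set es) \<and> module.span scale (set es) = UNIV \<and>
     (\<forall>e\<in>set es. \<exists>d. e \<in> W d)"

definition dual_bases ::
  "('k::field \<Rightarrow> 'v::ab_group_add \<Rightarrow> 'v) \<Rightarrow> (int \<Rightarrow> 'v set) \<Rightarrow> ('v \<Rightarrow> 'v \<Rightarrow> 'k) \<Rightarrow>
   'v list \<times> 'v list \<Rightarrow> bool" where
  "dual_bases scale W b = (\<lambda>(es, es').
     hom_basis scale W es \<and> hom_basis scale W es' \<and> length es = length es' \<and>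
     (\<forall>i<length es. \<forall>j<length es'. b (es ! i) (es' ! j) = (if i = j then 1 else 0)))"

text \<open>The bracket does not depend on the choice of the bases. Letters
  \<open>f, g, e, e', x\<^sub>1, \<dots>, x\<^sub>n\<close>, reordered as \<open>f, e, x\<^sub>I, g, e', x\<^sub>J\<close>, where \<open>x\<^sub>I, x\<^sub>J\<close> is a cyclic
  permutation of the variables. The pair \<open>e, e'\<close> has even total degree, so its place in the first
  word does not matter. The cyclic group on no variables has one element, hence the \<open>max\<close>.\<close>

definition pinczon ::
  "('k::field \<Rightarrow> 'v::ab_group_add \<Rightarrow> 'v) \<Rightarrow> (int \<Rightarrow> 'v set) \<Rightarrow> ('v \<Rightarrow> 'v \<Rightarrow> 'k) \<Rightarrow>
   ('v, 'k) form \<Rightarrow> ('v, 'k) form \<Rightarrow> ('v, 'k) form" where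
  "pinczon scale W b f g =
     (let (es, es') = (SOME B. dual_bases scale W b B) in multi_ext W (\<lambda>ds xs.
       \<Sum>r < max 1 (length xs). \<Sum>k \<le> length xs. \<Sum>i < length es.
         let c = rotate r [0..<length xs]; I = take k c; J = drop k c;
             e = es ! i; e' = es' ! i; d = hom_deg W e; d' = hom_deg W e'
         in koszul ([- (d + sum_list (pick ds I)), - (d' + sum_list (pick ds J)), d, d'] @ ds)
              ([0, 2] @ map ((+) 4) I @ [1, 3] @ map ((+) 4) J)
            * f (e # pick xs I) * g (e' # pick xs J)))"


section \<open>The theorem's hypotheses and conclusion\<close>

locale quadratic_graded_space = vector_space scale
  for scale :: "'k::field_char_0 \<Rightarrow> 'v::ab_group_add \<Rightarrow> 'v" +
  fixes V :: "int \<Rightarrow> 'v set" and b :: "'v \<Rightarrow> 'v \<Rightarrow> 'k"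
  assumes finite_dim: "\<exists>B. finite B \<and> span B = UNIV"
    and grading: "is_grading scale UNIV V"
    and linear_right: "Vector_Spaces.linear scale (*) (\<lambda>y. b x y)"
    and linear_left: "Vector_Spaces.linear scale (*) (\<lambda>x. b x y)"
    and symmetric: "x \<in> V i \<Longrightarrow> y \<in> V j \<Longrightarrow> b x y = ksign i j * b y x"
    and degree_zero: "x \<in> V i \<Longrightarrow> y \<in> V j \<Longrightarrow> i + j \<noteq> 0 \<Longrightarrow> b x y = 0"
    and nondegenerate: "(\<forall>y. b x y = 0) \<Longrightarrow> x = 0"

definition bilinear_on ::
  "('k::field \<Rightarrow> 'a::ab_group_add \<Rightarrow> 'a) \<Rightarrow> 'a set \<Rightarrow> ('a \<Rightarrow> 'a \<Rightarrow> 'a) \<Rightarrow> bool" where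
  "bilinear_on s A br \<longleftrightarrow>
     (\<forall>x\<in>A. \<forall>y\<in>A. \<forall>z\<in>A. br (x + y) z = br x z + br y z \<and> br z (x + y) = br z x + br z y) \<and>
     (\<forall>c. \<forall>x\<in>A. \<forall>y\<in>A. br (s c x) y = s c (br x y) \<and> br x (s c y) = s c (br x y))"

definition graded_Lie_algebra ::
  "('k::field_char_0 \<Rightarrow> 'a::ab_group_add \<Rightarrow> 'a) \<Rightarrow> 'a set \<Rightarrow> (int \<Rightarrow> 'a set) \<Rightarrow>
   ('a \<Rightarrow> 'a \<Rightarrow> 'a) \<Rightarrow> bool" where
  "graded_Lie_algebra s A L br \<longleftrightarrow>
     vector_space s \<and> is_grading s A L \<and> bilinear_on s A br \<and>
     (\<forall>i j. \<forall>x\<in>L i. \<forall>y\<in>L j. br x y \<in> L (i + j)) \<and>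
     (\<forall>i j. \<forall>x\<in>L i. \<forall>y\<in>L j. br x y = s (- ksign i j) (br y x)) \<and>
     (\<forall>i j. \<forall>x\<in>L i. \<forall>y\<in>L j. \<forall>z\<in>A.
        br x (br y z) = br (br x y) z + s (ksign i j) (br y (br x z)))"

text \<open>The grading \<open>deg - 2\<close>, for which the bracket has degree \<open>0\<close>.\<close>

definition bisym_grading ::
  "('k::field \<Rightarrow> 'v::ab_group_add \<Rightarrow> 'v) \<Rightarrow> (int \<Rightarrow> 'v set) \<Rightarrow> int \<Rightarrow> ('v, 'k) form set" where
  "bisym_grading scale W d = {F \<in> bisym_forms scale W. form_deg W (d + 2) F}"

text \<open>Letters \<open>\<Omega>, \<alpha>, \<Omega>', \<alpha>'\<close>, of degrees \<open>p, a, p', a'\<close>. The bracket itself has even degree.\<close>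

definition is_bisym_pinczon_bracket ::
  "('k::field \<Rightarrow> 'v::ab_group_add \<Rightarrow> 'v) \<Rightarrow> (int \<Rightarrow> 'v set) \<Rightarrow> ('v \<Rightarrow> 'v \<Rightarrow> 'k) \<Rightarrow>
   (('v, 'k) form \<Rightarrow> ('v, 'k) form \<Rightarrow> ('v, 'k) form) \<Rightarrow> bool" where
  "is_bisym_pinczon_bracket scale W b br \<longleftrightarrow>
     bilinear_on form_scale (bisym_forms scale W) br \<and>
     (\<forall>\<Omega> \<in> sym_forms scale W. \<forall>\<Omega>' \<in> sym_forms scale W.
      \<forall>\<alpha> \<in> sym_bilinear_forms scale W. \<forall>\<alpha>' \<in> sym_bilinear_forms scale W. \<forall>p a p' a'.
        form_deg W p \<Omega> \<and> form_deg W a \<alpha> \<and> form_deg W p' \<Omega>' \<and> form_deg W a' \<alpha>' \<longrightarrow>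
        br (tensor W \<Omega> \<alpha>) (tensor W \<Omega>' \<alpha>') =
          form_scale (koszul [p, a, p', a'] [0, 1, 2, 3])
            (tensor W (sym_prod W \<Omega> (pinczon scale W b \<alpha> \<Omega>')) \<alpha>')
        + form_scale (koszul [p, a, p', a'] [2, 0, 3, 1])
            (tensor W (sym_prod W \<Omega>' (pinczon scale W b \<Omega> \<alpha>')) \<alpha>)
        + form_scale (koszul [p, a, p', a'] [0, 2, 1, 3])
            (tensor W (sym_prod W \<Omega> \<Omega>') (pinczon scale W b \<alpha> \<alpha>')))"

end

theory Submission
  imports Defs "HOL-Library.Multiset"
begin

text \<open>Fix a homogeneous basis of \<open>V\<close>. The coefficients of a form are a function of words in the
  basis, the symmetric product is a signed shuffle product of such functions, and the bracket with
  a bilinear form is a derivation of the shuffle product. All these operations are recursive in the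
  first letter of a word, so their identities are inductions on words.

  A bi-symmetric form \<open>\<Omega> \<otimes> \<alpha>\<close> acts by the operator \<open>h \<mapsto> \<Omega> \<cdot> {\<alpha>, h}\<close>. By the Leibniz rule, and since
  the bilinear forms act as a Lie algebra, the graded commutator of two such operators is the
  operator of the bracket in the theorem. On a suitable module the action is faithful, so the
  bracket inherits antisymmetry and the Jacobi identity from the commutator of operators. It is
  determined by its values on tensors because these span.\<close>

section \<open>Functions of words and the shuffle product\<close>

text \<open>The formula prescribes the bracket on tensors only, and a bi-symmetric form is a sum of
  tensors in many ways, so well-definedness is the obstacle. It is avoided because
  \<open>nabla F\<close> depends on the coefficients of \<open>F\<close> alone: the bracket is the
  unique form with a given operator, and only its existence is checked on tensors. There the three
  terms arise as follows. Let D and D' be the brackets with \<alpha> and \<alpha>'. In \<Omega>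
  D(\<Omega>' D' h) the derivative of \<Omega>' gives the first term, the opposite order gives the
  second, and the second-order terms \<Omega> \<Omega>' D D' h leave the commutator of D and D',
  which is the bracket with {\<alpha>, \<alpha>'}. That last identity depends on the shift:
  \<open>b\<close> is symmetric for the degrees of \<open>V\<close>, but antisymmetric for those of
  \<open>V[1]\<close>. Signs depend on parities only, so homogeneity is mostly tracked modulo 2.
  Exact degrees enter only for the grading: a dual pair has total degree -2 in \<open>V[1]\<close>,
  which is why the bracket lowers degrees by 2.\<close>

lemma ksign_cong: "even (i - i') \<Longrightarrow> even (j - j') \<Longrightarrow> ksign i j = ksign i' j'"
  by (auto simp: ksign_def)

lemma ksign_commute: "ksign i j = ksign j i"
  by (auto simp: ksign_def)

lemma ksign_add_left: "(ksign (i + j) k :: 'k::comm_ring_1) = ksign i k * ksign j k"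
  by (auto simp: ksign_def)

lemma ksign_add_right: "(ksign k (i + j) :: 'k::comm_ring_1) = ksign k i * ksign k j"
  by (auto simp: ksign_def)

lemma ksign_0 [simp]: "ksign 0 j = 1" "ksign j 0 = 1"
  by (auto simp: ksign_def)

lemma ksign_minus [simp]: "ksign (- i) j = ksign i j" "ksign i (- j) = ksign i j"
  by (auto simp: ksign_def)

lemma ksign_square [simp]: "(ksign i j :: 'k::comm_ring_1) * ksign i j = 1"
  "(ksign i j :: 'k::comm_ring_1) * (ksign i j * c) = c"
  by (auto simp: ksign_def)

lemma sum_fun_apply: "(\<Sum>i\<in>I. f i) x = (\<Sum>i\<in>I. f i x)"
  by (induction I rule: infinite_finite_induct) auto

lemma sum_rotate: "(\<Sum>i\<in>A. \<Sum>l\<in>B. \<Sum>j\<in>C. T i l j) = (\<Sum>j\<in>C. \<Sum>i\<in>A. \<Sum>l\<in>B. T i l j)"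
proof -
  have "(\<Sum>i\<in>A. \<Sum>l\<in>B. \<Sum>j\<in>C. T i l j) = (\<Sum>i\<in>A. \<Sum>j\<in>C. \<Sum>l\<in>B. T i l j)"
    by (intro sum.cong refl sum.swap)
  also have "\<dots> = (\<Sum>j\<in>C. \<Sum>i\<in>A. \<Sum>l\<in>B. T i l j)"
    by (rule sum.swap)
  finally show ?thesis .
qed

lemma form_scale_apply: "form_scale c f x = c * f x"
  by (simp add: form_scale_def)

lemma form_scale_1 [simp]: "form_scale 1 (f :: 'a list \<Rightarrow> 'k::comm_ring_1) = f"
  by (rule ext) (simp add: form_scale_apply)

lemma form_scale_0 [simp]: "form_scale 0 (f :: 'a list \<Rightarrow> 'k::comm_ring_1) = 0"
  "form_scale c (0 :: 'a list \<Rightarrow> 'k::comm_ring_1) = 0"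
  by (rule ext, simp add: form_scale_apply)+

lemma form_scale_add: "form_scale c (f + g) = form_scale c f + form_scale c (g :: 'a list \<Rightarrow> 'k::comm_ring_1)"
  "form_scale (c + d) f = form_scale c f + form_scale d f"
  by (rule ext, simp add: form_scale_apply algebra_simps)+

lemma form_scale_sum: "form_scale c (\<Sum>i\<in>I. F i) = (\<Sum>i\<in>I. form_scale c (F i :: 'a list \<Rightarrow> 'k::comm_ring_1))"
  by (rule ext) (simp add: form_scale_apply sum_fun_apply sum_distrib_left)

lemma form_scale_form_scale: "form_scale c (form_scale d (f :: 'a list \<Rightarrow> 'k::comm_ring_1)) = form_scale (c * d) f"
  by (rule ext) (simp add: form_scale_apply algebra_simps)

definition contr :: "'a \<Rightarrow> ('a list \<Rightarrow> 'k) \<Rightarrow> 'a list \<Rightarrow> 'k" where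
  "contr x f = (\<lambda>w. f (x # w))"

lemma contr_simps [simp]:
  fixes f g :: "'a list \<Rightarrow> 'k::comm_ring_1"
  shows "contr x (f + g) = contr x f + contr x g"
    "contr x (f - g) = contr x f - contr x g"
    "contr x (form_scale c f) = form_scale c (contr x f)" "contr x 0 = 0"
    "contr x (\<Sum>i\<in>I. F i) = (\<Sum>i\<in>I. contr x (F i :: 'a list \<Rightarrow> 'k))"
  by (auto simp: contr_def form_scale_def sum_fun_apply)

locale graded_letters =
  fixes dg :: "nat \<Rightarrow> int" and m :: nat
begin

definition wd :: "nat list \<Rightarrow> int" where
  "wd w = sum_list (map dg w)"

lemma wd_simps [simp]: "wd [] = 0" "wd (x # w) = dg x + wd w" "wd (u @ v) = wd u + wd v"
  by (simp_all add: wd_def)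

text \<open>The sign of moving a letter of degree \<open>d\<close> across the whole word. On a
  function of definite parity it is a scalar (\<open>twist_parity\<close>), so it expresses the sign
  of passing the form itself, also for inhomogeneous forms.\<close>

definition twist :: "int \<Rightarrow> (nat list \<Rightarrow> 'k::comm_ring_1) \<Rightarrow> nat list \<Rightarrow> 'k" where
  "twist d f = (\<lambda>w. ksign d (wd w) * f w)"

lemma twist_simps [simp]:
  "twist d (f + g) = twist d f + twist d g"
  "twist d (form_scale c f) = form_scale c (twist d f)" "twist d 0 = 0"
  "twist d (\<Sum>i\<in>I. F i) = (\<Sum>i\<in>I. twist d (F i))"
  by (auto simp: twist_def form_scale_def sum_fun_apply algebra_simps sum_distrib_left)

lemma twist_twist: "twist d (twist d' f) = twist (d + d') f"
  by (rule ext) (simp add: twist_def ksign_add_left mult.assoc)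

lemma twist_commute: "twist d (twist d' f) = twist d' (twist d f)"
  by (simp add: twist_twist add.commute)

lemma twist_cong: "even (d - d') \<Longrightarrow> twist d f = twist d' f"
  by (rule ext) (simp add: twist_def ksign_cong[of d d'])

lemma twist_self [simp]: "twist d (twist d f) = f"
  by (rule ext) (simp add: twist_def)

lemma contr_twist: "contr x (twist d f) = form_scale (ksign d (dg x)) (twist d (contr x f))"
  by (rule ext) (simp add: contr_def twist_def form_scale_def ksign_add_right mult.assoc)

text \<open>The first letter goes to \<open>g\<close> without a sign, or to \<open>f\<close> with a
  sign against everything that \<open>g\<close> receives. The Koszul rule gives exactly this because
  \<open>g\<close> is itself a letter whose degree is opposite to that of its arguments; see
  \<open>koszul_split\<close>.\<close>

fun shuf :: "(nat list \<Rightarrow> 'k::comm_ring_1) \<Rightarrow> (nat list \<Rightarrow> 'k) \<Rightarrow> nat list \<Rightarrow> 'k" where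
  "shuf f g [] = f [] * g []"
| "shuf f g (x # w) = shuf f (contr x g) w + shuf (contr x f) (twist (dg x) g) w"

lemma contr_shuf: "contr x (shuf f g) = shuf f (contr x g) + shuf (contr x f) (twist (dg x) g)"
  by (rule ext) (simp add: contr_def[of x "shuf f g"])

lemma shuf_add_left: "shuf (f + f') g = shuf f g + shuf f' g"
proof (rule ext)
  fix w show "shuf (f + f') g w = (shuf f g + shuf f' g) w"
    by (induction w arbitrary: f f' g) (auto simp: algebra_simps)
qed

lemma shuf_add_right: "shuf f (g + g') = shuf f g + shuf f g'"
proof (rule ext)
  fix w show "shuf f (g + g') w = (shuf f g + shuf f g') w"
    by (induction w arbitrary: f g g') (auto simp: algebra_simps)
qed

lemma shuf_scale_left: "shuf (form_scale c f) g = form_scale c (shuf f g)"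
proof (rule ext)
  fix w show "shuf (form_scale c f) g w = form_scale c (shuf f g) w"
    by (induction w arbitrary: f g) (auto simp: algebra_simps form_scale_apply)
qed

lemma shuf_scale_right: "shuf f (form_scale c g) = form_scale c (shuf f g)"
proof (rule ext)
  fix w show "shuf f (form_scale c g) w = form_scale c (shuf f g) w"
    by (induction w arbitrary: f g) (auto simp: algebra_simps form_scale_apply)
qed

lemma shuf_zero [simp]: "shuf 0 g = 0" "shuf f 0 = 0"
  using shuf_scale_left[of 0 0 g] shuf_scale_right[of f 0 0] by auto

lemma shuf_sum_left: "shuf (\<Sum>i\<in>I. F i) g = (\<Sum>i\<in>I. shuf (F i) g)"
  by (induction I rule: infinite_finite_induct)
    (simp_all only: sum.infinite sum.empty sum.insert shuf_add_left shuf_zero not_False_eq_True)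

lemma shuf_sum_right: "shuf f (\<Sum>i\<in>I. G i) = (\<Sum>i\<in>I. shuf f (G i))"
  by (induction I rule: infinite_finite_induct)
    (simp_all only: sum.infinite sum.empty sum.insert shuf_add_right shuf_zero not_False_eq_True)

lemma twist_shuf: "twist d (shuf f g) = shuf (twist d f) (twist d g)"
proof (rule ext)
  fix w show "twist d (shuf f g) w = shuf (twist d f) (twist d g) w"
  proof (induction w arbitrary: f g)
    case Nil
    then show ?case by (simp add: twist_def)
  next
    case (Cons x w)
    have "twist d (shuf f g) (x # w) = ksign d (dg x) *
        (twist d (shuf f (contr x g)) w + twist d (shuf (contr x f) (twist (dg x) g)) w)"
      by (simp add: twist_def ksign_add_right algebra_simps)
    then show ?case
      by (simp add: Cons contr_twist shuf_scale_left shuf_scale_right form_scale_apply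
          twist_commute[of "dg x" d] algebra_simps)
  qed
qed

lemma shuf_assoc: "shuf f (shuf g h) = shuf (shuf f g) h"
proof (rule ext)
  fix w show "shuf f (shuf g h) w = shuf (shuf f g) h w"
    by (induction w arbitrary: f g h)
      (simp_all add: mult.assoc contr_shuf shuf_add_left shuf_add_right twist_shuf algebra_simps)
qed

text \<open>A form has the degree opposite to that of the words on which it is nonzero;
  \<open>p\<close> is that degree modulo 2, which is all that signs can see.\<close>

definition parity :: "int \<Rightarrow> (nat list \<Rightarrow> 'k::zero) \<Rightarrow> bool" where
  "parity p f \<longleftrightarrow> (\<forall>w. f w \<noteq> 0 \<longrightarrow> even (p + wd w))"

lemma parity_contr: "parity p f \<Longrightarrow> parity (p + dg x) (contr x f)"
  unfolding parity_def contr_def by (metis add.assoc wd_simps(2))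

lemma twist_parity: "parity p f \<Longrightarrow> twist d f = form_scale (ksign d p) f"
proof (rule ext)
  fix w assume "parity p f"
  then have "f w = 0 \<or> even (p + wd w)" by (auto simp: parity_def)
  then show "twist d f w = form_scale (ksign d p) f w"
    by (auto simp: twist_def form_scale_apply ksign_def)
qed

text \<open>The two summands of the recursion exchange roles. \<open>twist_parity\<close> turns the
  twists into scalars, and contracting by \<open>x\<close> shifts the parity by \<open>dg x\<close>,
  which accounts for the signs.\<close>

lemma shuf_commute:
  assumes "parity p f" "parity q g"
  shows "shuf f g = form_scale (ksign p q) (shuf g f)"
proof (rule ext)
  fix w show "shuf f g w = form_scale (ksign p q) (shuf g f) w"
    using assms
  proof (induction w arbitrary: f g p q)
    case Nil
    then have "(f [] = 0 \<or> even p) " by (auto simp: parity_def)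
    then show ?case by (auto simp: form_scale_apply ksign_def)
  next
    case (Cons x w)
    have 1: "shuf f (contr x g) w = form_scale (ksign p (q + dg x)) (shuf (contr x g) f) w"
      using Cons.prems by (intro Cons.IH parity_contr)
    have 2: "shuf (contr x f) g w = form_scale (ksign (p + dg x) q) (shuf g (contr x f)) w"
      using Cons.prems by (intro Cons.IH parity_contr)
    show ?case
      using 1 2 by (simp add: form_scale_apply twist_parity[OF Cons.prems(1)] twist_parity[OF Cons.prems(2)]
        shuf_scale_left shuf_scale_right ksign_add_left ksign_add_right algebra_simps ksign_commute[of "dg x"])
  qed
qed

text \<open>Replaces one letter at a time, \<open>x\<close> by the combination of the
  \<open>k\<close> with coefficients \<open>A k x\<close>, as a derivation of degree
  \<open>a\<close> acting from the left. Its sign against \<open>h\<close>, whose degree is opposite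
  to that of the whole new word, and against the letters before the replaced one reduces to the sign
  against the new letter and those after it.\<close>

fun der :: "int \<Rightarrow> (nat \<Rightarrow> nat \<Rightarrow> 'k::comm_ring_1) \<Rightarrow> (nat list \<Rightarrow> 'k) \<Rightarrow> nat list \<Rightarrow> 'k" where
  "der a A h [] = 0"
| "der a A h (x # w) = (\<Sum>k<m. A k x * twist a h (k # w)) + der a A (contr x h) w"

lemma contr_der:
  "contr x (der a A h) = der a A (contr x h) + (\<Sum>k<m. form_scale (A k x) (contr k (twist a h)))"
  by (rule ext) (simp add: contr_def sum_fun_apply form_scale_def add.commute)

lemma der_add: "der a A (f + g) = der a A f + der a A g"
proof (rule ext)
  fix w show "der a A (f + g) w = (der a A f + der a A g) w"
    by (induction w arbitrary: f g) (auto simp: algebra_simps sum.distrib)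
qed

lemma der_scale: "der a A (form_scale c f) = form_scale c (der a A f)"
proof (rule ext)
  fix w show "der a A (form_scale c f) w = form_scale c (der a A f) w"
    by (induction w arbitrary: f) (auto simp: algebra_simps form_scale_apply sum_distrib_left)
qed

lemma der_zero [simp]: "der a A 0 = 0"
  using der_scale[of a A 0 0] by auto

lemma der_sum: "der a A (\<Sum>i\<in>I. F i) = (\<Sum>i\<in>I. der a A (F i))"
  by (induction I rule: infinite_finite_induct)
    (simp_all only: sum.infinite sum.empty sum.insert der_add der_zero not_False_eq_True)

lemma der_mat_sum:
  "der a (\<lambda>k x. \<Sum>i\<in>I. c i * A i k x) f = (\<Sum>i\<in>I. form_scale (c i) (der a (A i) f))"
proof (rule ext)
  fix w show "der a (\<lambda>k x. \<Sum>i\<in>I. c i * A i k x) f w = (\<Sum>i\<in>I. form_scale (c i) (der a (A i) f)) w"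
  proof (induction w arbitrary: f)
    case (Cons x w)
    then show ?case
      by (simp add: sum_fun_apply form_scale_apply algebra_simps sum.distrib sum_distrib_left sum_distrib_right)
        (rule sum.swap)
  qed (simp add: sum_fun_apply form_scale_apply)
qed

lemma der_cong:
  assumes "even (a - a')" "\<And>k x. k < m \<Longrightarrow> A k x = A' k x"
  shows "der a A f = der a' A' f"
proof (rule ext)
  fix w show "der a A f w = der a' A' f w"
    using assms by (induction w arbitrary: f) (auto simp: twist_cong[of a a'])
qed

text \<open>Modulo 2 a degree equals its negative, so one condition says both that the bilinear form
  with coefficients \<open>A\<close> has degree \<open>a\<close> and that replacing \<open>x\<close>
  by \<open>k\<close> changes the degree by \<open>a\<close>.\<close>

definition hom_mat :: "int \<Rightarrow> (nat \<Rightarrow> nat \<Rightarrow> 'k::zero) \<Rightarrow> bool" where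
  "hom_mat a A \<longleftrightarrow> (\<forall>k x. A k x \<noteq> 0 \<longrightarrow> even (a + dg k + dg x))"

lemma der_twist:
  assumes A: "hom_mat a A"
  shows "der a A (twist d f) = form_scale (ksign d a) (twist d (der a A f))"
proof (rule ext)
  fix w show "der a A (twist d f) w = form_scale (ksign d a) (twist d (der a A f)) w"
  proof (induction w arbitrary: f)
    case Nil
    then show ?case by (simp add: twist_def form_scale_apply)
  next
    case (Cons x w)
    have "A k x * twist a (twist d f) (k # w) =
        ksign d a * (ksign d (dg x + wd w) * (A k x * twist a f (k # w)))" for k
    proof (cases "A k x = 0")
      case False
      then have "even (a + dg k + dg x)" using A by (auto simp: hom_mat_def)
      then show ?thesis by (auto simp: twist_def ksign_def)
    qed simp
    then show ?case
      by (simp add: contr_twist der_scale Cons form_scale_apply sum_distrib_left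
          twist_def[of d "der _ _ _"] ksign_add_right algebra_simps)
  qed
qed

lemma twist_der:
  assumes A: "hom_mat a A"
  shows "twist d (der a A f) = form_scale (ksign d a) (der a A (twist d f))"
  by (simp add: der_twist[OF A] form_scale_form_scale)

lemma der_shuf:
  assumes A: "hom_mat a A"
  shows "der a A (shuf f g) = shuf (der a A f) g + shuf (twist a f) (der a A g)"
proof (rule ext)
  fix w show "der a A (shuf f g) w = (shuf (der a A f) g + shuf (twist a f) (der a A g)) w"
  proof (induction w arbitrary: f g)
    case (Cons x w)
    \<comment> \<open>Where \<open>A k x\<close> is nonzero, the new letter \<open>k\<close> and the
      operator together have the parity of the replaced letter \<open>x\<close>, so passing
      \<open>g\<close> costs the same sign.\<close>
    have tw: "form_scale (A k x) (shuf (contr k (twist a f)) (twist (dg k) (twist a g))) =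
        form_scale (A k x) (shuf (contr k (twist a f)) (twist (dg x) g))" for k
    proof (cases "A k x = 0")
      case False
      then have "even (a + dg k + dg x)" using A by (auto simp: hom_mat_def)
      then have "twist (dg k + a) g = twist (dg x) g"
        by (intro twist_cong) auto
      then show ?thesis by (simp add: twist_twist)
    qed simp
    have "(\<Sum>k<m. A k x * twist a (shuf f g) (k # w)) =
       (\<Sum>k<m. form_scale (A k x) (contr k (twist a (shuf f g)))) w"
      by (simp add: contr_def sum_fun_apply form_scale_apply)
    also have "\<dots> = (\<Sum>k<m. form_scale (A k x) (shuf (twist a f) (contr k (twist a g)))) w
        + (\<Sum>k<m. form_scale (A k x) (shuf (contr k (twist a f)) (twist (dg k) (twist a g)))) w"
      by (simp add: twist_shuf contr_shuf sum_fun_apply sum.distrib form_scale_apply algebra_simps)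
    finally have 1: "(\<Sum>k<m. A k x * twist a (shuf f g) (k # w)) =
        shuf (twist a f) (\<Sum>k<m. form_scale (A k x) (contr k (twist a g))) w
        + shuf (\<Sum>k<m. form_scale (A k x) (contr k (twist a f))) (twist (dg x) g) w"
      by (simp only: tw shuf_sum_left shuf_sum_right shuf_scale_left shuf_scale_right)
    have tau: "shuf (twist a (contr x f)) (der a A (twist (dg x) g)) =
        shuf (contr x (twist a f)) (twist (dg x) (der a A g))"
      by (simp only: der_twist[OF A] contr_twist shuf_scale_left shuf_scale_right ksign_commute[of "dg x" a])
    have 2: "der a A (contr x (shuf f g)) w =
        shuf (der a A f) (contr x g) w + shuf (twist a f) (der a A (contr x g)) w +
        shuf (der a A (contr x f)) (twist (dg x) g) w +
        shuf (contr x (twist a f)) (twist (dg x) (der a A g)) w"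
      by (simp add: contr_shuf der_add Cons tau)
    show ?case
      by (simp add: 1 2 contr_der shuf_add_left shuf_add_right algebra_simps)
  qed simp
qed

text \<open>Replacements at two different positions cancel in the graded commutator; what survives
  is replacing the same letter twice. The outer operator acts on the given letter first, so the
  composite of \<open>der a A\<close> after \<open>der b B\<close> has \<open>A\<close> as the right
  factor of its matrix product.\<close>

lemma der_commutator:
  fixes A B :: "nat \<Rightarrow> nat \<Rightarrow> 'k::comm_ring_1"
  assumes A: "hom_mat a A" and B: "hom_mat b B"
  shows "der a A (der b B f) - form_scale (ksign a b) (der b B (der a A f)) =
    der (a + b) (\<lambda>l x. ksign a b * (\<Sum>k<m. B l k * A k x) - (\<Sum>k<m. A l k * B k x)) f"
    (is "_ = der _ ?C f")
proof (rule ext)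
  \<comment> \<open>Four groups: both replacements behind the first letter, just one of them on it
    (in two ways), both on it. The matrices are arbitrary because the expansion is used in both
    orders, where the mixed groups cancel crosswise.\<close>
  have exp: "contr x (der a A (der b B f)) = der a A (der b B (contr x f))
      + (\<Sum>k<m. form_scale (B k x) (der a A (contr k (twist b f))))
      + form_scale (ksign a b) (\<Sum>k<m. form_scale (A k x) (der b B (contr k (twist a f))))
      + form_scale (ksign a b) (\<Sum>l<m. form_scale (\<Sum>k<m. B l k * A k x) (contr l (twist (a + b) f)))"
    if A: "hom_mat a A" and B: "hom_mat b B" for a b x f and A B :: "nat \<Rightarrow> nat \<Rightarrow> 'k"
  proof -
    have "(\<Sum>k<m. form_scale (A k x) (\<Sum>l<m. form_scale (B l k) (contr l (twist b (twist a f))))) v =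
        (\<Sum>l<m. form_scale (\<Sum>k<m. B l k * A k x) (contr l (twist (a + b) f))) v" for v
    proof -
      have "(\<Sum>k<m. form_scale (A k x) (\<Sum>l<m. form_scale (B l k) (contr l (twist b (twist a f))))) v =
        (\<Sum>k<m. \<Sum>l<m. B l k * A k x * contr l (twist (a + b) f) v)"
        by (simp add: sum_fun_apply form_scale_apply sum_distrib_left twist_twist add.commute mult_ac)
      also have "\<dots> = (\<Sum>l<m. \<Sum>k<m. B l k * A k x * contr l (twist (a + b) f) v)"
        by (rule sum.swap)
      finally show ?thesis
        by (simp add: sum_fun_apply form_scale_apply sum_distrib_right)
    qed
    then have dbl: "(\<Sum>k<m. form_scale (A k x) (\<Sum>l<m. form_scale (B l k) (contr l (twist b (twist a f))))) =
        (\<Sum>l<m. form_scale (\<Sum>k<m. B l k * A k x) (contr l (twist (a + b) f)))" ..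
    have "(\<Sum>k<m. form_scale (A k x) (contr k (twist a (der b B f)))) =
       form_scale (ksign a b) ((\<Sum>k<m. form_scale (A k x) (der b B (contr k (twist a f)))) +
        (\<Sum>k<m. form_scale (A k x) (\<Sum>l<m. form_scale (B l k) (contr l (twist b (twist a f))))))"
      unfolding twist_der[OF B] contr_simps contr_der
      by (rule ext) (simp add: sum_fun_apply form_scale_apply sum.distrib sum_distrib_left algebra_simps)
    then have "(\<Sum>k<m. form_scale (A k x) (contr k (twist a (der b B f)))) =
       form_scale (ksign a b) (\<Sum>k<m. form_scale (A k x) (der b B (contr k (twist a f)))) +
       form_scale (ksign a b) (\<Sum>l<m. form_scale (\<Sum>k<m. B l k * A k x) (contr l (twist (a + b) f)))"
      by (simp only: dbl form_scale_add)
    then show ?thesis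
      by (simp only: contr_der der_add der_sum der_scale add.assoc)
  qed
  fix w show "(der a A (der b B f) - form_scale (ksign a b) (der b B (der a A f))) w = der (a + b) ?C f w"
  proof (induction w arbitrary: f)
    case Nil
    then show ?case by (simp add: form_scale_apply)
  next
    case (Cons x w)
    have 1: "(der a A (der b B f) - form_scale (ksign a b) (der b B (der a A f))) (x # w) =
       contr x (der a A (der b B f)) w - ksign a b * contr x (der b B (der a A f)) w"
      by (simp add: contr_def form_scale_apply)
    have 2: "der (a + b) ?C f (x # w) = (\<Sum>k<m. ?C k x * twist (a + b) f (k # w)) +
       (der a A (der b B (contr x f)) - form_scale (ksign a b) (der b B (der a A (contr x f)))) w"
      using Cons by simp
    show ?case unfolding 1 2 exp[OF A B] exp[OF B A]
      by (simp add: form_scale_apply sum_fun_apply ksign_commute[of b a] add.commute[of b a]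
          contr_def[of _ "twist (a + b) f"] sum_subtractf sum_distrib_left algebra_simps)
  qed
qed

text \<open>The first letter of a word plays a special role: it always goes to \<open>h\<close>. So \<open>h\<close>
  ranges over linear forms with coefficients in functions of words; this module is faithful for
  the operators \<open>nabla F\<close> below, whereas symmetric forms alone are not.\<close>

definition mshuf :: "(nat list \<Rightarrow> 'k::comm_ring_1) \<Rightarrow> (nat list \<Rightarrow> 'k) \<Rightarrow> nat list \<Rightarrow> 'k" where
  "mshuf f h w = (case w of [] \<Rightarrow> 0 | k # v \<Rightarrow> shuf f (contr k h) v)"

lemma mshuf_simps [simp]: "mshuf f h [] = 0" "mshuf f h (k # w) = shuf f (contr k h) w"
  by (simp_all add: mshuf_def)

lemma contr_mshuf: "contr k (mshuf f h) = shuf f (contr k h)"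
  by (simp add: contr_def)

lemma word_eqI: "f [] = g [] \<Longrightarrow> (\<And>k. contr k f = contr k g) \<Longrightarrow> f = g"
  unfolding contr_def by (rule ext, case_tac x) (auto dest: fun_cong)

lemma mshuf_add_left: "mshuf (f + f') h = mshuf f h + mshuf f' h"
  and mshuf_add_right: "mshuf f (h + h') = mshuf f h + mshuf f h'"
  and mshuf_scale_left: "mshuf (form_scale c f) h = form_scale c (mshuf f h)"
  and mshuf_scale_right: "mshuf f (form_scale c h) = form_scale c (mshuf f h)"
  and mshuf_assoc: "mshuf f (mshuf g h) = mshuf (shuf f g) h"
  by (rule word_eqI; simp add: contr_mshuf shuf_add_left shuf_add_right shuf_scale_left
    shuf_scale_right form_scale_apply shuf_assoc)+

lemma mshuf_zero [simp]: "mshuf 0 h = 0" "mshuf f 0 = 0"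
  using mshuf_scale_left[of 0 0 h] mshuf_scale_right[of f 0 0] by auto

lemma mshuf_sum_right: "mshuf f (\<Sum>i\<in>I. G i) = (\<Sum>i\<in>I. mshuf f (G i))"
  by (induction I rule: infinite_finite_induct)
    (simp_all only: sum.infinite sum.empty sum.insert mshuf_add_right mshuf_zero not_False_eq_True)

lemma twist_mshuf: "twist d (mshuf f h) = mshuf (twist d f) (twist d h)"
  by (rule word_eqI) (simp_all add: contr_twist contr_mshuf twist_shuf shuf_scale_right, simp add: twist_def)

text \<open>The distinguished first letter is replaced inside \<open>h\<close> only, so the Leibniz
  rule for \<open>shuf\<close> carries over.\<close>

lemma der_mshuf:
  assumes A: "hom_mat a A"
  shows "der a A (mshuf f h) = mshuf (der a A f) h + mshuf (twist a f) (der a A h)"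
  by (rule word_eqI)
    (simp_all add: contr_der contr_mshuf twist_mshuf der_shuf[OF A] shuf_add_right shuf_sum_right shuf_scale_right)

text \<open>The commutator of first-order operators has first order. The Leibniz rule splits each
  composite into a term that differentiates the coefficient and a second-order term; once the
  coefficients are exchanged by \<open>shuf_commute\<close>, the second-order terms combine into the
  commutator of the derivations.\<close>

lemma mshuf_der_commutator:
  fixes A A' :: "nat \<Rightarrow> nat \<Rightarrow> 'k::comm_ring_1"
  assumes A: "hom_mat a A" and A': "hom_mat a' A'" and p: "parity p \<Omega>" and p': "parity p' \<Omega>'"
  shows "mshuf \<Omega> (der a A (mshuf \<Omega>' (der a' A' h)))
      - form_scale (ksign (p + a) (p' + a')) (mshuf \<Omega>' (der a' A' (mshuf \<Omega> (der a A h)))) =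
    mshuf (shuf \<Omega> (der a A \<Omega>')) (der a' A' h)
      - form_scale (ksign (p + a) (p' + a')) (mshuf (shuf \<Omega>' (der a' A' \<Omega>)) (der a A h))
      + form_scale (ksign a p') (mshuf (shuf \<Omega> \<Omega>')
          (der (a + a') (\<lambda>l x. ksign a a' * (\<Sum>k<m. A' l k * A k x) - (\<Sum>k<m. A l k * A' k x)) h))"
proof -
  have 1: "mshuf \<Omega> (der a A (mshuf \<Omega>' (der a' A' h))) =
    mshuf (shuf \<Omega> (der a A \<Omega>')) (der a' A' h)
      + form_scale (ksign a p') (mshuf (shuf \<Omega> \<Omega>') (der a A (der a' A' h)))"
    if "hom_mat a A" "parity p' \<Omega>'" for a A p' a' A' \<Omega> \<Omega>'
    using that by (simp only: der_mshuf twist_parity mshuf_add_right mshuf_assoc mshuf_scale_left mshuf_scale_right)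
  have 2: "shuf \<Omega>' \<Omega> = form_scale (ksign p p') (shuf \<Omega> \<Omega>')"
    using shuf_commute[OF p' p] by (simp only: ksign_commute)
  have 3: "ksign (p + a) (p' + a') * (ksign a' p * ksign p p') = ksign a p' * (ksign a a' :: 'k)"
    by (auto simp: ksign_def)
  have "form_scale (ksign (p + a) (p' + a')) (form_scale (ksign a' p)
       (mshuf (shuf \<Omega>' \<Omega>) (der a' A' (der a A h)))) =
     form_scale (ksign a p') (mshuf (shuf \<Omega> \<Omega>') (form_scale (ksign a a') (der a' A' (der a A h))))"
    by (simp only: 2 3 mshuf_scale_left mshuf_scale_right form_scale_form_scale)
  then show ?thesis
    unfolding 1[OF A p'] 1[OF A' p] der_commutator[OF A A', symmetric] form_scale_add
    using mshuf_add_right[of "shuf \<Omega> \<Omega>'" "der a A (der a' A' h) - form_scale (ksign a a') (der a' A' (der a A h))"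
       "form_scale (ksign a a') (der a' A' (der a A h))"]
    by (auto simp: form_scale_add fun_eq_iff form_scale_apply algebra_simps)
qed

end

section \<open>The action of bi-symmetric forms on words\<close>

text \<open>\<open>cas\<close> holds the coefficients of \<open>\<Sum>\<^sub>i e\<^sub>i \<otimes> e'\<^sub>i\<close> in the basis \<open>e\<^sub>i \<otimes> e\<^sub>j\<close>; it is
  antisymmetric in the graded sense of the shifted degrees \<open>dg\<close>.\<close>

locale casimir_letters = graded_letters dg m for dg m +
  fixes cas :: "nat \<Rightarrow> nat \<Rightarrow> 'k::comm_ring_1" and bm :: "nat \<Rightarrow> nat \<Rightarrow> 'k"
  assumes cas_bm: "i < m \<Longrightarrow> k < m \<Longrightarrow> (\<Sum>l<m. cas i l * bm k l) = (if i = k then 1 else 0)"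
    and cas_swap: "i < m \<Longrightarrow> j < m \<Longrightarrow> cas i j = - ksign (dg i) (dg j) * cas j i"
    and cas_parity: "i < m \<Longrightarrow> j < m \<Longrightarrow> cas i j \<noteq> 0 \<Longrightarrow> even (dg i + dg j)"
begin

text \<open>In coordinates, \<open>der a (act \<alpha>)\<close> is the bracket with the bilinear form \<open>\<alpha>\<close> of degree \<open>a\<close>.\<close>

definition act :: "(nat \<Rightarrow> nat \<Rightarrow> 'k) \<Rightarrow> nat \<Rightarrow> nat \<Rightarrow> 'k" where
  "act \<alpha> k x = (if k < m \<and> x < m then \<Sum>i<m. ksign (dg x) (dg k) * \<alpha> i x * cas i k else 0)"

lemma hom_mat_act:
  assumes "hom_mat a \<alpha>"
  shows "hom_mat a (act \<alpha>)"
  unfolding hom_mat_def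
proof (intro allI impI)
  fix k x assume "act \<alpha> k x \<noteq> 0"
  then obtain i where "i < m" "k < m" "\<alpha> i x \<noteq> 0" "cas i k \<noteq> 0"
    by (auto simp: act_def elim!: sum.not_neutral_contains_not_neutral split: if_splits)
      (metis mult_zero_left mult_zero_right)
  with assms cas_parity[of i k] have "even (a + dg i + dg x)" "even (dg i + dg k)"
    by (auto simp: hom_mat_def)
  then show "even (a + dg k + dg x)" by presburger
qed

definition eps :: "nat \<Rightarrow> nat \<Rightarrow> nat \<Rightarrow> nat \<Rightarrow> 'k" where
  "eps i j l x = (if l = i \<and> x = j then 1 else 0)"

lemma act_eps: "i < m \<Longrightarrow> act (eps i j) k x =
    (if k < m \<and> x < m \<and> x = j then ksign (dg x) (dg k) * cas i k else 0)"
  by (auto simp: act_def eps_def if_distrib if_distribR cong: if_cong)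

lemma act_expand: "act \<alpha> k x = (\<Sum>i<m. \<Sum>j<m. \<alpha> i j * act (eps i j) k x)"
proof -
  have "(\<Sum>i<m. \<Sum>j<m. \<alpha> i j * act (eps i j) k x) =
     (\<Sum>i<m. \<Sum>j<m. if j = x then (if k < m \<and> x < m then ksign (dg x) (dg k) * \<alpha> i x * cas i k else 0) else 0)"
    by (intro sum.cong refl) (auto simp: act_eps)
  also have "\<dots> = act \<alpha> k x"
    by (cases "x < m") (simp_all add: act_def)
  finally show ?thesis ..
qed

text \<open>The sign undoes the one that \<open>tensor\<close> introduces when the bilinear factor
  passes the arguments of the first factor. So the coefficient of a tensor is
  \<open>\<alpha> i j\<close> times \<Omega>, without sign.\<close>

definition coe :: "(nat list \<Rightarrow> 'k) \<Rightarrow> nat \<Rightarrow> nat \<Rightarrow> nat list \<Rightarrow> 'k" where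
  "coe F i j = (\<lambda>v. ksign (dg i + dg j) (wd v) * F (v @ [i, j]))"

lemma coe_simps [simp]: "coe (F + G) i j = coe F i j + coe G i j"
  "coe (form_scale c F) i j = form_scale c (coe F i j)" "coe 0 i j = 0"
  by (auto simp: coe_def form_scale_def algebra_simps)

text \<open>If \<open>F\<close> stands for \<open>\<Omega> \<otimes> \<alpha>\<close>, then \<open>nabla F\<close> is the bracket with \<open>\<alpha>\<close> followed by the product
  with \<open>\<Omega>\<close>; this formula is linear in \<open>F\<close> and so makes sense for all bi-symmetric forms.\<close>

definition nabla :: "(nat list \<Rightarrow> 'k) \<Rightarrow> (nat list \<Rightarrow> 'k) \<Rightarrow> nat list \<Rightarrow> 'k" where
  "nabla F h = (\<Sum>i<m. \<Sum>j<m. mshuf (coe F i j) (der (dg i + dg j) (act (eps i j)) h))"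

lemma nabla_add_left: "nabla (F + G) h = nabla F h + nabla G h"
  by (simp add: nabla_def mshuf_add_left sum.distrib)

lemma nabla_add_right: "nabla F (h + h') = nabla F h + nabla F h'"
  by (simp add: nabla_def der_add mshuf_add_right sum.distrib)

lemma nabla_scale_left: "nabla (form_scale c F) h = form_scale c (nabla F h)"
  by (simp add: nabla_def mshuf_scale_left form_scale_sum)

lemma nabla_scale_right: "nabla F (form_scale c h) = form_scale c (nabla F h)"
  by (simp add: nabla_def der_scale mshuf_scale_right form_scale_sum)

lemma nabla_zero [simp]: "nabla 0 h = 0" "nabla F 0 = 0"
  by (simp_all add: nabla_def)

lemma nabla_tensor:
  assumes "\<And>i j. i < m \<Longrightarrow> j < m \<Longrightarrow> coe F i j = form_scale (\<alpha> i j) \<Omega>" and \<alpha>: "hom_mat a \<alpha>"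
  shows "nabla F h = mshuf \<Omega> (der a (act \<alpha>) h)"
proof -
  \<comment> \<open>A matrix unit at \<open>i\<close>, \<open>j\<close> has degree
    \<open>dg i + dg j\<close>, which has the parity of \<open>a\<close> wherever \<alpha> has a
    nonzero entry. With a common degree, the sum over matrix units recombines by linearity in the
    matrix.\<close>
  have "form_scale (\<alpha> i j) (der (dg i + dg j) A h) = form_scale (\<alpha> i j) (der a A h)" for i j A
  proof (cases "\<alpha> i j = 0")
    case False
    with \<alpha> have "even (a + dg i + dg j)" by (auto simp: hom_mat_def)
    then have "der (dg i + dg j) A h = der a A h" by (intro der_cong) auto
    then show ?thesis by simp
  qed simp
  then have "nabla F h = mshuf \<Omega> (\<Sum>i<m. \<Sum>j<m. form_scale (\<alpha> i j) (der a (act (eps i j)) h))"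
    by (simp add: nabla_def assms(1) mshuf_sum_right mshuf_scale_left mshuf_scale_right[symmetric])
  also have "(\<Sum>i<m. \<Sum>j<m. form_scale (\<alpha> i j) (der a (act (eps i j)) h)) =
      (\<Sum>i<m. form_scale 1 (der a (\<lambda>k x. \<Sum>j<m. \<alpha> i j * act (eps i j) k x) h))"
    by (simp add: der_mat_sum)
  also have "\<dots> = der a (\<lambda>k x. \<Sum>i<m. 1 * (\<Sum>j<m. \<alpha> i j * act (eps i j) k x)) h"
    by (rule der_mat_sum[symmetric])
  also have "\<dots> = der a (act \<alpha>) h"
    by (rule der_cong) (simp_all add: act_expand[symmetric])
  finally show ?thesis .
qed

lemma shuf_const: "(\<And>w. w \<noteq> [] \<Longrightarrow> g w = 0) \<Longrightarrow> shuf f g w = f w * g []"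
proof (induction w arbitrary: f g)
  case (Cons x w)
  have "contr x g = 0" using Cons.prems by (auto simp: contr_def)
  moreover have "shuf (contr x f) (twist (dg x) g) w = contr x f w * twist (dg x) g []"
    by (rule Cons.IH) (auto simp: twist_def Cons.prems)
  ultimately show ?case by (simp add: twist_def contr_def)
qed simp

lemma der_length: "(\<And>w. length w \<noteq> n \<Longrightarrow> h w = 0) \<Longrightarrow> length w \<noteq> n \<Longrightarrow> der a A h w = 0"
proof (induction w arbitrary: h n)
  case (Cons x w)
  have "der a A (contr x h) w = 0"
  proof (cases n)
    case 0
    then have "contr x h = 0" by (intro ext) (auto simp: contr_def Cons.prems)
    then show ?thesis by simp
  next
    case (Suc n')
    then show ?thesis using Cons.prems by (intro Cons.IH[of n']) (auto simp: contr_def)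
  qed
  moreover have "twist a h (k # w) = 0" for k
    using Cons.prems by (simp add: twist_def)
  ultimately show ?case by simp
qed simp

text \<open>Testing on the indicators of one-letter words suffices.\<close>

lemma nabla_faithful:
  assumes "\<And>h. nabla F h = 0" and "k < m" "x < m"
  shows "F (w @ [k, x]) = 0"
proof -
  have *: "(\<Sum>i<m. coe F i x w * cas i l) = 0" if l: "l < m" for l
  proof -
    define h :: "nat list \<Rightarrow> 'k" where "h = (\<lambda>v. if v = [l] then 1 else 0)"
    have h: "der a A h (y # v) = (if v = [] then A l y * ksign a (dg l) else 0)" for a A y v
    proof (cases "v = []")
      case True
      have "(\<Sum>k<m. A k y * twist a h [k]) = (\<Sum>k<m. if k = l then A l y * ksign a (dg l) else 0)"
        by (rule sum.cong) (auto simp: h_def twist_def)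
      with True l show ?thesis by simp
    next
      case False
      have "der a A h (y # v) = 0"
        by (rule der_length[of 1]) (use False in \<open>auto simp: h_def\<close>)
      with False show ?thesis by simp
    qed
    \<comment> \<open>The derivative of a one-letter indicator is again supported on one-letter
      words; once its letter is split off it is a constant, and the shuffle product becomes an
      ordinary multiple.\<close>
    have "mshuf f (der a A h) (x # w) = f w * A l x * ksign a (dg l)" for f a A
      using shuf_const[of "contr x (der a A h)" f w] by (simp add: contr_def h del: der.simps)
    then have "nabla F h (x # w) =
        (\<Sum>i<m. \<Sum>j<m. coe F i j w * act (eps i j) l x * ksign (dg i + dg j) (dg l))"
      by (simp add: nabla_def sum_fun_apply)
    \<comment> \<open>Only \<open>j = x\<close> contributes. The remaining sign depends on
      \<open>l\<close> alone, because \<open>i\<close> and \<open>l\<close> have the same parity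
      wherever \<open>cas i l\<close> is nonzero.\<close>
    also have "\<dots> = (\<Sum>i<m. \<Sum>j<m. if j = x then ksign (dg l) (dg l) * (coe F i x w * cas i l) else 0)"
    proof (intro sum.cong refl)
      fix i j assume "i \<in> {..<m}" "j \<in> {..<m}"
      then have "cas i l = 0 \<or> even (dg i + dg l)"
        using cas_parity l by auto
      then show "coe F i j w * act (eps i j) l x * ksign (dg i + dg j) (dg l) =
          (if j = x then ksign (dg l) (dg l) * (coe F i x w * cas i l) else 0)"
        using \<open>i \<in> {..<m}\<close> l \<open>x < m\<close> by (auto simp: act_eps ksign_def)
    qed
    also have "\<dots> = ksign (dg l) (dg l) * (\<Sum>i<m. coe F i x w * cas i l)"
      using \<open>x < m\<close> by (simp add: sum_distrib_left)
    finally have "ksign (dg l) (dg l) * (\<Sum>i<m. coe F i x w * cas i l) = 0"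
      using assms(1) by simp
    then show ?thesis by (simp add: ksign_def split: if_splits)
  qed
  \<comment> \<open>\<open>bm\<close> inverts \<open>cas\<close>, so the vanishing sums over
    \<open>i\<close> give back the single coefficient at \<open>k\<close>.\<close>
  have "0 = (\<Sum>l<m. (\<Sum>i<m. coe F i x w * cas i l) * bm k l)"
    using * by simp
  also have "\<dots> = (\<Sum>i<m. \<Sum>l<m. coe F i x w * (cas i l * bm k l))"
    by (simp add: sum_distrib_right mult.assoc) (rule sum.swap)
  also have "\<dots> = (\<Sum>i<m. if i = k then coe F k x w else 0)"
    by (rule sum.cong) (auto simp: sum_distrib_left[symmetric] cas_bm \<open>k < m\<close>)
  also have "\<dots> = coe F k x w" using \<open>k < m\<close> by simp
  finally show ?thesis by (auto simp: coe_def ksign_def split: if_splits)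
qed

text \<open>This makes bilinear forms act as a Lie algebra: the matrix of the bracket is the
  commutator of the matrices. Replacing the second argument of \<beta> gives one product directly.
  Replacing the first gives the other after the symmetry of \<alpha> and the antisymmetry of
  \<open>cas\<close> are used, and the latter is the source of the minus sign.\<close>

lemma act_der:
  assumes \<alpha>: "hom_mat a \<alpha>" and \<beta>: "hom_mat b \<beta>"
    and sym: "\<And>i j. i < m \<Longrightarrow> j < m \<Longrightarrow> \<alpha> i j = ksign (dg i) (dg j) * \<alpha> j i"
    and g: "\<And>i j. i < m \<Longrightarrow> j < m \<Longrightarrow> g [i, j] = \<beta> i j"
    and k: "k < m" and x: "x < m"
  shows "act (\<lambda>i j. der a (act \<alpha>) g [i, j]) k x =
    ksign a b * (\<Sum>l<m. act \<beta> k l * act \<alpha> l x) - (\<Sum>l<m. act \<alpha> k l * act \<beta> l x)"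
proof -
  have d: "der a (act \<alpha>) g [i, x] = (\<Sum>l<m. act \<alpha> l i * ksign a (dg l + dg x) * \<beta> l x)
      + (\<Sum>l<m. act \<alpha> l x * ksign a (dg l) * \<beta> i l)" if "i < m" for i
    using that x g by (simp add: twist_def contr_def mult.assoc)
  have "act (\<lambda>i j. der a (act \<alpha>) g [i, j]) k x =
     (\<Sum>i<m. ksign (dg x) (dg k) * (\<Sum>l<m. act \<alpha> l i * ksign a (dg l + dg x) * \<beta> l x) * cas i k)
    + (\<Sum>i<m. ksign (dg x) (dg k) * (\<Sum>l<m. act \<alpha> l x * ksign a (dg l) * \<beta> i l) * cas i k)"
    using k x by (simp add: act_def[of _ k x] d sum.distrib ring_distribs del: der.simps)
  also have "(\<Sum>i<m. ksign (dg x) (dg k) * (\<Sum>l<m. act \<alpha> l x * ksign a (dg l) * \<beta> i l) * cas i k) =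
     (\<Sum>l<m. \<Sum>i<m. ksign a b * ((ksign (dg l) (dg k) * \<beta> i l * cas i k) * act \<alpha> l x))"
    unfolding sum_distrib_left sum_distrib_right
  proof (subst sum.swap, intro sum.cong refl)
    fix i l assume "i \<in> {..<m}" "l \<in> {..<m}"
    then have "act \<alpha> l x = 0 \<or> even (a + dg l + dg x)" "\<beta> i l = 0 \<or> even (b + dg i + dg l)"
      "cas i k = 0 \<or> even (dg i + dg k)"
      using hom_mat_act[OF \<alpha>] \<beta> cas_parity[of i k] k by (auto simp: hom_mat_def)
    then show "ksign (dg x) (dg k) * (act \<alpha> l x * ksign a (dg l) * \<beta> i l) * cas i k =
        ksign a b * ((ksign (dg l) (dg k) * \<beta> i l * cas i k) * act \<alpha> l x)"
      by (auto simp: ksign_def)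
  qed
  also have "\<dots> = ksign a b * (\<Sum>l<m. act \<beta> k l * act \<alpha> l x)"
    using k by (simp add: act_def[of \<beta>] sum_distrib_left sum_distrib_right)
  also have "(\<Sum>i<m. ksign (dg x) (dg k) * (\<Sum>l<m. act \<alpha> l i * ksign a (dg l + dg x) * \<beta> l x) * cas i k) =
     (\<Sum>i<m. \<Sum>l<m. \<Sum>j<m. - ((ksign (dg j) (dg k) * \<alpha> i j * cas i k) * (ksign (dg x) (dg j) * \<beta> l x * cas l j)))"
  proof (intro sum.cong refl)
    fix i assume "i \<in> {..<m}"
    then have i: "i < m" by simp
    have "ksign (dg x) (dg k) * ((ksign (dg i) (dg l) * \<alpha> j i * cas j l) * ksign a (dg l + dg x) * \<beta> l x) * cas i k =
        - ((ksign (dg j) (dg k) * \<alpha> i j * cas i k) * (ksign (dg x) (dg j) * \<beta> l x * cas l j))"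
      if "j < m" "l < m" for j l
    proof -
      have "\<alpha> i j = 0 \<or> even (a + dg i + dg j)" "\<beta> l x = 0 \<or> even (b + dg l + dg x)"
        "cas i k = 0 \<or> even (dg i + dg k)" "cas l j = 0 \<or> even (dg l + dg j)"
        using \<alpha> \<beta> cas_parity[of i k] k i that cas_parity[of l j] by (auto simp: hom_mat_def)
      then show ?thesis
        unfolding cas_swap[OF that] sym[OF \<open>j < m\<close> i]
        by (auto simp: ksign_def)
    qed
    then show "ksign (dg x) (dg k) * (\<Sum>l<m. act \<alpha> l i * ksign a (dg l + dg x) * \<beta> l x) * cas i k =
      (\<Sum>l<m. \<Sum>j<m. - ((ksign (dg j) (dg k) * \<alpha> i j * cas i k) * (ksign (dg x) (dg j) * \<beta> l x * cas l j)))"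
      unfolding sum_distrib_left sum_distrib_right
      by (intro sum.cong refl) (simp add: act_def i sum_distrib_left sum_distrib_right)
  qed
  also have "\<dots> = - (\<Sum>j<m. \<Sum>i<m. \<Sum>l<m. (ksign (dg j) (dg k) * \<alpha> i j * cas i k) * (ksign (dg x) (dg j) * \<beta> l x * cas l j))"
    unfolding sum_negf neg_equal_iff_equal
    by (rule sum_rotate)
  also have "\<dots> = - (\<Sum>l<m. act \<alpha> k l * act \<beta> l x)"
    using k x by (simp add: act_def sum_product)
  finally show ?thesis by simp
qed

end

section \<open>Koszul signs of permutations\<close>

text \<open>The sign with which \<open>a\<close> overtakes the smaller letters of \<open>p\<close>.
  It makes \<open>koszul\<close>, a product over inversions, recursive in the first letter.\<close>

definition cross :: "int list \<Rightarrow> nat \<Rightarrow> nat list \<Rightarrow> 'k::comm_ring_1" where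
  "cross ds a p = (\<Prod>b\<leftarrow>p. if b < a then ksign (ds ! a) (ds ! b) else 1)"

lemma cross_simps [simp]: "cross ds a [] = 1"
  "cross ds a (b # p) = (if b < a then ksign (ds ! a) (ds ! b) else 1) * cross ds a p"
  "cross ds a (p @ q) = cross ds a p * cross ds a q"
  by (simp_all add: cross_def)

lemma cross_mset: "mset p = mset q \<Longrightarrow> cross ds a p = cross ds a q"
  unfolding cross_def by (metis (mono_tags, lifting) mset_map prod_mset_prod_list)

lemma cross_eq_1: "(\<And>b. b \<in> set p \<Longrightarrow> a \<le> b) \<Longrightarrow> cross ds a p = 1"
proof -
  assume "\<And>b. b \<in> set p \<Longrightarrow> a \<le> b"
  then have "\<forall>b\<in>set p. a \<le> b" by blast
  then show ?thesis by (induction p) auto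
qed

lemma koszul_double_prod:
  "koszul ds p = (\<Prod>i<length p. \<Prod>j<length p. if i < j \<and> p ! j < p ! i then ksign (ds ! (p ! i)) (ds ! (p ! j)) else 1)"
proof -
  have "koszul ds p = (\<Prod>(i, j) \<in> {ij \<in> {..<length p} \<times> {..<length p}. fst ij < snd ij \<and> p ! snd ij < p ! fst ij}.
      ksign (ds ! (p ! i)) (ds ! (p ! j)))"
    unfolding koszul_def by (rule prod.cong) auto
  also have "\<dots> = (\<Prod>ij \<in> {..<length p} \<times> {..<length p}. if fst ij < snd ij \<and> p ! snd ij < p ! fst ij
      then (case ij of (i, j) \<Rightarrow> ksign (ds ! (p ! i)) (ds ! (p ! j))) else 1)"
    by (rule prod.inter_filter) auto
  also have "\<dots> = (\<Prod>(i, j) \<in> {..<length p} \<times> {..<length p}. if i < j \<and> p ! j < p ! i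
      then ksign (ds ! (p ! i)) (ds ! (p ! j)) else 1)"
    by (rule prod.cong) auto
  finally show ?thesis by (simp add: prod.cartesian_product)
qed

lemma koszul_Nil [simp]: "koszul ds [] = 1"
  by (simp add: koszul_double_prod)

lemma koszul_Cons: "(koszul ds (a # p) :: 'k::comm_ring_1) = cross ds a p * koszul ds p"
proof -
  have "(cross ds a p :: 'k) = (\<Prod>j<length p. if p ! j < a then ksign (ds ! a) (ds ! (p ! j)) else 1)"
    unfolding cross_def prod.list_conv_set_nth by (simp add: atLeast0LessThan)
  then show ?thesis
    by (simp add: koszul_double_prod prod.lessThan_Suc_shift del: prod.lessThan_Suc cong: if_cong)
qed

lemma koszul_append: "koszul ds (p @ q) = koszul ds p * koszul ds q * (\<Prod>a\<leftarrow>p. cross ds a q)"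
  by (induction p) (simp_all add: koszul_Cons algebra_simps)

lemma koszul_sorted: "sorted p \<Longrightarrow> koszul ds p = 1"
  by (induction p) (auto simp: koszul_Cons cross_eq_1)

lemma koszul_square: "(koszul ds p :: 'k::comm_ring_1) * koszul ds p = 1"
proof -
  have "(cross ds a p :: 'k) * cross ds a p = 1" for a p
  proof (induction p)
    case (Cons b p)
    have "(cross ds a (b # p) :: 'k) * cross ds a (b # p) =
        ((if b < a then ksign (ds ! a) (ds ! b) else 1) * (if b < a then ksign (ds ! a) (ds ! b) else 1)) *
        (cross ds a p * cross ds a p)"
      by (simp add: algebra_simps)
    then show ?case using Cons by simp
  qed simp
  note c = this
  show ?thesis
  proof (induction p)
    case (Cons a p)
    have "(koszul ds (a # p) :: 'k) * koszul ds (a # p) =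
       (cross ds a p * cross ds a p) * (koszul ds p * koszul ds p)"
      by (simp add: koszul_Cons algebra_simps)
    then show ?case using Cons c by simp
  qed simp
qed

lemma koszul_cancel: "koszul ds p * (koszul ds p * c) = (c :: 'k::comm_ring_1)"
  by (simp only: mult.assoc[symmetric] koszul_square mult_1_left)

text \<open>A function of words that picks up \<open>ksign\<close> under adjacent swaps picks up \<open>koszul\<close> under
  insertion sort.\<close>

lemma koszul_insort:
  fixes \<Psi> :: "nat list \<Rightarrow> 'k::comm_ring_1"
  assumes swap: "\<And>u i j v. mset (u @ i # j # v) = M \<Longrightarrow> \<Psi> (u @ i # j # v) = ksign (ds ! i) (ds ! j) * \<Psi> (u @ j # i # v)"
    and "sorted q" "mset (u @ a # q) = M"
  shows "\<Psi> (u @ a # q) = cross ds a q * \<Psi> (u @ insort a q)"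
  using assms(2,3)
proof (induction q arbitrary: u)
  case (Cons b q)
  show ?case
  proof (cases "a \<le> b")
    case True
    with Cons.prems have "cross ds a (b # q) = (1 :: 'k)"
      by (intro cross_eq_1) auto
    with True show ?thesis by simp
  next
    case False
    have "\<Psi> (u @ a # b # q) = ksign (ds ! a) (ds ! b) * \<Psi> ((u @ [b]) @ a # q)"
      using swap[OF Cons.prems(2)] by simp
    also have "\<Psi> ((u @ [b]) @ a # q) = cross ds a q * \<Psi> ((u @ [b]) @ insort a q)"
      using Cons.prems by (intro Cons.IH) (auto simp: ac_simps)
    finally show ?thesis using False by (simp add: mult.assoc)
  qed
qed simp

text \<open>The prefix holds the letters that the recursion has passed. The swap rule is assumed
  only for rearrangements of \<open>M\<close>, so that in applications the indices stay within the
  word from which they select.\<close>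

lemma koszul_sort_context:
  fixes \<Psi> :: "nat list \<Rightarrow> 'k::comm_ring_1"
  assumes swap: "\<And>u i j v. mset (u @ i # j # v) = M \<Longrightarrow> \<Psi> (u @ i # j # v) = ksign (ds ! i) (ds ! j) * \<Psi> (u @ j # i # v)"
    and "mset (u @ p) = M"
  shows "\<Psi> (u @ p) = koszul ds p * \<Psi> (u @ sort p)"
  using assms(2)
proof (induction p arbitrary: u)
  case (Cons a p)
  have "\<Psi> (u @ a # p) = koszul ds p * \<Psi> (u @ a # sort p)"
    using Cons.IH[of "u @ [a]"] Cons.prems by simp
  also have "\<Psi> (u @ a # sort p) = cross ds a (sort p) * \<Psi> (u @ insort a (sort p))"
    using Cons.prems by (intro koszul_insort[OF swap]) auto
  also have "cross ds a (sort p) = (cross ds a p :: 'k)"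
    by (rule cross_mset) simp
  finally show ?case by (simp add: koszul_Cons algebra_simps)
qed simp

lemma koszul_sort:
  fixes \<Psi> :: "nat list \<Rightarrow> 'k::comm_ring_1"
  assumes "\<And>u i j v. mset (u @ i # j # v) = mset p \<Longrightarrow> \<Psi> (u @ i # j # v) = ksign (ds ! i) (ds ! j) * \<Psi> (u @ j # i # v)"
  shows "\<Psi> p = koszul ds p * \<Psi> (sort p)"
  using koszul_sort_context[of "mset p" \<Psi> ds "[]" p] assms by simp

lemma koszul_swap:
  "koszul ds ([0..<k] @ [Suc k, k] @ [Suc (Suc k)..<n]) = (ksign (ds ! Suc k) (ds ! k) :: 'k::comm_ring_1)"
proof -
  have 1: "cross ds a ([Suc k, k] @ [Suc (Suc k)..<n]) = (1 :: 'k)" if "a \<in> set [0..<k]" for a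
    using that by (intro cross_eq_1) auto
  have "(\<Prod>a\<leftarrow>[0..<k]. cross ds a ([Suc k, k] @ [Suc (Suc k)..<n])) = (\<Prod>a\<leftarrow>[0..<k]. 1 :: 'k)"
    by (intro arg_cong[of _ _ prod_list] map_cong refl 1)
  moreover have "cross ds (Suc k) [Suc (Suc k)..<n] = (1 :: 'k)" "cross ds k [Suc (Suc k)..<n] = (1 :: 'k)"
    by (rule cross_eq_1, simp)+
  ultimately show ?thesis
    by (simp add: koszul_append koszul_Cons koszul_sorted map_replicate_const)
qed

lemma pick_simps [simp]: "pick xs [] = []" "pick xs (i # p) = xs ! i # pick xs p"
  "pick xs (p @ q) = pick xs p @ pick xs q" "length (pick xs p) = length p"
  "pick (x # xs) (map Suc p) = pick xs p"
  by (simp_all add: pick_def)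

lemma pick_upt: "j \<le> length xs \<Longrightarrow> pick xs [i..<j] = take (j - i) (drop i xs)"
  unfolding pick_def by (rule nth_equalityI) auto

lemma pick_all [simp]: "pick xs [0..<length xs] = xs"
  by (simp add: pick_def map_nth)

lemma pick_map: "set p \<subseteq> {..<length xs} \<Longrightarrow> pick (map f xs) p = map f (pick xs p)"
  by (auto simp: pick_def)

lemma sum_Pow_Suc:
  "(\<Sum>A\<in>Pow {..<Suc n}. F A) = (\<Sum>A\<in>Pow {..<n}. F (Suc ` A) + (F (insert 0 (Suc ` A)) :: 'k::comm_monoid_add))"
proof -
  have e: "{..<Suc n} = insert 0 (Suc ` {..<n})" by (auto simp: lessThan_Suc_eq_insert_0)
  have inj: "inj_on ((`) Suc) X" for X
    by (intro inj_onI) (simp add: inj_image_eq_iff)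
  have inj2: "inj_on (insert 0 \<circ> (`) Suc) X" for X
    by (intro inj_onI) (auto simp: insert_eq_iff inj_image_eq_iff)
  have P: "Pow (Suc ` {..<n}) = (`) Suc ` Pow {..<n}" by (simp add: image_Pow_surj)
  have "Pow {..<Suc n} = (`) Suc ` Pow {..<n} \<union> (insert 0 \<circ> (`) Suc) ` Pow {..<n}"
    unfolding e Pow_insert P by (simp add: image_comp)
  then have "(\<Sum>A\<in>Pow {..<Suc n}. F A) = sum F ((`) Suc ` Pow {..<n}) + sum F ((insert 0 \<circ> (`) Suc) ` Pow {..<n})"
    by (simp only:) (rule sum.union_disjoint, auto)
  also have "\<dots> = (\<Sum>A\<in>Pow {..<n}. F (Suc ` A)) + (\<Sum>A\<in>Pow {..<n}. F (insert 0 (Suc ` A)))"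
    unfolding sum.reindex[OF inj] sum.reindex[OF inj2] by (simp only: comp_def)
  finally show ?thesis by (simp add: sum.distrib)
qed

section \<open>Shuffles as sums over subsets, and symmetric functions of words\<close>

context graded_letters
begin

lemma sum_list_pick: "set p \<subseteq> {..<length w} \<Longrightarrow> sum_list (pick (map dg w) p) = wd (pick w p)"
  by (simp add: pick_map wd_def)

lemma ksign_sum_list: "(ksign d (sum_list xs) :: 'k::comm_ring_1) = (\<Prod>x\<leftarrow>xs. ksign d x)"
  "(ksign (sum_list xs) d :: 'k::comm_ring_1) = (\<Prod>x\<leftarrow>xs. ksign x d)"
  by (induction xs) (simp_all add: ksign_add_left ksign_add_right)

definition split_sign :: "int list \<Rightarrow> nat list \<Rightarrow> nat list \<Rightarrow> 'k::comm_ring_1" where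
  "split_sign ds I J = (\<Prod>a\<leftarrow>I. \<Prod>b\<leftarrow>J. if a < b then ksign (ds ! a) (ds ! b) else 1)"

text \<open>A variable of \<open>I\<close> passes the second form, whose degree is minus the sum
  over all of \<open>J\<close>, and also those variables of \<open>J\<close> that precede it. The
  signs of the latter occur twice and cancel, leaving the pairs in which the variable of
  \<open>I\<close> comes first.\<close>

lemma koszul_split:
  fixes ds :: "int list"
  assumes "sorted I" "sorted J" "set I \<inter> set J = {}"
  shows "koszul ([- sum_list (pick ds I), - sum_list (pick ds J)] @ ds)
      ([0] @ map ((+) 2) I @ [1] @ map ((+) 2) J) = (split_sign ds I J :: 'k::comm_ring_1)"
proof -
  let ?ds = "[- sum_list (pick ds I), - sum_list (pick ds J)] @ ds"
  have "cross ?ds 0 p = (1 :: 'k)" for p by (rule cross_eq_1) simp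
  moreover have "koszul ?ds (map ((+) 2) I) = (1 :: 'k)"
    using assms(1) by (intro koszul_sorted) (auto simp: sorted_map)
  moreover have "koszul ?ds ([1] @ map ((+) 2) J) = (1 :: 'k)"
    using assms(2) by (intro koszul_sorted) (auto simp: sorted_map)
  moreover have "cross ?ds (2 + a) ([1] @ map ((+) 2) J) = (\<Prod>b\<leftarrow>J. if a < b then ksign (ds ! a) (ds ! b) else 1 :: 'k)"
    if "a \<in> set I" for a
  proof -
    have "ksign (ds ! a) (sum_list (pick ds K)) * cross ?ds (2 + a) (map ((+) 2) K) =
      (\<Prod>b\<leftarrow>K. (if a < b then ksign (ds ! a) (ds ! b) else 1 :: 'k))" if "a \<notin> set K" for K
      using that by (induction K) (auto simp: ksign_add_right algebra_simps)
    from this[of J] show ?thesis using that assms(3) by auto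
  qed
  then have "(\<Prod>a\<leftarrow>map ((+) 2) I. cross ?ds a ([1] @ map ((+) 2) J)) = (split_sign ds I J :: 'k)"
    unfolding split_sign_def map_map by (intro arg_cong[of _ _ prod_list] map_cong refl) auto
  ultimately show ?thesis
    by (simp only: koszul_append koszul_Cons append_Cons append_Nil mult_1_left mult_1_right)
qed

text \<open>Subsets without 0 give the first letter to \<open>g\<close>, subsets with 0 give it to
  \<open>f\<close>; these are the two summands of the recursion.\<close>

lemma shuf_subsets:
  "shuf f g w = (\<Sum>A\<in>Pow {..<length w}.
     let I = filter (\<lambda>i. i \<in> A) [0..<length w]; J = filter (\<lambda>i. i \<notin> A) [0..<length w]
     in split_sign (map dg w) I J * f (pick w I) * g (pick w J))"
proof (induction w arbitrary: f g)
  case Nil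
  then show ?case by (simp add: split_sign_def)
next
  case (Cons x w)
  have u: "[0..<length (x # w)] = 0 # map Suc [0..<length w]"
    by (simp add: upt_conv_Cons map_Suc_upt del: upt_Suc)
  have f: "filter (\<lambda>i. i \<in> Suc ` A) (map Suc xs) = map Suc (filter (\<lambda>i. i \<in> A) xs)"
     "filter (\<lambda>i. i \<notin> Suc ` A) (map Suc xs) = map Suc (filter (\<lambda>i. i \<notin> A) xs)"
     "filter (\<lambda>i. i \<in> insert 0 (Suc ` A)) (map Suc xs) = map Suc (filter (\<lambda>i. i \<in> A) xs)"
     "filter (\<lambda>i. i \<notin> insert 0 (Suc ` A)) (map Suc xs) = map Suc (filter (\<lambda>i. i \<notin> A) xs)" for A xs
    by (auto simp: filter_map comp_def intro!: filter_cong)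
  have s1: "split_sign (d # ds) (map Suc I) (0 # map Suc J) = (split_sign ds I J :: 'a)" for d ds I J
    by (simp add: split_sign_def comp_def cong: if_cong)
  have s2: "split_sign (d # ds) (0 # map Suc I) (map Suc J) = (ksign d (sum_list (pick ds J)) * split_sign ds I J :: 'a)" for d ds I J
    by (simp add: split_sign_def comp_def ksign_sum_list pick_def cong: if_cong)
  have "shuf f g (x # w) = (\<Sum>A\<in>Pow {..<length w}.
     (let I = filter (\<lambda>i. i \<in> A) [0..<length w]; J = filter (\<lambda>i. i \<notin> A) [0..<length w]
      in split_sign (map dg w) I J * f (pick w I) * contr x g (pick w J)) +
     (let I = filter (\<lambda>i. i \<in> A) [0..<length w]; J = filter (\<lambda>i. i \<notin> A) [0..<length w]
      in split_sign (map dg w) I J * contr x f (pick w I) * twist (dg x) g (pick w J)))"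
    by (simp only: shuf.simps Cons sum.distrib)
  also have "\<dots> = (\<Sum>A\<in>Pow {..<length w}.
     (let I = filter (\<lambda>i. i \<in> Suc ` A) [0..<length (x # w)]; J = filter (\<lambda>i. i \<notin> Suc ` A) [0..<length (x # w)]
      in split_sign (map dg (x # w)) I J * f (pick (x # w) I) * g (pick (x # w) J)) +
     (let I = filter (\<lambda>i. i \<in> insert 0 (Suc ` A)) [0..<length (x # w)]; J = filter (\<lambda>i. i \<notin> insert 0 (Suc ` A)) [0..<length (x # w)]
      in split_sign (map dg (x # w)) I J * f (pick (x # w) I) * g (pick (x # w) J)))"
  proof (intro sum.cong refl)
    fix A assume "A \<in> Pow {..<length w}"
    have "sum_list (pick (map dg w) (filter (\<lambda>i. i \<notin> A) [0..<length w])) = wd (pick w (filter (\<lambda>i. i \<notin> A) [0..<length w]))"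
      by (rule sum_list_pick) auto
    then show "(let I = filter (\<lambda>i. i \<in> A) [0..<length w]; J = filter (\<lambda>i. i \<notin> A) [0..<length w]
      in split_sign (map dg w) I J * f (pick w I) * contr x g (pick w J)) +
     (let I = filter (\<lambda>i. i \<in> A) [0..<length w]; J = filter (\<lambda>i. i \<notin> A) [0..<length w]
      in split_sign (map dg w) I J * contr x f (pick w I) * twist (dg x) g (pick w J)) =
     (let I = filter (\<lambda>i. i \<in> Suc ` A) [0..<length (x # w)]; J = filter (\<lambda>i. i \<notin> Suc ` A) [0..<length (x # w)]
      in split_sign (map dg (x # w)) I J * f (pick (x # w) I) * g (pick (x # w) J)) +
     (let I = filter (\<lambda>i. i \<in> insert 0 (Suc ` A)) [0..<length (x # w)]; J = filter (\<lambda>i. i \<notin> insert 0 (Suc ` A)) [0..<length (x # w)]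
      in split_sign (map dg (x # w)) I J * f (pick (x # w) I) * g (pick (x # w) J))"
      unfolding u filter.simps f
      by (simp add: s1 s2 Let_def contr_def twist_def algebra_simps)
  qed
  finally show ?case
    by (simp only: sum_Pow_Suc length_Cons)
qed

text \<open>Written by positions for comparison with the cyclic sum in the bracket, where position
  \<open>r\<close> is the variable that goes to the bilinear form.\<close>

lemma der_sum_nth:
  "der a A h w = (\<Sum>r<length w. \<Sum>k<m. A k (w ! r) *
     (ksign a (dg k + wd (drop (Suc r) w)) * h (take r w @ k # drop (Suc r) w)))"
proof (induction w arbitrary: h)
  case (Cons x w)
  show ?case
    by (simp add: Cons sum.lessThan_Suc_shift contr_def twist_def del: sum.lessThan_Suc)
qed simp

text \<open>Adjacent swaps generate all permutations and suit inductions on words;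
  \<open>wsym_sort\<close> recovers arbitrary orders.\<close>

definition wsym :: "(nat list \<Rightarrow> 'k::comm_ring_1) \<Rightarrow> bool" where
  "wsym f \<longleftrightarrow> (\<forall>u x y v. f (u @ x # y # v) = ksign (dg x) (dg y) * f (u @ y # x # v))"

lemma wsymD: "wsym f \<Longrightarrow> f (u @ x # y # v) = ksign (dg x) (dg y) * f (u @ y # x # v)"
  unfolding wsym_def by blast

lemma wsym_swap: "wsym f \<Longrightarrow> contr y (contr x f) = form_scale (ksign (dg x) (dg y)) (contr x (contr y f))"
  using wsymD[of f "[]" x y] by (auto simp: contr_def form_scale_def fun_eq_iff)

lemma wsym_contr: "wsym f \<Longrightarrow> wsym (contr x f)"
  unfolding wsym_def contr_def by (metis append_Cons)

lemma wsym_twist: "wsym f \<Longrightarrow> wsym (twist d f)"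
  unfolding wsym_def
proof (intro allI)
  fix u x y v assume "\<forall>u x y v. f (u @ x # y # v) = ksign (dg x) (dg y) * f (u @ y # x # v)"
  then have "f (u @ x # y # v) = ksign (dg x) (dg y) * f (u @ y # x # v)" by blast
  then show "twist d f (u @ x # y # v) = ksign (dg x) (dg y) * twist d f (u @ y # x # v)"
    by (simp add: twist_def algebra_simps)
qed

lemma wsym_move:
  "wsym f \<Longrightarrow> f (u @ x # v) = ksign (wd u) (dg x) * f (x # u @ v)"
proof (induction u arbitrary: v rule: rev_induct)
  case (snoc y u)
  then show ?case
    using wsymD[OF snoc.prems, of u y x v]
    by (simp add: ksign_add_left algebra_simps)
qed simp

lemma wsym_shuf:
  fixes f g :: "nat list \<Rightarrow> 'k::comm_ring_1"
  assumes "wsym f" "wsym g"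
  shows "wsym (shuf f g)"
  unfolding wsym_def
proof (intro allI)
  fix u x y v show "shuf f g (u @ x # y # v) = ksign (dg x) (dg y) * shuf f g (u @ y # x # v)"
    using assms
  proof (induction u arbitrary: f g)
    case Nil
    show ?case
      by (simp add: contr_twist shuf_scale_right shuf_scale_left form_scale_apply
          wsym_swap[OF Nil(1), of y x] wsym_swap[OF Nil(2), of y x] twist_commute[of "dg y" "dg x"]
          ksign_commute[of "dg y" "dg x"] algebra_simps)
  qed (simp add: wsym_contr wsym_twist algebra_simps)
qed

lemma wsym_der:
  fixes f :: "nat list \<Rightarrow> 'k::comm_ring_1"
  assumes "wsym f" and A: "hom_mat a A"
  shows "wsym (der a A f)"
  unfolding wsym_def
proof (intro allI)
  fix u x y v show "der a A f (u @ x # y # v) = ksign (dg x) (dg y) * der a A f (u @ y # x # v)"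
    using assms(1)
  proof (induction u arbitrary: f)
    case Nil
    \<comment> \<open>Moving the new letter \<open>k\<close> behind \<open>y\<close> costs the sign
      of \<open>k\<close> and \<open>y\<close>. Together with the operator's own sign against
      \<open>y\<close> this is the sign of \<open>x\<close> and \<open>y\<close>, since
      \<open>k\<close> and \<open>x\<close> differ in parity by \<open>a\<close>.\<close>
    have "A k x * twist a f (k # y # v) = ksign (dg x) (dg y) * (A k x * twist a (contr y f) (k # v))" for k x y
    proof (cases "A k x = 0")
      case False
      then have "even (a + dg k + dg x)" using A by (auto simp: hom_mat_def)
      then have s: "ksign a (dg k + (dg y + wd v)) * ksign (dg k) (dg y) = (ksign (dg x) (dg y) * ksign a (dg k + wd v) :: 'k)"
        by (auto simp: ksign_def)
      have "twist a f (k # y # v) = (ksign a (dg k + (dg y + wd v)) * ksign (dg k) (dg y)) * f (y # k # v)"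
        using wsymD[OF Nil, of "[]" k y v] by (simp add: twist_def)
      then show ?thesis unfolding s by (simp add: twist_def contr_def)
    qed simp
    note * = this
    have "der a A (contr y (contr x f)) v = ksign (dg x) (dg y) * der a A (contr x (contr y f)) v"
      by (simp add: wsym_swap[OF Nil, of y x] der_scale form_scale_apply)
    then show ?case
      by (simp add: *[of _ x y] *[of _ y x] sum_distrib_left ksign_commute[of "dg y" "dg x"] algebra_simps)
  next
    case (Cons z u)
    have "twist a f (k # u @ x # y # v) = ksign (dg x) (dg y) * twist a f (k # u @ y # x # v)" for k
      using wsymD[OF wsym_twist[OF Cons.prems], where u = "k # u" and x = x and y = y and v = v] by simp
    then show ?case
      using Cons by (simp add: wsym_contr sum_distrib_left algebra_simps)
  qed
qed

lemma wsym_sort: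
  assumes h: "wsym h" and p: "set p \<subseteq> {..<length w}"
  shows "h (u @ pick w p) = koszul (map dg w) p * h (u @ pick w (sort p))"
proof (rule koszul_sort[of p "\<lambda>p. h (u @ pick w p)"])
  fix u' i j v assume "mset (u' @ i # j # v) = mset p"
  then have "i \<in># mset p" "j \<in># mset p"
    by (metis in_multiset_in_set in_set_conv_decomp append.assoc append_Cons append_Nil)+
  then have "i < length w" "j < length w" using p by auto
  then show "h (u @ pick w (u' @ i # j # v)) = ksign (map dg w ! i) (map dg w ! j) * h (u @ pick w (u' @ j # i # v))"
    using wsymD[OF h, of "u @ pick w u'" "w ! i" "w ! j" "pick w v"] by simp
qed

end

section \<open>Multilinear forms and their coefficients\<close>

context quadratic_graded_space
begin

abbreviation lin :: "('v \<Rightarrow> 'k) \<Rightarrow> bool" where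
  "lin f \<equiv> Vector_Spaces.linear scale (*) f"

lemma lin_iff: "lin f \<longleftrightarrow> (\<forall>x y. f (x + y) = f x + f y) \<and> (\<forall>c x. f (scale c x) = c * f x)"
proof -
  have "vector_space ((*) :: 'k \<Rightarrow> 'k \<Rightarrow> 'k)"
    by unfold_locales (auto simp: algebra_simps)
  then show ?thesis
    using vector_space_axioms by (auto simp: Vector_Spaces.linear_iff)
qed

lemma linD: assumes "lin f" shows "f (x + y) = f x + f y" "f (scale c x) = c * f x"
  using assms by (auto simp: lin_iff)

lemma lin_diff: "lin f \<Longrightarrow> f (x - y) = f x - f y"
  using linD(1)[of f "x - y" y] by simp

lemma lin_zero: "lin f \<Longrightarrow> f 0 = 0"
  using linD(2)[of f 0 0] by simp

lemma lin_sum: "lin f \<Longrightarrow> f (\<Sum>i\<in>I. x i) = (\<Sum>i\<in>I. f (x i))"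
  by (induction I rule: infinite_finite_induct) (auto simp: linD lin_zero)

lemma lin_intros:
  "lin (\<lambda>v. 0)" "lin f \<Longrightarrow> lin g \<Longrightarrow> lin (\<lambda>v. f v + g v)" "lin f \<Longrightarrow> lin g \<Longrightarrow> lin (\<lambda>v. f v - g v)"
  "lin f \<Longrightarrow> lin (\<lambda>v. c * f v)" "lin f \<Longrightarrow> lin (\<lambda>v. f v * c)"
  by (auto simp: lin_iff algebra_simps)

lemma lin_sum_fun: "(\<And>i. i \<in> I \<Longrightarrow> lin (f i)) \<Longrightarrow> lin (\<lambda>v. \<Sum>i\<in>I. f i v)"
  by (induction I rule: infinite_finite_induct) (auto intro: lin_intros)

lemma multilinearD: "multilinear scale f \<Longrightarrow> lin (\<lambda>v. f (xs @ v # ys))"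
  by (simp add: multilinear_def)

lemma multilinearI: "(\<And>xs ys. lin (\<lambda>v. f (xs @ v # ys))) \<Longrightarrow> multilinear scale f"
  by (simp add: multilinear_def)

lemma multilinear_context: "multilinear scale f \<Longrightarrow> multilinear scale (\<lambda>xs. f (u @ xs @ u'))"
  using multilinearD[of f "u @ xs" "ys @ u'" for xs ys] by (auto intro: multilinearI)

lemma multilinear_add: "multilinear scale f \<Longrightarrow> multilinear scale g \<Longrightarrow> multilinear scale (f + g)"
  unfolding multilinear_def plus_fun_apply by (auto intro: lin_intros)

lemma multilinear_scale: "multilinear scale f \<Longrightarrow> multilinear scale (form_scale c f)"
  unfolding multilinear_def form_scale_apply by (auto intro: lin_intros)

lemma multilinear_0: "multilinear scale 0"
  unfolding multilinear_def zero_fun_apply by (auto intro: lin_intros)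

lemma pick_other: "length xs \<notin> set p \<Longrightarrow> pick (xs @ v # ys) p = pick (xs @ w # ys) p"
  by (auto simp: pick_def nth_append nth_Cons')

lemma lin_pick:
  assumes "multilinear scale f" "distinct p" "length xs \<in> set p"
  shows "lin (\<lambda>v. f (u @ pick (xs @ v # ys) p))"
proof -
  obtain p1 p2 where p: "p = p1 @ length xs # p2" using split_list[OF assms(3)] by blast
  then have "length xs \<notin> set p1" "length xs \<notin> set p2" using assms(2) by auto
  then have "pick (xs @ v # ys) p = pick (xs @ 0 # ys) p1 @ v # pick (xs @ 0 # ys) p2" for v
    using pick_other[of xs _ v ys 0] by (simp add: p)
  then show ?thesis
    using multilinearD[OF assms(1), of "u @ pick (xs @ 0 # ys) p1"] by simp
qed

text \<open>Each variable is an argument of exactly one of the two factors, so the other factor is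
  constant in it.\<close>

lemma lin_pick_product:
  assumes "multilinear scale f" "multilinear scale g" "distinct (I @ J)" "length xs \<in> set (I @ J)"
  shows "lin (\<lambda>v. c * f (u @ pick (xs @ v # ys) I) * g (u' @ pick (xs @ v # ys) J))"
proof (cases "length xs \<in> set I")
  case True
  then have "length xs \<notin> set J" using assms(3) by auto
  then have "pick (xs @ v # ys) J = pick (xs @ 0 # ys) J" for v by (rule pick_other)
  then obtain z where "\<And>v. pick (xs @ v # ys) J = z" by blast
  then show ?thesis using True assms by (auto intro!: lin_intros lin_pick)
next
  case False
  then have "pick (xs @ v # ys) I = pick (xs @ 0 # ys) I" for v by (rule pick_other)
  then obtain z where "\<And>v. pick (xs @ v # ys) I = z" by blast
  then show ?thesis using False assms by (auto intro!: lin_intros lin_pick)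
qed

section \<open>The grading of \<open>V\<close> and homogeneous dual bases\<close>

abbreviation W :: "int \<Rightarrow> 'v set" where "W \<equiv> shift V"

lemma subspace_V: "subspace (V d)"
  using grading by (simp add: is_grading_def)

lemma decomposition_unique:
  "is_decomposition V v c \<Longrightarrow> is_decomposition V v c' \<Longrightarrow> c = c'"
  using grading unfolding is_grading_def by blast

lemma decomposition_exists: "\<exists>c. is_decomposition V v c"
  using grading unfolding is_grading_def by blast

lemma decomposition_homogeneous: "x \<in> V d \<Longrightarrow> is_decomposition V x (\<lambda>i. if i = d then x else 0)"
proof -
  assume x: "x \<in> V d"
  have "{i. (if i = d then x else 0) \<noteq> 0} = (if x = 0 then {} else {d})" by auto
  then show ?thesis
    using x subspace_0[OF subspace_V] by (auto simp: is_decomposition_def)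
qed

lemma V_disjoint: "x \<in> V i \<Longrightarrow> x \<in> V j \<Longrightarrow> x \<noteq> 0 \<Longrightarrow> i = j"
  using decomposition_unique[OF decomposition_homogeneous decomposition_homogeneous, of x i j]
  by (metis)

lemma is_decomposition_shift: "is_decomposition (shift V) v c \<longleftrightarrow> is_decomposition V v (\<lambda>d. c (d - 1))"
proof -
  have e: "{d. c (d - 1) \<noteq> 0} = (\<lambda>d. d + 1) ` {d. c d \<noteq> 0}"
  proof (intro equalityI subsetI)
    fix d assume "d \<in> {d. c (d - 1) \<noteq> 0}"
    then show "d \<in> (\<lambda>d. d + 1) ` {d. c d \<noteq> 0}" by (intro image_eqI[of _ _ "d - 1"]) auto
  qed auto
  have inj: "inj_on (\<lambda>d. d + 1) X" for X :: "int set" by (auto simp: inj_on_def)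
  have "(\<forall>d. c d \<in> V (d + 1)) \<longleftrightarrow> (\<forall>d. c (d - 1) \<in> V d)"
    by (metis add_diff_cancel diff_add_cancel)
  then show ?thesis
    unfolding is_decomposition_def shift_def e
    by (simp add: sum.reindex[OF inj] finite_image_iff[OF inj])
qed

lemma hom_comp_eqI: "is_decomposition W v c \<Longrightarrow> hom_comp W v = c"
  unfolding hom_comp_def
proof (rule the_equality)
  fix c' assume c: "is_decomposition W v c" "is_decomposition W v c'"
  then have "(\<lambda>d. c (d - 1)) = (\<lambda>d. c' (d - 1))"
    by (intro decomposition_unique) (auto simp: is_decomposition_shift)
  then have "c (d + 1 - 1) = c' (d + 1 - 1)" for d by (rule fun_cong)
  then show "c' = c" by (simp add: fun_eq_iff)
qed

lemma hom_deg_eq: "x \<in> W d \<Longrightarrow> x \<noteq> 0 \<Longrightarrow> hom_deg W x = d"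
  unfolding hom_deg_def by (rule the_equality) (auto simp: shift_def dest: V_disjoint)

lemma b_simps:
  "b (x + y) z = b x z + b y z" "b (x - y) z = b x z - b y z" "b (scale c x) z = c * b x z" "b 0 z = 0"
  "b z (x + y) = b z x + b z y" "b z (scale c x) = c * b z x" "b z 0 = 0"
  "b (\<Sum>i\<in>I. f i) z = (\<Sum>i\<in>I. b (f i) z)" "b z (\<Sum>i\<in>I. f i) = (\<Sum>i\<in>I. b z (f i))"
  using linD[OF linear_left] linD[OF linear_right] lin_diff[OF linear_left] lin_zero[OF linear_left] lin_zero[OF linear_right]
    lin_sum[OF linear_left] lin_sum[OF linear_right] by auto

text \<open>A maximal independent set of homogeneous vectors spans, because every vector is the sum
  of its components.\<close>

lemma homogeneous_basis: "\<exists>B. finite B \<and> independent B \<and> span B = UNIV \<and> (\<forall>x\<in>B. \<exists>d. x \<in> V d)"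
proof -
  obtain B where B: "B \<subseteq> (\<Union>d. V d)" "independent B" "(\<Union>d. V d) \<subseteq> span B"
    by (rule maximal_independent_subset)
  have "v \<in> span B" for v
  proof -
    obtain c where "is_decomposition V v c" using decomposition_exists by blast
    then have "v = (\<Sum>d | c d \<noteq> 0. c d)" "\<And>d. c d \<in> V d" by (auto simp: is_decomposition_def)
    then show ?thesis using B(3) by (metis UN_I UNIV_I span_sum subsetD)
  qed
  then have "span B = UNIV" by auto
  moreover have "finite B"
  proof -
    obtain C where "finite C" "span C = UNIV" using finite_dim by blast
    then show ?thesis using independent_span_bound[of C B] B(2) by simp
  qed
  ultimately show ?thesis using B(1,2) by (intro exI[of _ B]) auto
qed

text \<open>The form \<open>b\<close> is nondegenerate on the left only by assumption; surjectivity of the map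
  \<open>x \<mapsto> (b x e)\<^sub>e\<close> yields vectors dual to the basis on the left, whose homogeneous components
  are moved to the right by symmetry.\<close>

lemma dual_basis_exists: "\<exists>B. dual_bases scale W b B"
proof -
  obtain B where B: "finite B" "independent B" "span B = UNIV" "\<forall>x\<in>B. \<exists>d. x \<in> V d"
    using homogeneous_basis by blast
  interpret fd: finite_dimensional_vector_space scale B
    by unfold_locales (use B in auto)
  define T where "T x = (\<Sum>e\<in>B. scale (b x e) e)" for x
  have "Vector_Spaces.linear scale scale T"
    by (auto simp: Vector_Spaces.linear_iff T_def b_simps sum.distrib scale_left_distrib scale_sum_right
        vector_space_axioms)
  moreover have "inj T"
  proof (rule injI)
    fix x y assume "T x = T y"
    then have "(\<Sum>e\<in>B. scale (b x e - b y e) e) = 0"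
      by (simp add: T_def scale_left_diff_distrib sum_subtractf)
    then have "\<And>e. e \<in> B \<Longrightarrow> b x e - b y e = 0"
      using independentD[OF B(2) B(1) subset_refl, of "\<lambda>e. b x e - b y e"] by blast
    then have 0: "\<And>e. e \<in> B \<Longrightarrow> b (x - y) e = 0" by (simp add: b_simps)
    have "z \<in> span B \<Longrightarrow> b (x - y) z = 0" for z
      by (induction rule: span_induct_alt) (auto simp: b_simps(5-) 0)
    then have "x - y = 0" using nondegenerate B(3) by blast
    then show "x = y" by simp
  qed
  ultimately have "surj T" by (rule fd.linear_inj_imp_surj)
  have "\<exists>z d. z \<in> V d \<and> (\<forall>e'\<in>B. b e' z = (if e' = e then 1 else 0))" if e: "e \<in> B" for e
  proof -
    obtain y where y: "T y = e" using \<open>surj T\<close> by (metis surjD)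
    have ye: "b y e' = (if e' = e then 1 else 0)" if "e' \<in> B" for e'
    proof -
      have "(\<Sum>x\<in>B. scale (if x = e then 1 else 0) x) = (\<Sum>x\<in>B. if x = e then x else 0)"
        by (rule sum.cong) auto
      also have "\<dots> = e" using e B(1) by simp
      finally have "(\<Sum>x\<in>B. scale (b y x - (if x = e then 1 else 0)) x) = 0"
        using y by (simp add: T_def scale_left_diff_distrib sum_subtractf)
      then have "b y e' - (if e' = e then 1 else 0) = 0"
        using independentD[OF B(2) B(1) subset_refl, of "\<lambda>x. b y x - (if x = e then 1 else 0)"] that by blast
      then show ?thesis by simp
    qed
    obtain d where d: "e \<in> V d" using B(4) e by blast
    obtain c where c: "is_decomposition V y c" using decomposition_exists by blast
    then have c': "y = (\<Sum>d | c d \<noteq> 0. c d)" "\<And>d. c d \<in> V d" "finite {d. c d \<noteq> 0}"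
      by (auto simp: is_decomposition_def)
    \<comment> \<open>Components of all other degrees are orthogonal to \<open>e'\<close>. Hence the
      component of \<open>y\<close> of degree \<open>- d\<close> has the same pairings as
      \<open>y\<close> with the basis vectors of degree \<open>d\<close>.\<close>
    have bc: "b y e' = b (c (- d')) e'" if "e' \<in> V d'" for e' d'
    proof -
      have "b y e' = (\<Sum>i | c i \<noteq> 0. b (c i) e')" by (subst c'(1)) (simp add: b_simps)
      also have "\<dots> = (\<Sum>i | c i \<noteq> 0. if i = - d' then b (c (- d')) e' else 0)"
        using degree_zero[OF c'(2) that] by (intro sum.cong) auto
      also have "\<dots> = b (c (- d')) e'" using c'(3) by (auto simp: b_simps)
      finally show ?thesis .
    qed
    \<comment> \<open>The component pairs correctly as a left argument. Exchanging the arguments,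
      whose degrees are opposite, costs \<open>ksign d d\<close>, which this factor absorbs.\<close>
    define z where "z = scale (ksign d d) (c (- d))"
    have "z \<in> V (- d)" unfolding z_def by (intro subspace_scale[OF subspace_V] c'(2))
    moreover have "b e' z = (if e' = e then 1 else 0)" if e': "e' \<in> B" for e'
    proof -
      obtain d' where d': "e' \<in> V d'" using B(4) e' by blast
      show ?thesis
      proof (cases "d' = d")
        case True
        have "b e' z = ksign d d * (ksign d d * b (c (- d)) e')"
          using symmetric[OF d' c'(2), of "- d"] True by (simp add: z_def b_simps)
        then show ?thesis using bc[OF d'] ye[OF e'] True by simp
      next
        case False
        then have "b e' z = 0" using degree_zero[OF d' \<open>z \<in> V (- d)\<close>] by simp
        moreover have "e' \<noteq> e"
        proof
          assume "e' = e"
          moreover have "e \<noteq> 0" using e B(2) dependent_zero by blast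
          ultimately show False using False d d' V_disjoint by blast
        qed
        ultimately show ?thesis by simp
      qed
    qed
    ultimately show ?thesis by blast
  qed
  then obtain z where z: "\<And>e. e \<in> B \<Longrightarrow> \<exists>d. z e \<in> V d"
    "\<And>e e'. e \<in> B \<Longrightarrow> e' \<in> B \<Longrightarrow> b e' (z e) = (if e' = e then 1 else 0)"
    by metis
  obtain es where es: "set es = B" "distinct es" using finite_distinct_list[OF B(1)] by blast
  have inj: "inj_on z B"
    by (rule inj_onI) (metis z(2) zero_neq_one)
  have ind: "independent (z ` B)"
  proof (rule independent_if_scalars_zero)
    show "finite (z ` B)" using B(1) by simp
    fix u x assume u: "(\<Sum>x\<in>z ` B. scale (u x) x) = 0" and "x \<in> z ` B"
    then obtain e where e: "e \<in> B" "x = z e" by blast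
    have "0 = b e (\<Sum>x\<in>z ` B. scale (u x) x)" using u by (simp add: b_simps)
    also have "\<dots> = (\<Sum>e'\<in>B. u (z e') * (if e = e' then 1 else 0))"
      by (simp add: sum.reindex[OF inj] b_simps z(2) e)
    also have "\<dots> = u x" using e B(1) by (simp add: if_distrib cong: if_cong)
    finally show "u x = 0" ..
  qed
  have "UNIV \<subseteq> span (z ` B)"
    using fd.dim_UNIV by (intro fd.card_ge_dim_independent ind) (auto simp: card_image[OF inj])
  then have "hom_basis scale W es \<and> hom_basis scale W (map z es)"
    using es B z(1) inj ind by (auto simp: hom_basis_def distinct_map shift_def)
      (metis diff_add_cancel)+
  then have "dual_bases scale W b (es, map z es)"
    using z(2) es by (auto simp: dual_bases_def nth_eq_iff_index_eq)
  then show ?thesis ..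
qed

end

lemma set_pick: "set p \<subseteq> {..<length xs} \<Longrightarrow> set (pick xs p) \<subseteq> set xs"
  by (auto simp: pick_def)

text \<open>\<open>chosen\<close> identifies the bases with the pair that \<open>SOME\<close>
  selects in \<open>pinczon\<close>, so that the bracket unfolds in the same coordinates as the
  forms.\<close>

locale based_space = quadratic_graded_space scale V b
  for scale :: "'k::field_char_0 \<Rightarrow> 'v::ab_group_add \<Rightarrow> 'v" and V b +
  fixes es es' :: "'v list"
  assumes dual_es: "dual_bases scale (shift V) b (es, es')"
    and chosen: "(SOME B. dual_bases scale (shift V) b B) = (es, es')"
begin

section \<open>Coordinates in a fixed pair of dual bases\<close>

definition m where "m = length es"
definition e where "e i = es ! i"
definition e' where "e' i = es' ! i"
definition dg where "dg i = hom_deg W (e i)"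
text \<open>By \<open>expand\<close>, the vector \<open>e' i\<close> has the coordinates
  \<open>b (e' i) (e' j)\<close>, so the Gram matrix of the dual basis holds the required
  coefficients.\<close>

definition cas where "cas i j = b (e' i) (e' j)"
definition bm where "bm i j = b (e i) (e j)"

lemma es_facts: "distinct es" "independent (set es)" "span (set es) = UNIV"
  "x \<in> set es \<Longrightarrow> \<exists>d. x \<in> W d" "x \<in> set es' \<Longrightarrow> \<exists>d. x \<in> W d" "length es' = m"
  using dual_es by (auto simp: dual_bases_def hom_basis_def m_def)

lemma e_mem: "i < m \<Longrightarrow> e i \<in> set es" "i < m \<Longrightarrow> e' i \<in> set es'"
  using es_facts(6) by (simp_all add: e_def e'_def m_def)

lemma b_dual: "i < m \<Longrightarrow> j < m \<Longrightarrow> b (e i) (e' j) = (if i = j then 1 else 0)"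
  using dual_es by (auto simp: dual_bases_def e_def e'_def m_def)

lemma e_nonzero: "i < m \<Longrightarrow> e i \<noteq> 0"
  using b_dual[of i i] by (auto simp: b_simps)

lemma e_in: "i < m \<Longrightarrow> e i \<in> W (dg i)"
  using hom_deg_eq e_nonzero e_mem(1) es_facts(4) by (metis dg_def)

lemma e'_nonzero: "i < m \<Longrightarrow> e' i \<noteq> 0"
  using b_dual[of i i] by (auto simp: b_simps)

text \<open>Paired vectors have opposite degrees in \<open>V\<close>, and each degree drops by 1
  under the shift, so that they add up to -2.\<close>

lemma e'_in: assumes "i < m" shows "e' i \<in> W (- dg i - 2)"
proof -
  obtain d where d: "e' i \<in> W d"
    using assms e_mem(2) es_facts(5) by blast
  have "e i \<in> V (dg i + 1)" "e' i \<in> V (d + 1)"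
    using e_in[OF assms] d by (auto simp: shift_def)
  then have "dg i + 1 + (d + 1) = 0"
    using degree_zero b_dual[OF assms assms] by fastforce
  then have "d = - dg i - 2" by simp
  with d show ?thesis by simp
qed

lemma hom_deg_e': "i < m \<Longrightarrow> hom_deg W (e' i) = - dg i - 2"
  by (intro hom_deg_eq e'_in e'_nonzero)

lemma expand: "x = (\<Sum>i<m. scale (b x (e' i)) (e i))"
proof -
  have "x \<in> span (set es)" using es_facts(3) by simp
  then obtain u where "x = (\<Sum>v\<in>set es. scale (u v) v)"
    by (auto simp: span_finite)
  also have "\<dots> = (\<Sum>i<m. scale (u (e i)) (e i))"
    using sum.reindex_bij_betw[OF bij_betw_nth[OF es_facts(1) refl refl], of "\<lambda>v. scale (u v) v"]
    by (simp add: e_def m_def)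
  finally have x: "x = (\<Sum>i<m. scale (u (e i)) (e i))" .
  have "b x (e' j) = u (e j)" if "j < m" for j
    by (subst x) (simp add: b_simps b_dual that if_distrib cong: if_cong)
  then have "(\<Sum>i<m. scale (b x (e' i)) (e i)) = (\<Sum>i<m. scale (u (e i)) (e i))" by simp
  with x show ?thesis by simp
qed

lemma coordinate_degree: "x \<in> W d \<Longrightarrow> i < m \<Longrightarrow> b x (e' i) \<noteq> 0 \<Longrightarrow> dg i = d"
  using e'_in[of i] degree_zero[of x "d + 1" "e' i" "- dg i - 2 + 1"] by (force simp: shift_def)

sublocale casimir_letters dg m cas bm
proof
  fix i k assume i: "i < m" "k < m"
  have "(\<Sum>l<m. cas i l * bm k l) = b (e k) (\<Sum>l<m. scale (b (e' i) (e' l)) (e l))"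
    by (simp add: cas_def bm_def b_simps)
  also have "\<dots> = b (e k) (e' i)" using expand[of "e' i"] by simp
  finally show "(\<Sum>l<m. cas i l * bm k l) = (if i = k then 1 else 0)"
    using i by (auto simp: b_dual)
next
  fix i j assume i: "i < m" "j < m"
  have V: "e' i \<in> V (- 1 - dg i)" "e' j \<in> V (- 1 - dg j)"
    using e'_in[OF i(1)] e'_in[OF i(2)] by (auto simp: shift_def)
  show par: "even (dg i + dg j)" if "cas i j \<noteq> 0"
  proof -
    have "- 1 - dg i + (- 1 - dg j) = 0"
      using degree_zero[OF V] that by (auto simp: cas_def)
    then have "dg i + dg j = - 2" by linarith
    then show ?thesis by simp
  qed
  \<comment> \<open>This is the symmetry of \<open>b\<close> in the degrees of \<open>V\<close>.
    Where \<open>cas i j\<close> is nonzero both indices have the same parity, and shifting both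
    degrees by one exchanges the even and the odd case, which turns symmetry into
    antisymmetry.\<close>
  have *: "cas i j = ksign (- 1 - dg i) (- 1 - dg j) * cas j i"
    using symmetric[OF V] by (simp add: cas_def)
  show "cas i j = - ksign (dg i) (dg j) * cas j i"
  proof (cases "cas i j = 0")
    case True
    then show ?thesis using * by (auto simp: ksign_def split: if_splits)
  next
    case False
    then show ?thesis using par * by (auto simp: ksign_def)
  qed
qed

section \<open>Homogeneous components and multilinear extension in coordinates\<close>

lemma hom_comp_eq: "hom_comp W x = (\<lambda>d. \<Sum>i | i < m \<and> dg i = d. scale (b x (e' i)) (e i))"
    (is "_ = ?c")
proof (rule hom_comp_eqI)
  have sub: "{d. ?c d \<noteq> 0} \<subseteq> dg ` {..<m}"
    by (auto elim!: sum.not_neutral_contains_not_neutral)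
  have "?c d \<in> W d" for d
    using e_in subspace_V[of "d + 1"]
    by (auto simp: shift_def intro!: subspace_sum subspace_scale)
  moreover have "x = (\<Sum>d | ?c d \<noteq> 0. ?c d)"
  proof -
    have "(\<Sum>d | ?c d \<noteq> 0. ?c d) = (\<Sum>d\<in>dg ` {..<m}. ?c d)"
      using sub by (intro sum.mono_neutral_left) auto
    also have "\<dots> = (\<Sum>d\<in>dg ` {..<m}. \<Sum>i | i \<in> {..<m} \<and> dg i = d. scale (b x (e' i)) (e i))"
      by simp
    also have "\<dots> = (\<Sum>i<m. scale (b x (e' i)) (e i))"
      by (rule sum.group) auto
    finally show ?thesis using expand[of x] by simp
  qed
  ultimately show "is_decomposition W x ?c"
    using finite_subset[OF sub] by (auto simp: is_decomposition_def)
qed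

lemma hom_comp_linear: "hom_comp W (x + y) d = hom_comp W x d + hom_comp W y d"
  "hom_comp W (scale c x) d = scale c (hom_comp W x d)"
  by (simp_all add: hom_comp_eq b_simps scale_left_distrib sum.distrib scale_sum_right)

lemma hom_comp_degree: "hom_comp W x d \<noteq> 0 \<Longrightarrow> d \<in> dg ` {..<m}"
  by (auto simp: hom_comp_eq elim!: sum.not_neutral_contains_not_neutral)

lemma hom_comp_e:
  assumes "i < m" shows "hom_comp W (e i) = (\<lambda>d. if d = dg i then e i else 0)"
proof
  fix d
  have "hom_comp W (e i) d = (\<Sum>j\<in>{j. j < m \<and> dg j = d}. if j = i then e i else 0)"
    unfolding hom_comp_eq using assms by (intro sum.cong) (auto simp: b_dual)
  then show "hom_comp W (e i) d = (if d = dg i then e i else 0)"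
    using assms by auto
qed

text \<open>Each basis vector has a single nonzero component, so only one degree list
  survives.\<close>

lemma multi_ext_basis:
  assumes "set w \<subseteq> {..<m}"
  shows "multi_ext W \<Phi> (map e w) = \<Phi> (map dg w) (map e w)"
proof -
  have 1: "hom_comp W (e (w ! i)) d \<noteq> 0 \<longleftrightarrow> d = dg (w ! i)" if "i < length w" for i d
  proof -
    have "w ! i < m" using assms that nth_mem by blast
    then show ?thesis by (simp add: hom_comp_e e_nonzero)
  qed
  have "{ds. length ds = length (map e w) \<and> (\<forall>i<length (map e w). hom_comp W (map e w ! i) (ds ! i) \<noteq> 0)} = {map dg w}"
    by (auto simp: 1 intro!: nth_equalityI)
  moreover have "map2 (hom_comp W) (map e w) (map dg w) = map e w"
    using assms by (intro nth_equalityI) (auto simp: hom_comp_e subset_iff)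
  ultimately show ?thesis by (simp add: multi_ext_def)
qed

definition degree_lists :: "nat \<Rightarrow> int list set" where
  "degree_lists n = {ds. set ds \<subseteq> dg ` {..<m} \<and> length ds = n}"

lemma finite_degree_lists: "finite (degree_lists n)"
  unfolding degree_lists_def by (rule finite_lists_length_eq) simp

text \<open>The index set in \<open>multi_ext\<close> varies with the arguments. A fixed finite
  index set allows linearity in one variable to be checked term by term.\<close>

lemma multi_ext_alt:
  assumes "\<And>ds xs. length ds = length xs \<Longrightarrow> 0 \<in> set xs \<Longrightarrow> \<Phi> ds xs = 0"
  shows "multi_ext W \<Phi> xs = (\<Sum>ds\<in>degree_lists (length xs). \<Phi> ds (map2 (hom_comp W) xs ds))"
  unfolding multi_ext_def
proof (rule sum.mono_neutral_left)
  show "{ds. length ds = length xs \<and> (\<forall>i<length xs. hom_comp W (xs ! i) (ds ! i) \<noteq> 0)} \<subseteq> degree_lists (length xs)"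
    using hom_comp_degree by (auto simp: degree_lists_def in_set_conv_nth) blast
  show "\<forall>ds\<in>degree_lists (length xs) - {ds. length ds = length xs \<and> (\<forall>i<length xs. hom_comp W (xs ! i) (ds ! i) \<noteq> 0)}.
       \<Phi> ds (map2 (hom_comp W) xs ds) = 0"
  proof
    fix ds assume "ds \<in> degree_lists (length xs) - {ds. length ds = length xs \<and> (\<forall>i<length xs. hom_comp W (xs ! i) (ds ! i) \<noteq> 0)}"
    then obtain i where "length ds = length xs" "i < length xs" "hom_comp W (xs ! i) (ds ! i) = 0"
      by (auto simp: degree_lists_def)
    moreover from this have "0 \<in> set (map2 (hom_comp W) xs ds)"
      using nth_mem[of i "map2 (hom_comp W) xs ds"] by simp
    ultimately show "\<Phi> ds (map2 (hom_comp W) xs ds) = 0"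
      using assms by simp
  qed
qed (rule finite_degree_lists)

lemma multilinear_multi_ext:
  assumes "\<And>ds xs ys. length ds = length xs + Suc (length ys) \<Longrightarrow> lin (\<lambda>v. \<Phi> ds (xs @ v # ys))"
  shows "multilinear scale (multi_ext W \<Phi>)"
proof (rule multilinearI)
  fix xs ys
  have z: "\<Phi> ds zs = 0" if z: "length ds = length zs" "0 \<in> set zs" for ds zs
  proof -
    obtain us vs where zs: "zs = us @ 0 # vs" using split_list[OF z(2)] by blast
    show ?thesis using lin_zero[OF assms, of ds us vs] z(1) zs by simp
  qed
  have "lin (\<lambda>v. \<Phi> ds (map2 (hom_comp W) (xs @ v # ys) ds))" if ds: "ds \<in> degree_lists (length xs + Suc (length ys))" for ds
  proof -
    have l: "length ds = length xs + Suc (length ys)" using ds by (simp add: degree_lists_def)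
    define d where "d = ds ! length xs"
    have s: "ds = take (length xs) ds @ d # drop (Suc (length xs)) ds"
      using l by (simp add: d_def id_take_nth_drop)
    have "map2 (hom_comp W) (xs @ v # ys) ds =
        map2 (hom_comp W) xs (take (length xs) ds) @ hom_comp W v d # map2 (hom_comp W) ys (drop (Suc (length xs)) ds)" for v
      using l by (subst s) (simp add: zip_append)
    moreover have "lin (\<lambda>v. \<Phi> ds (map2 (hom_comp W) xs (take (length xs) ds) @ v # map2 (hom_comp W) ys (drop (Suc (length xs)) ds)))"
      using l by (intro assms) simp
    ultimately show ?thesis
      by (simp add: lin_iff hom_comp_linear)
  qed
  then have "lin (\<lambda>v. \<Sum>ds\<in>degree_lists (length xs + Suc (length ys)). \<Phi> ds (map2 (hom_comp W) (xs @ v # ys) ds))"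
    by (rule lin_sum_fun)
  then show "lin (\<lambda>v. multi_ext W \<Phi> (xs @ v # ys))"
    by (simp add: multi_ext_alt z)
qed

lemma multi_ext_zero: "(\<And>ds ys. length ys = length xs \<Longrightarrow> length ds = length xs \<Longrightarrow> \<Phi> ds ys = 0) \<Longrightarrow> multi_ext W \<Phi> xs = 0"
  unfolding multi_ext_def by (rule sum.neutral) auto

text \<open>Words may use any natural numbers as letters. The value 0 beyond the basis keeps the
  identities for functions of words free of range conditions.\<close>

definition hat :: "('v, 'k) form \<Rightarrow> nat list \<Rightarrow> 'k" where
  "hat f w = (if set w \<subseteq> {..<m} then f (map e w) else 0)"

lemma hat_simps [simp]: "hat (f + g) = hat f + hat g" "hat (form_scale c f) = form_scale c (hat f)" "hat 0 = 0"
  by (auto simp: hat_def form_scale_def fun_eq_iff)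

lemma hat_sum [simp]: "hat (\<Sum>i\<in>I. F i) = (\<Sum>i\<in>I. hat (F i))"
  by (induction I rule: infinite_finite_induct) (simp_all only: sum.infinite sum.empty sum.insert hat_simps not_False_eq_True)

lemma hat_bad: "\<not> set w \<subseteq> {..<m} \<Longrightarrow> hat f w = 0"
  by (simp add: hat_def)

lemma multilinear_expand:
  assumes "multilinear scale f"
  shows "f (u @ x # v) = (\<Sum>i<m. b x (e' i) * f (u @ e i # v))"
proof -
  have "f (u @ x # v) = f (u @ (\<Sum>i<m. scale (b x (e' i)) (e i)) # v)"
    using expand[of x] by simp
  also have "\<dots> = (\<Sum>i<m. f (u @ scale (b x (e' i)) (e i) # v))"
    by (rule lin_sum[OF multilinearD[OF assms]])
  also have "\<dots> = (\<Sum>i<m. b x (e' i) * f (u @ e i # v))"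
    by (intro sum.cong refl linD(2)[OF multilinearD[OF assms]])
  finally show ?thesis .
qed

text \<open>Variables are expanded one at a time into the prefix \<open>u\<close>; a homogeneous
  vector involves only basis vectors of its own degree.\<close>

lemma multilinear_zero_homs:
  assumes f: "multilinear scale f" and "homs W ds xs"
    and "\<And>w. set w \<subseteq> {..<m} \<Longrightarrow> map dg w = ds \<Longrightarrow> f (u @ map e w) = 0"
  shows "f (u @ xs) = 0"
proof -
  have "list_all2 (\<lambda>d x. x \<in> W d) ds xs" using assms(2) by (simp add: homs_def)
  then show ?thesis using assms(3)
  proof (induction arbitrary: u rule: list_all2_induct)
    case Nil
    then show ?case using Nil[of "[]"] by simp
  next
    case (Cons d ds x xs)
    have "f (u @ x # xs) = (\<Sum>i<m. b x (e' i) * f (u @ e i # xs))"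
      by (rule multilinear_expand[OF f])
    also have "\<dots> = (\<Sum>i<m. 0)"
    proof (intro sum.cong refl)
      fix i assume "i \<in> {..<m}"
      then have i: "i < m" by simp
      show "b x (e' i) * f (u @ e i # xs) = 0"
      proof (cases "b x (e' i) = 0")
        case False
        then have d: "dg i = d" using Cons.hyps(1) i coordinate_degree by blast
        have "f ((u @ [e i]) @ xs) = 0"
        proof (rule Cons.IH)
          fix w assume "set w \<subseteq> {..<m}" "map dg w = ds"
          then show "f ((u @ [e i]) @ map e w) = 0"
            using Cons.prems[of "i # w"] d i by simp
        qed
        then show ?thesis by simp
      qed simp
    qed
    finally show ?case by simp
  qed
qed

lemma multilinear_eqI:
  assumes f: "multilinear scale f" and g: "multilinear scale g" and "hat f = hat g"
  shows "f = g"
proof -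
  define h where "h = f + form_scale (-1) g"
  have h: "multilinear scale h" unfolding h_def by (intro multilinear_add multilinear_scale f g)
  have hw: "h (map e w) = 0" if "set w \<subseteq> {..<m}" for w
    using that fun_cong[OF assms(3), of w] by (simp add: h_def hat_def form_scale_apply)
  have "h (map e w @ xs) = 0" if "set w \<subseteq> {..<m}" for w xs
    using that
  proof (induction xs arbitrary: w)
    case Nil
    then show ?case by (simp add: hw)
  next
    case (Cons x xs)
    have "h (map e w @ x # xs) = (\<Sum>i<m. b x (e' i) * h (map e (w @ [i]) @ xs))"
      using multilinear_expand[OF h, of "map e w" x xs] by simp
    also have "\<dots> = 0"
      using Cons.IH[of "w @ [i]" for i] Cons.prems by (intro sum.neutral) auto
    finally show ?case .
  qed
  from this[of "[]"] have "h xs = 0" for xs by simp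
  then show ?thesis by (auto simp: h_def form_scale_apply)
qed

lemma form_deg_iff:
  assumes "multilinear scale f"
  shows "form_deg W d f \<longleftrightarrow> (\<forall>w. hat f w \<noteq> 0 \<longrightarrow> d = - wd w)"
proof
  assume d: "form_deg W d f"
  show "\<forall>w. hat f w \<noteq> 0 \<longrightarrow> d = - wd w"
  proof (intro allI impI)
    fix w assume "hat f w \<noteq> 0"
    then have "set w \<subseteq> {..<m}" "f (map e w) \<noteq> 0" by (auto simp: hat_def split: if_splits)
    moreover from this have "homs W (map dg w) (map e w)"
      by (auto simp: homs_def list_all2_map1 list_all2_map2 list_all2_same e_in)
    ultimately show "d = - wd w" using d by (auto simp: form_deg_def wd_def)
  qed
next
  assume d: "\<forall>w. hat f w \<noteq> 0 \<longrightarrow> d = - wd w"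
  show "form_deg W d f"
    unfolding form_deg_def
  proof (intro allI impI, elim conjE, rule ccontr)
    fix ds xs assume *: "homs W ds xs" "f xs \<noteq> 0" "d \<noteq> - sum_list ds"
    have "f (map e w) = 0" if "set w \<subseteq> {..<m}" "map dg w = ds" for w
      using d[rule_format, of w] * that by (auto simp: hat_def wd_def)
    then show False using multilinear_zero_homs[OF assms *(1), of "[]"] * by simp
  qed
qed

text \<open>Reduces a symmetry to basis words of the given degrees. The difference \<open>h\<close>
  of the two sides is cut off to lists of the length of \<open>xs\<close>, because \<open>p\<close>
  permutes only those; with this cut-off it is multilinear on all lists.\<close>

lemma perm_extend:
  assumes f: "multilinear scale f" and p: "is_perm_of p {..<length xs}" and "homs W ds xs"
    and "\<And>w. set w \<subseteq> {..<m} \<Longrightarrow> map dg w = ds \<Longrightarrow> hat f w = c * hat f (pick w p)"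
  shows "f xs = c * f (pick xs p)"
proof -
  let ?n = "length xs"
  have p': "distinct p" "set p = {..<?n}" using p by (auto simp: is_perm_of_def)
  define h where "h zs = (if length zs = ?n then f zs - c * f (pick zs p) else 0)" for zs
  have "multilinear scale h"
  proof (rule multilinearI)
    fix us vs
    show "lin (\<lambda>v. h (us @ v # vs))"
    proof (cases "length us + Suc (length vs) = ?n")
      case True
      then have "lin (\<lambda>v. f (us @ v # vs) - c * f ([] @ pick (us @ v # vs) p))"
        using p' by (intro lin_intros(3) lin_intros(4)[OF lin_pick[OF f]] multilinearD f) auto
      then show ?thesis using True by (simp add: h_def)
    qed (simp add: h_def lin_intros(1))
  qed
  moreover have "h (map e w) = 0" if w: "set w \<subseteq> {..<m}" "map dg w = ds" for w
  proof -
    have l: "length w = ?n" using w(2) assms(3) by (auto simp: homs_def dest: list_all2_lengthD)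
    have "set (pick w p) \<subseteq> {..<m}" using set_pick[of p w] p'(2) l w(1) by simp
    moreover have "pick (map e w) p = map e (pick w p)" using p'(2) l by (intro pick_map) simp
    ultimately have "hat f (pick w p) = f (pick (map e w) p)"
      by (simp add: hat_def)
    moreover have "hat f w = f (map e w)" using w by (simp add: hat_def)
    ultimately show ?thesis using assms(4)[OF w] l by (simp add: h_def)
  qed
  ultimately have "h ([] @ xs) = 0"
    using multilinear_zero_homs[of h ds xs "[]"] assms(3) by simp
  then show ?thesis by (simp add: h_def)
qed

lemma homs_basis: "set w \<subseteq> {..<m} \<Longrightarrow> homs W (map dg w) (map e w)"
  by (auto simp: homs_def list_all2_map1 list_all2_map2 list_all2_same e_in)

lemma pick_swap:
  "pick (u @ x # y # v) ([0..<length u] @ [Suc (length u), length u] @ [Suc (Suc (length u))..<length (u @ x # y # v)]) = u @ y # x # v"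
  by (simp add: pick_upt nth_append del: upt_Suc)

lemma hat_swapI:
  fixes u v :: "nat list" and x y :: nat
  defines "w \<equiv> u @ x # y # v"
  assumes "set w \<subseteq> {..<m} \<Longrightarrow> f (map e w) =
      koszul (map dg w) ([0..<length u] @ [Suc (length u), length u] @ [Suc (Suc (length u))..<length w]) *
      f (pick (map e w) ([0..<length u] @ [Suc (length u), length u] @ [Suc (Suc (length u))..<length w]))"
  shows "hat f (u @ x # y # v) = ksign (dg x) (dg y) * hat f (u @ y # x # v)"
proof (cases "set w \<subseteq> {..<m}")
  case True
  let ?p = "[0..<length u] @ [Suc (length u), length u] @ [Suc (Suc (length u))..<length w]"
  have "koszul (map dg w) ?p = (ksign (dg x) (dg y) :: 'k)"
    unfolding koszul_swap w_def by (simp add: nth_append ksign_commute)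
  moreover have "pick (map e w) ?p = map e (u @ y # x # v)"
    using pick_swap[of "map e u" "e x" "e y" "map e v"] by (simp add: w_def)
  moreover have "set (u @ y # x # v) \<subseteq> {..<m}" using True by (auto simp: w_def)
  ultimately show ?thesis using assms(2)[OF True] True by (simp only: hat_def if_True w_def)
next
  case False
  moreover from this have "\<not> set (u @ y # x # v) \<subseteq> {..<m}" by (auto simp: w_def)
  ultimately show ?thesis
    using hat_bad[of w f] hat_bad[of "u @ y # x # v" f] by (simp only: mult_zero_right simp_thms w_def)
qed

text \<open>An adjacent transposition is a particular permutation. Conversely, a permuted word is
  sorted back at the cost of \<open>koszul\<close>, which is its own inverse.\<close>

lemma symmetric_form_iff:
  assumes f: "multilinear scale f"
  shows "symmetric_form W f \<longleftrightarrow> wsym (hat f)"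
proof
  assume s: "symmetric_form W f"
  show "wsym (hat f)"
    unfolding wsym_def
  proof (intro allI)
    fix u v :: "nat list" and x y :: nat
    let ?w = "u @ x # y # v"
    let ?p = "[0..<length u] @ [Suc (length u), length u] @ [Suc (Suc (length u))..<length ?w]"
    show "hat f ?w = ksign (dg x) (dg y) * hat f (u @ y # x # v)"
    proof (rule hat_swapI)
      assume True: "set ?w \<subseteq> {..<m}"
      have p: "is_perm_of ?p {..<length (map e ?w)}"
        by (auto simp: is_perm_of_def simp del: upt_Suc)
      show "f (map e ?w) = koszul (map dg ?w) ?p * f (pick (map e ?w) ?p)"
        using s[unfolded symmetric_form_def, rule_format, OF conjI, OF homs_basis[OF True] p] .
    qed
  qed
next
  assume s: "wsym (hat f)"
  show "symmetric_form W f"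
    unfolding symmetric_form_def
  proof (intro allI impI, elim conjE)
    fix ds xs p assume h: "homs W ds xs" and p: "is_perm_of p {..<length xs}"
    show "f xs = koszul ds p * f (pick xs p)"
    proof (rule perm_extend[OF f p h])
      fix w assume w: "set w \<subseteq> {..<m}" "map dg w = ds"
      have l: "length w = length xs" using w(2) h by (auto simp: homs_def dest: list_all2_lengthD)
      have p': "distinct p" "set p = {..<length w}" using p l by (auto simp: is_perm_of_def)
      have "hat f (pick w p) = koszul ds p * hat f (pick w (sort p))"
        using wsym_sort[OF s, of p w "[]"] p'(2) w(2) by simp
      moreover have "sort p = [0..<length w]"
        using p' by (intro sorted_distinct_set_unique) (auto simp: lessThan_atLeast0)
      ultimately have "koszul ds p * hat f (pick w p) = (koszul ds p * koszul ds p) * hat f w"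
        by (simp add: mult.assoc)
      then show "hat f w = koszul ds p * hat f (pick w p)" by (simp add: koszul_square)
    qed
  qed
qed

text \<open>A swap followed by exactly one letter would mix the two blocks of variables and is
  therefore excluded.\<close>

definition wbisym :: "(nat list \<Rightarrow> 'k) \<Rightarrow> bool" where
  "wbisym F \<longleftrightarrow> (\<forall>u x y v. 2 \<le> length v \<longrightarrow> F (u @ x # y # v) = ksign (dg x) (dg y) * F (u @ y # x # v))
     \<and> (\<forall>u x y. F (u @ [x, y]) = ksign (dg x) (dg y) * F (u @ [y, x]))"

lemma bisymmetric_form_iff:
  assumes f: "multilinear scale f"
  shows "bisymmetric_form W f \<longleftrightarrow> wbisym (hat f)"
proof
  assume s: "bisymmetric_form W f"
  have *: "hat f (u @ x # y # v) = ksign (dg x) (dg y) * hat f (u @ y # x # v)" if v: "length v \<noteq> 1" for u x y v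
  proof -
    let ?w = "u @ x # y # v"
    let ?p = "[0..<length u] @ [Suc (length u), length u] @ [Suc (Suc (length u))..<length ?w]"
    show ?thesis
    proof (rule hat_swapI)
      assume good: "set ?w \<subseteq> {..<m}"
      show "f (map e ?w) = koszul (map dg ?w) ?p * f (pick (map e ?w) ?p)"
      proof (cases "v = []")
        case True
        let ?k = "length u"
        have "is_perm_of [0..<?k] {..<?k}" "is_perm_of [Suc ?k, ?k] {?k, ?k + 1}"
          by (auto simp: is_perm_of_def)
        then have "f (map e ?w) = koszul (map dg ?w) ([0..<?k] @ [Suc ?k, ?k]) * f (pick (map e ?w) ([0..<?k] @ [Suc ?k, ?k]))"
          using s[unfolded bisymmetric_form_def, rule_format, of "map dg ?w" "map e ?w" ?k "[0..<?k]" "[Suc ?k, ?k]"]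
             homs_basis[OF good] True by simp
        then show ?thesis using True by (simp del: koszul_append)
      next
        case False
        define k where "k = length u + length v"
        have lv: "2 \<le> length v" using False v by (cases v; cases "tl v") auto
        let ?p0 = "[0..<length u] @ [Suc (length u), length u] @ [Suc (Suc (length u))..<k]"
        have "is_perm_of ?p0 {..<k}" "is_perm_of [k, Suc k] {k, k + 1}"
          using lv by (auto simp: is_perm_of_def k_def simp del: upt_Suc)
        then have "f (map e ?w) = koszul (map dg ?w) (?p0 @ [k, Suc k]) * f (pick (map e ?w) (?p0 @ [k, Suc k]))"
          using s[unfolded bisymmetric_form_def, rule_format, of "map dg ?w" "map e ?w" k ?p0 "[k, Suc k]"]
             homs_basis[OF good] by (simp add: k_def)
        moreover have "[Suc (Suc (length u))..<length ?w] = [Suc (Suc (length u))..<k] @ [k, Suc k]"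
          using lv by (simp add: k_def upt_Suc_append)
        ultimately show ?thesis by simp
      qed
    qed
  qed
  show "wbisym (hat f)"
    unfolding wbisym_def
  proof (intro conjI allI impI)
    fix u v :: "nat list" and x y :: nat
    assume "2 \<le> length v"
    then show "hat f (u @ x # y # v) = ksign (dg x) (dg y) * hat f (u @ y # x # v)" by (intro *) simp
  qed (rule *, simp)
next
  assume s: "wbisym (hat f)"
  have s1: "2 \<le> length v \<Longrightarrow> hat f (u @ x # y # v) = ksign (dg x) (dg y) * hat f (u @ y # x # v)" for u x y v
    using s unfolding wbisym_def by blast
  have s2: "hat f (u @ [x, y]) = ksign (dg x) (dg y) * hat f (u @ [y, x])" for u x y
    using s unfolding wbisym_def by blast
  show "bisymmetric_form W f"
    unfolding bisymmetric_form_def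
  proof (intro allI impI, elim conjE)
    fix k ds xs p q assume h: "homs W ds xs" and n: "length xs = k + 2"
      and p: "is_perm_of p {..<k}" and q: "is_perm_of q {k, k + 1}"
    have pq: "is_perm_of (p @ q) {..<length xs}"
      using p q n by (auto simp: is_perm_of_def)
    show "f xs = koszul ds (p @ q) * f (pick xs (p @ q))"
    proof (rule perm_extend[OF f pq h])
      fix w assume w: "set w \<subseteq> {..<m}" "map dg w = ds"
      have l: "length w = k + 2" using w(2) h n by (auto simp: homs_def dest: list_all2_lengthD)
      have p': "distinct p" "set p = {..<k}" and q': "distinct q" "set q = {k, k + 1}"
        using p q by (auto simp: is_perm_of_def)
      have lq: "length q = 2" using q' distinct_card[of q] by simp
      have "hat f (pick w (p @ q)) = koszul ds p * hat f (pick w (sort p @ q))"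
      proof (rule koszul_sort[of p "\<lambda>p. hat f (pick w (p @ q))"])
        fix u i j v assume "mset (u @ i # j # v) = mset p"
        then have "i \<in># mset p" "j \<in># mset p" by (metis in_multiset_in_set in_set_conv_decomp append.assoc append_Cons append_Nil)+
        then have "i < length w" "j < length w" using p' l by auto
        then have "ds ! i = dg (w ! i)" "ds ! j = dg (w ! j)" using w(2) by auto
        moreover have "2 \<le> length (pick w (v @ q))" using lq by simp
        ultimately have "hat f (pick w u @ w ! i # w ! j # pick w (v @ q)) =
            ksign (ds ! i) (ds ! j) * hat f (pick w u @ w ! j # w ! i # pick w (v @ q))"
          by (simp only: s1[of "pick w (v @ q)" "pick w u" "w ! i" "w ! j"])
        then show "hat f (pick w ((u @ i # j # v) @ q)) = ksign (ds ! i) (ds ! j) * hat f (pick w ((u @ j # i # v) @ q))"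
          by (simp only: pick_simps append_Cons append_assoc)
      qed
      moreover have "sort p = [0..<k]"
        using p' by (intro sorted_distinct_set_unique) (auto simp: lessThan_atLeast0)
      moreover have "hat f (pick w ([0..<k] @ q)) = koszul ds q * hat f (pick w ([0..<k] @ sort q))"
      proof (rule koszul_sort[of q "\<lambda>q. hat f (pick w ([0..<k] @ q))"])
        fix u i j v assume m: "mset (u @ i # j # v) = mset q"
        then have "length (u @ i # j # v) = 2" using lq by (metis size_mset)
        then have uv: "u = []" "v = []" by auto
        have "i \<in># mset q" "j \<in># mset q"
          using m by (metis in_multiset_in_set in_set_conv_decomp append.assoc append_Cons append_Nil)+
        then have "i < length w" "j < length w" using q' l by auto
        then have "ds ! i = dg (w ! i)" "ds ! j = dg (w ! j)" using w(2) by auto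
        then have "hat f (pick w [0..<k] @ [w ! i, w ! j]) =
            ksign (ds ! i) (ds ! j) * hat f (pick w [0..<k] @ [w ! j, w ! i])"
          by (simp only: s2[of "pick w [0..<k]" "w ! i" "w ! j"])
        then show "hat f (pick w ([0..<k] @ u @ i # j # v)) = ksign (ds ! i) (ds ! j) * hat f (pick w ([0..<k] @ u @ j # i # v))"
          by (simp only: pick_simps uv append_Nil)
      qed
      moreover have "sort q = [k..<k + 2]"
        using q' by (intro sorted_distinct_set_unique) auto
      moreover have "[0..<k] @ [k..<k + 2] = [0..<length w]"
        using l upt_add_eq_append[of 0 k 2] by simp
      \<comment> \<open>All indices in \<open>p\<close> lie below those in \<open>q\<close>, so
        there is no inversion between the blocks.\<close>
      moreover have "koszul ds (p @ q) = koszul ds p * (koszul ds q :: 'k)"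
      proof -
        have c: "cross ds a q = (1 :: 'k)" if "a \<in> set p" for a
          using that p' q' by (intro cross_eq_1) auto
        have "(\<Prod>a\<leftarrow>p. cross ds a q :: 'k) = (\<Prod>a\<leftarrow>p. 1)"
          by (intro arg_cong[of _ _ prod_list] map_cong refl c)
        then show ?thesis by (simp add: koszul_append map_replicate_const)
      qed
      ultimately have "hat f (pick w (p @ q)) = koszul ds (p @ q) * hat f w"
        by (simp only: mult.assoc pick_all)
      then have "koszul ds (p @ q) * hat f (pick w (p @ q)) = (koszul ds (p @ q) * koszul ds (p @ q)) * hat f w"
        by (simp only: mult.assoc)
      then show "hat f w = koszul ds (p @ q) * hat f (pick w (p @ q))" by (simp only: koszul_square mult_1_left)
    qed
  qed
qed

end

lemma last_two: "2 \<le> length v \<Longrightarrow> \<exists>u i j. v = u @ [i, j]"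
proof -
  assume v: "2 \<le> length v"
  then obtain v1 j where "v = v1 @ [j]" by (cases v rule: rev_cases) auto
  with v show ?thesis by (cases v1 rule: rev_cases) auto
qed

lemma cross_shift:
  "cross (pre @ ds) (length pre + a) (map ((+) (length pre)) p) = (cross ds a p :: 'k::comm_ring_1)"
  by (induction p) simp_all

lemma koszul_shift:
  "koszul (pre @ ds) (map ((+) (length pre)) p) = (koszul ds p :: 'k::comm_ring_1)"
  by (induction p) (simp_all add: koszul_Cons cross_shift)

context graded_letters
begin

lemma shuf_bad:
  assumes "\<And>w. \<not> set w \<subseteq> S \<Longrightarrow> f w = 0" "\<And>w. \<not> set w \<subseteq> S \<Longrightarrow> g w = 0" "\<not> set w \<subseteq> S"
  shows "shuf f g w = 0"
  using assms
proof (induction w arbitrary: f g)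
  case (Cons x w)
  show ?case
  proof (cases "x \<in> S")
    case True
    then have "\<not> set w \<subseteq> S" using Cons.prems(3) by simp
    moreover have "\<not> set v \<subseteq> S \<Longrightarrow> contr x g v = 0" "\<not> set v \<subseteq> S \<Longrightarrow> contr x f v = 0"
      "\<not> set v \<subseteq> S \<Longrightarrow> twist (dg x) g v = 0" for v
      using Cons.prems(1,2)[of "x # v"] Cons.prems(2)[of v] by (simp_all add: contr_def twist_def)
    ultimately have "shuf f (contr x g) w = 0" "shuf (contr x f) (twist (dg x) g) w = 0"
      using Cons.prems(1) by (blast intro: Cons.IH)+
    then show ?thesis by simp
  next
    case False
    then have "contr x f = 0" "contr x g = 0"
      using Cons.prems(1,2) by (auto simp: contr_def fun_eq_iff)
    then show ?thesis by simp
  qed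
qed simp

lemma cross_split_sign:
  assumes "\<And>a. a \<in> set I \<Longrightarrow> a < length w" "\<And>a. a \<in> set J \<Longrightarrow> a < length w"
    "\<And>a b. a \<in> set I \<Longrightarrow> b \<in> set J \<Longrightarrow> a < b"
  shows "split_sign (map dg w) I J = (ksign (wd (pick w I)) (wd (pick w J)) :: 'k::comm_ring_1)"
proof -
  have "split_sign (map dg w) I J = (\<Prod>a\<leftarrow>I. \<Prod>b\<leftarrow>J. ksign (dg (w ! a)) (dg (w ! b)) :: 'k)"
    unfolding split_sign_def using assms
    by (intro arg_cong[of _ _ prod_list] map_cong refl) auto
  also have "\<dots> = ksign (wd (pick w I)) (wd (pick w J))"
    unfolding wd_def by (subst ksign_sum_list(2), subst ksign_sum_list(1)) (simp add: pick_def comp_def)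
  finally show ?thesis .
qed

end

text \<open>The tensor product has the sign of the symmetric product for the particular subsets
  \<open>I\<close> that are initial blocks.\<close>

lemma (in graded_letters) koszul_take:
  fixes ds :: "int list"
  assumes "k \<le> length ds"
  shows "koszul ([- sum_list (take k ds), - sum_list (drop k ds)] @ ds)
    ([0] @ map ((+) 2) [0..<k] @ [1] @ map ((+) 2) [k..<length ds]) =
    (split_sign ds [0..<k] [k..<length ds] :: 'k::comm_ring_1)"
proof -
  have "pick ds [0..<k] = take k ds" "pick ds [k..<length ds] = drop k ds"
    using pick_upt[of k ds 0] pick_upt[of "length ds" ds k] assms by simp_all
  then show ?thesis
    using koszul_split[of "[0..<k]" "[k..<length ds]" ds] by simp
qed

abbreviation inside :: "nat set \<Rightarrow> nat \<Rightarrow> nat list" where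
  "inside A n \<equiv> filter (\<lambda>i. i \<in> A) [0..<n]"

abbreviation outside :: "nat set \<Rightarrow> nat \<Rightarrow> nat list" where
  "outside A n \<equiv> filter (\<lambda>i. i \<notin> A) [0..<n]"

section \<open>Symmetric products and tensors in coordinates\<close>

context based_space
begin

abbreviation S where "S \<equiv> sym_forms scale W"
abbreviation C2 where "C2 \<equiv> sym_bilinear_forms scale W"
abbreviation P where "P \<equiv> bisym_forms scale W"

lemma pick_basis:
  assumes "set w \<subseteq> {..<m}" "set p \<subseteq> {..<length w}"
  shows "f (map e u @ pick (map e w) p) = f (map e (u @ pick w p))" "set (pick w p) \<subseteq> {..<m}"
  using set_pick[OF assms(2)] assms(1) by (auto simp: pick_map[OF assms(2)])

lemma hat_pick:
  assumes "set w \<subseteq> {..<m}" "set p \<subseteq> {..<length w}"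
  shows "f (pick (map e w) p) = hat f (pick w p)"
  using pick_basis(2)[OF assms] by (simp add: hat_def pick_map[OF assms(2)])

lemma hat_sym_prod: "hat (sym_prod W f g) = shuf (hat f) (hat g)"
proof
  fix w show "hat (sym_prod W f g) w = shuf (hat f) (hat g) w"
  proof (cases "set w \<subseteq> {..<m}")
    case True
    have "koszul ([- sum_list (pick (map dg w) I), - sum_list (pick (map dg w) J)] @ map dg w) ([0] @ map ((+) 2) I @ [1] @ map ((+) 2) J) =
       (split_sign (map dg w) I J :: 'k)"
      if "I = inside A (length w)" "J = outside A (length w)" for A I J
      unfolding that by (rule koszul_split) (auto intro!: sorted_wrt_filter)
    note k = this[OF refl refl]
    have "hat (sym_prod W f g) w = sym_prod W f g (map e w)" using True by (simp add: hat_def)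
    also have "\<dots> = shuf (hat f) (hat g) w"
      unfolding sym_prod_def multi_ext_basis[OF True] shuf_subsets Let_def length_map k
      by (intro sum.cong refl arg_cong2[where f = "(*)"] hat_pick True) auto
    finally show ?thesis .
  next
    case False
    then show ?thesis using shuf_bad[of "{..<m}" "hat f" "hat g" w] hat_bad by simp
  qed
qed

lemma filter_pick:
  "distinct (inside A n @ outside A n)"
  "set (inside A n @ outside A n) = {..<n}"
  by auto

lemma multilinear_sym_prod:
  assumes "multilinear scale f" "multilinear scale g"
  shows "multilinear scale (sym_prod W f g)"
  unfolding sym_prod_def Let_def
proof (rule multilinear_multi_ext)
  fix ds :: "int list" and xs ys :: "'v list"
  have l: "length (xs @ v # ys) = length xs + Suc (length ys)" for v by simp
  show "lin (\<lambda>v. \<Sum>A\<in>Pow {..<length (xs @ v # ys)}.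
      koszul ([- sum_list (pick ds (inside A (length (xs @ v # ys)))), - sum_list (pick ds (outside A (length (xs @ v # ys))))] @ ds)
       ([0] @ map ((+) 2) (inside A (length (xs @ v # ys))) @ [1] @ map ((+) 2) (outside A (length (xs @ v # ys)))) *
      f (pick (xs @ v # ys) (inside A (length (xs @ v # ys)))) * g (pick (xs @ v # ys) (outside A (length (xs @ v # ys)))))"
    unfolding l
    by (intro lin_sum_fun lin_pick_product[of f g _ _ _ _ "[]" _ "[]", unfolded append_Nil] assms filter_pick(1))
      (unfold filter_pick(2), simp)
qed

lemma finite_arity_sym_prod:
  assumes "finite_arity f" "finite_arity g"
  shows "finite_arity (sym_prod W f g)"
proof -
  obtain N M where N: "\<And>xs. N \<le> length xs \<Longrightarrow> f xs = 0" and M: "\<And>xs. M \<le> length xs \<Longrightarrow> g xs = 0"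
    using assms by (auto simp: finite_arity_def)
  have "sym_prod W f g xs = 0" if n: "N + M \<le> length xs" for xs
    unfolding sym_prod_def Let_def
  proof (intro multi_ext_zero sum.neutral ballI)
    fix ds A and ys :: "'v list" assume l: "length ys = length xs"
    let ?I = "inside A (length ys)" and ?J = "outside A (length ys)"
    have "length ?I + length ?J = length ys"
      using sum_length_filter_compl[of "\<lambda>i. i \<in> A" "[0..<length ys]"] by simp
    then have "N \<le> length ?I \<or> M \<le> length ?J" using n l by linarith
    then have "f (pick ys ?I) = 0 \<or> g (pick ys ?J) = 0" using N M by auto
    then show "koszul ([- sum_list (pick ds ?I), - sum_list (pick ds ?J)] @ ds) ([0] @ map ((+) 2) ?I @ [1] @ map ((+) 2) ?J) * f (pick ys ?I) * g (pick ys ?J) = 0"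
      by auto
  qed
  then show ?thesis by (auto simp: finite_arity_def)
qed

lemma sym_formsD: assumes "f \<in> S"
  shows "multilinear scale f" "finite_arity f" "wsym (hat f)"
  using assms symmetric_form_iff by (auto simp: sym_forms_def)

lemma sym_formsI: "multilinear scale f \<Longrightarrow> finite_arity f \<Longrightarrow> wsym (hat f) \<Longrightarrow> f \<in> S"
  using symmetric_form_iff by (auto simp: sym_forms_def)

lemma sym_prod_closed:
  "f \<in> S \<Longrightarrow> g \<in> S \<Longrightarrow> sym_prod W f g \<in> S"
  by (intro sym_formsI multilinear_sym_prod finite_arity_sym_prod)
    (auto dest: sym_formsD simp: hat_sym_prod intro!: wsym_shuf)

lemma bilinear_formD:
  assumes "\<alpha> \<in> C2"
  shows "\<alpha> \<in> S" "length xs \<noteq> 2 \<Longrightarrow> \<alpha> xs = 0" "length w \<noteq> 2 \<Longrightarrow> hat \<alpha> w = 0"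
  using assms by (auto simp: sym_bilinear_forms_def hat_def)

text \<open>Since \<alpha> takes exactly two arguments, one splitting of the word survives; all of
  \<open>v\<close> stands before the last two letters, which makes the sign a single
  \<open>ksign\<close>.\<close>

lemma hat_tensor:
  assumes \<alpha>: "\<alpha> \<in> C2"
  shows "hat (tensor W \<Omega> \<alpha>) (v @ [i, j]) = ksign (dg i + dg j) (wd v) * hat \<Omega> v * hat \<alpha> [i, j]"
proof (cases "set (v @ [i, j]) \<subseteq> {..<m}")
  case True
  let ?w = "v @ [i, j]" and ?n = "length v"
  have k: "koszul ([- sum_list (take k (map dg ?w)), - sum_list (drop k (map dg ?w))] @ map dg ?w)
         ([0] @ map ((+) 2) [0..<k] @ [1] @ map ((+) 2) [k..<length ?w]) = (split_sign (map dg ?w) [0..<k] [k..<length ?w] :: 'k)"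
    if "k \<le> length ?w" for k
    using koszul_take[of k "map dg ?w", unfolded length_map, OF that] .
  have "hat (tensor W \<Omega> \<alpha>) ?w = tensor W \<Omega> \<alpha> (map e ?w)" using True by (simp only: hat_def if_True)
  also have "\<dots> = (\<Sum>k\<le>length ?w. split_sign (map dg ?w) [0..<k] [k..<length ?w] * \<Omega> (take k (map e ?w)) * \<alpha> (drop k (map e ?w)))"
    unfolding tensor_def multi_ext_basis[OF True] length_map
    by (intro sum.cong refl) (simp only: k atMost_iff)
  also have "\<dots> = (\<Sum>k\<le>length ?w. if k = ?n then ksign (dg i + dg j) (wd v) * hat \<Omega> v * hat \<alpha> [i, j] else 0)"
  proof (intro sum.cong refl)
    fix k assume k: "k \<in> {..length ?w}"
    show "split_sign (map dg ?w) [0..<k] [k..<length ?w] * \<Omega> (take k (map e ?w)) * \<alpha> (drop k (map e ?w)) =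
        (if k = ?n then ksign (dg i + dg j) (wd v) * hat \<Omega> v * hat \<alpha> [i, j] else 0)"
    proof (cases "k = ?n")
      case True
      have "split_sign (map dg ?w) [0..<?n] [?n..<length ?w] = (ksign (wd (pick ?w [0..<?n])) (wd (pick ?w [?n..<length ?w])) :: 'k)"
        by (rule cross_split_sign) (auto simp del: upt_Suc)
      also have "\<dots> = ksign (dg i + dg j) (wd v)"
        by (subst pick_upt, simp, subst pick_upt, simp, simp add: ksign_commute)
      finally show ?thesis
        using True \<open>set (v @ [i, j]) \<subseteq> {..<m}\<close> by (simp add: hat_def del: upt_Suc)
    next
      case False
      then have "length (drop k (map e ?w)) \<noteq> 2" using k by simp
      then show ?thesis using False bilinear_formD(2)[OF \<alpha>] by simp
    qed
  qed
  finally show ?thesis by simp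
next
  case False
  then show ?thesis by (auto simp: hat_def)
qed

lemma coe_tensor:
  "\<alpha> \<in> C2 \<Longrightarrow> coe (hat (tensor W \<Omega> \<alpha>)) i j = form_scale (hat \<alpha> [i, j]) (hat \<Omega>)"
  unfolding coe_def hat_tensor by (auto simp: form_scale_def mult.assoc)

lemma tensor_short:
  assumes \<alpha>: "\<alpha> \<in> C2" and "length xs < 2"
  shows "tensor W \<Omega> \<alpha> xs = 0"
  unfolding tensor_def
proof (intro multi_ext_zero sum.neutral ballI)
  fix ds k and ys :: "'v list" assume "length ys = length xs"
  then have "\<alpha> (drop k ys) = 0" using assms(2) by (intro bilinear_formD(2)[OF \<alpha>]) auto
  then show "koszul ([- sum_list (take k ds), - sum_list (drop k ds)] @ ds)
         ([0] @ map ((+) 2) [0..<k] @ [1] @ map ((+) 2) [k..<length ys]) * \<Omega> (take k ys) * \<alpha> (drop k ys) = 0" by simp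
qed

lemma multilinear_tensor:
  assumes "multilinear scale f" "multilinear scale g"
  shows "multilinear scale (tensor W f g)"
  unfolding tensor_def
proof (rule multilinear_multi_ext)
  fix ds :: "int list" and xs ys :: "'v list"
  have l: "length (xs @ v # ys) = length xs + Suc (length ys)" for v by simp
  have "lin (\<lambda>v. \<Sum>k\<le>length xs + Suc (length ys).
      koszul ([- sum_list (take k ds), - sum_list (drop k ds)] @ ds)
       ([0] @ map ((+) 2) [0..<k] @ [1] @ map ((+) 2) [k..<length xs + Suc (length ys)]) *
      f (pick (xs @ v # ys) [0..<k]) * g (pick (xs @ v # ys) [k..<length xs + Suc (length ys)]))"
    by (intro lin_sum_fun lin_pick_product[of f g _ _ _ _ "[]" _ "[]", unfolded append_Nil] assms) auto
  moreover have "pick (xs @ v # ys) [0..<k] = take k (xs @ v # ys)"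
    "pick (xs @ v # ys) [k..<length xs + Suc (length ys)] = drop k (xs @ v # ys)"
    if "k \<in> {..length xs + Suc (length ys)}" for k v
    using that pick_upt[of k "xs @ v # ys" 0] pick_upt[of "length xs + Suc (length ys)" "xs @ v # ys" k]
    by (simp_all del: upt_Suc)
  then have "(\<Sum>k\<le>length (xs @ v # ys).
      koszul ([- sum_list (take k ds), - sum_list (drop k ds)] @ ds)
       ([0] @ map ((+) 2) [0..<k] @ [1] @ map ((+) 2) [k..<length (xs @ v # ys)]) *
      f (take k (xs @ v # ys)) * g (drop k (xs @ v # ys))) =
    (\<Sum>k\<le>length xs + Suc (length ys).
      koszul ([- sum_list (take k ds), - sum_list (drop k ds)] @ ds)
       ([0] @ map ((+) 2) [0..<k] @ [1] @ map ((+) 2) [k..<length xs + Suc (length ys)]) *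
      f (pick (xs @ v # ys) [0..<k]) * g (pick (xs @ v # ys) [k..<length xs + Suc (length ys)]))" for v
    unfolding l by (intro sum.cong refl) (simp only:)
  ultimately show "lin (\<lambda>v. \<Sum>k\<le>length (xs @ v # ys).
      koszul ([- sum_list (take k ds), - sum_list (drop k ds)] @ ds)
       ([0] @ map ((+) 2) [0..<k] @ [1] @ map ((+) 2) [k..<length (xs @ v # ys)]) *
      f (take k (xs @ v # ys)) * g (drop k (xs @ v # ys)))"
    by (simp only:)
qed

lemma finite_arity_tensor:
  assumes "finite_arity f" "finite_arity g"
  shows "finite_arity (tensor W f g)"
proof -
  obtain N M where N: "\<And>xs. N \<le> length xs \<Longrightarrow> f xs = 0" and M: "\<And>xs. M \<le> length xs \<Longrightarrow> g xs = 0"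
    using assms by (auto simp: finite_arity_def)
  have "tensor W f g xs = 0" if n: "N + M \<le> length xs" for xs
    unfolding tensor_def
  proof (intro multi_ext_zero sum.neutral ballI)
    fix ds k and ys :: "'v list" assume l: "length ys = length xs" and k: "k \<in> {..length ys}"
    have "N \<le> length (take k ys) \<or> M \<le> length (drop k ys)" using n l k by auto
    then have "f (take k ys) = 0 \<or> g (drop k ys) = 0" using N M by auto
    then show "koszul ([- sum_list (take k ds), - sum_list (drop k ds)] @ ds)
         ([0] @ map ((+) 2) [0..<k] @ [1] @ map ((+) 2) [k..<length ys]) * f (take k ys) * g (drop k ys) = 0"
      by auto
  qed
  then show ?thesis by (auto simp: finite_arity_def)
qed

lemma bisym_formsD: assumes "F \<in> P"
  shows "multilinear scale F" "finite_arity F" "wbisym (hat F)" "length xs < 2 \<Longrightarrow> F xs = 0"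
  using assms bisymmetric_form_iff by (auto simp: bisym_forms_def)

lemma bisym_formsI: "multilinear scale F \<Longrightarrow> finite_arity F \<Longrightarrow> wbisym (hat F) \<Longrightarrow>
    (\<And>xs. length xs < 2 \<Longrightarrow> F xs = 0) \<Longrightarrow> F \<in> P"
  using bisymmetric_form_iff by (auto simp: bisym_forms_def)

lemma tensor_closed:
  assumes \<Omega>: "\<Omega> \<in> S" and \<alpha>: "\<alpha> \<in> C2"
  shows "tensor W \<Omega> \<alpha> \<in> P"
proof (rule bisym_formsI)
  note \<alpha>' = bilinear_formD[OF \<alpha>]
  show "multilinear scale (tensor W \<Omega> \<alpha>)" "finite_arity (tensor W \<Omega> \<alpha>)"
    by (intro multilinear_tensor finite_arity_tensor sym_formsD[OF \<Omega>] sym_formsD[OF \<alpha>'(1)])+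
  show "tensor W \<Omega> \<alpha> xs = 0" if "length xs < 2" for xs
    using that by (rule tensor_short[OF \<alpha>])
  show "wbisym (hat (tensor W \<Omega> \<alpha>))"
    unfolding wbisym_def
  proof (intro conjI allI impI)
    fix u v :: "nat list" and x y :: nat assume "2 \<le> length v"
    then obtain v' i j where v: "v = v' @ [i, j]" using last_two by blast
    have "hat (tensor W \<Omega> \<alpha>) ((u @ x # y # v') @ [i, j]) = ksign (dg x) (dg y) * hat (tensor W \<Omega> \<alpha>) ((u @ y # x # v') @ [i, j])"
      unfolding hat_tensor[OF \<alpha>] wsymD[OF sym_formsD(3)[OF \<Omega>], of u x y v'] by (simp add: algebra_simps)
    then show "hat (tensor W \<Omega> \<alpha>) (u @ x # y # v) = ksign (dg x) (dg y) * hat (tensor W \<Omega> \<alpha>) (u @ y # x # v)"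
      by (simp add: v)
  next
    fix u :: "nat list" and x y :: nat
    show "hat (tensor W \<Omega> \<alpha>) (u @ [x, y]) = ksign (dg x) (dg y) * hat (tensor W \<Omega> \<alpha>) (u @ [y, x])"
      unfolding hat_tensor[OF \<alpha>]
      using wsymD[OF sym_formsD(3)[OF \<alpha>'(1)], of "[]" x y "[]"] by (simp add: algebra_simps)
  qed
qed

end

section \<open>The Pinczon bracket in coordinates\<close>

text \<open>Indexes the rotations by the letter that comes last instead of first, as is needed when
  the bilinear form is the second factor. The shift by one is harmless because \<open>n\<close>
  rotations give the identity.\<close>

lemma sum_rotate_shift:
  assumes "0 < n"
  shows "(\<Sum>r<n. F (rotate r [0..<n])) = (\<Sum>s<n. F (([Suc s..<n] @ [0..<s]) @ [s]) :: 'a::ab_group_add)"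
proof -
  have "(\<Sum>r<n. F (rotate r [0..<n])) + F (rotate n [0..<n]) = (\<Sum>r<Suc n. F (rotate r [0..<n]))"
    by simp
  also have "\<dots> = F (rotate 0 [0..<n]) + (\<Sum>s<n. F (rotate (Suc s) [0..<n]))"
    by (rule sum.lessThan_Suc_shift)
  also have "rotate n [0..<n] = rotate 0 [0..<n]"
    by (simp add: rotate_drop_take)
  finally have "(\<Sum>r<n. F (rotate r [0..<n])) = (\<Sum>s<n. F (rotate (Suc s) [0..<n]))"
    by (simp add: add.commute)
  also have "\<dots> = (\<Sum>s<n. F (([Suc s..<n] @ [0..<s]) @ [s]))"
  proof (intro sum.cong refl)
    fix s assume "s \<in> {..<n}"
    then have s: "s < n" by simp
    have "rotate (Suc s) [0..<n] = [Suc s..<n] @ [0..<Suc s]"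
    proof (cases "Suc s = n")
      case True
      then show ?thesis by (simp add: rotate_drop_take)
    next
      case False
      with s have "Suc s < n" by simp
      then show ?thesis by (simp add: rotate_drop_take drop_upt take_upt del: upt_Suc)
    qed
    then show "F (rotate (Suc s) [0..<n]) = F (([Suc s..<n] @ [0..<s]) @ [s])" by simp
  qed
  finally show ?thesis .
qed

lemma rotate_upt: "r < n \<Longrightarrow> rotate r [0..<n] = r # ([Suc r..<n] @ [0..<r])"
  using upt_conv_Cons[of r n] by (simp add: rotate_drop_take drop_upt take_upt)

lemma sort_rotated: "r < n \<Longrightarrow> sort ([Suc r..<n] @ [0..<r]) = [0..<r] @ [Suc r..<n]"
  by (intro properties_for_sort) (auto simp: sorted_append ac_simps simp del: upt_Suc)

lemma cross_take:
  assumes "r < n"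
  shows "cross ds r ([Suc r..<n] @ [0..<r]) = (ksign (ds ! r) (sum_list (pick ds [0..<r])) :: 'k::comm_ring_1)"
proof -
  have "cross ds r [Suc r..<n] = (1 :: 'k)" by (rule cross_eq_1) simp
  moreover have "cross ds r [0..<k] = (ksign (ds ! r) (sum_list (pick ds [0..<k])) :: 'k)" if "k \<le> r" for k
    using that by (induction k) (auto simp: ksign_add_right)
  ultimately show ?thesis by simp
qed

lemma cross_drop:
  assumes "r < n"
  shows "(\<Prod>a\<leftarrow>[Suc r..<n] @ [0..<r]. cross ds a [r]) = (ksign (sum_list (pick ds [Suc r..<n])) (ds ! r) :: 'k::comm_ring_1)"
proof -
  have "(\<Prod>a\<leftarrow>[0..<r]. cross ds a [r]) = (\<Prod>a\<leftarrow>[0..<r]. 1 :: 'k)"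
    by (intro arg_cong[of _ _ prod_list] map_cong refl) simp
  moreover have "(\<Prod>a\<leftarrow>[Suc r..<k]. cross ds a [r]) = (ksign (sum_list (pick ds [Suc r..<k])) (ds ! r) :: 'k)" for k
    by (induction k) (auto simp: ksign_add_left)
  ultimately show ?thesis by (simp add: map_replicate_const del: upt_Suc)
qed

text \<open>The factors \<open>koszul ds I\<close> and \<open>koszul ds J\<close> will cancel when the arguments of symmetric forms
  are put back into their original order.\<close>

lemma koszul_bracket:
  fixes ds :: "int list" and d d' p q :: int
  shows "koszul ([p, q, d, d'] @ ds) ([0, 2] @ map ((+) 4) I @ [1, 3] @ map ((+) 4) J) =
    ksign (d + sum_list (pick ds I)) q * ksign (sum_list (pick ds I)) d' *
    (\<Prod>a\<leftarrow>I. cross ds a J) * koszul ds I * (koszul ds J :: 'k::comm_ring_1)"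
proof -
  let ?pre = "[p, q, d, d']"
  have len: "length ?pre = 4" by simp
  note shift = cross_shift[of ?pre ds, unfolded len] koszul_shift[of ?pre ds, unfolded len]
  have c4: "cross (?pre @ ds) 0 p = (1 :: 'k)" "cross (?pre @ ds) 1 ([3] @ map ((+) 4) p) = (1 :: 'k)"
    "cross (?pre @ ds) 3 (map ((+) 4) p) = (1 :: 'k)" "cross (?pre @ ds) 2 (map ((+) 4) p) = (1 :: 'k)" for p
    by (rule cross_eq_1, force)+
  \<comment> \<open>Letters 0 to 3 are the two forms and the dual pair; the variables start at 4.
    The first basis vector overtakes only the second form, whereas a variable of \<open>I\<close>
    overtakes the second form, the second basis vector and the earlier variables of
    \<open>J\<close>.\<close>
  have c2: "cross (?pre @ ds) 2 (map ((+) 4) I @ [1, 3] @ map ((+) 4) J) = (ksign d q :: 'k)"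
    using c4(4)[of I] c4(4)[of J] by simp
  have "(\<Prod>a\<leftarrow>map ((+) 4) K. cross (?pre @ ds) a ([1, 3] @ map ((+) 4) J)) =
     ksign (sum_list (pick ds K)) q * ksign (sum_list (pick ds K)) d' * (\<Prod>a\<leftarrow>K. cross ds a J :: 'k)" for K
  proof (induction K)
    case (Cons a K)
    have "cross (?pre @ ds) (4 + a) ([1, 3] @ map ((+) 4) J) = ksign (ds ! a) q * ksign (ds ! a) d' * (cross ds a J :: 'k)"
      using shift(1)[of a J, where 'k = 'k] by simp
    then show ?case
      unfolding list.map prod_list.Cons Cons.IH pick_simps sum_list.Cons ksign_add_left
      by (simp only: mult_ac)
  qed simp
  note c1 = this[of I]
  have "koszul (?pre @ ds) ([0, 2] @ map ((+) 4) I @ [1, 3] @ map ((+) 4) J) =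
     cross (?pre @ ds) 0 (2 # map ((+) 4) I @ [1, 3] @ map ((+) 4) J) *
     (cross (?pre @ ds) 2 (map ((+) 4) I @ [1, 3] @ map ((+) 4) J) *
     (koszul (?pre @ ds) (map ((+) 4) I) * (cross (?pre @ ds) 1 ([3] @ map ((+) 4) J) *
       (cross (?pre @ ds) 3 (map ((+) 4) J) * koszul (?pre @ ds) (map ((+) 4) J))) *
     (\<Prod>a\<leftarrow>map ((+) 4) I. cross (?pre @ ds) a ([1, 3] @ map ((+) 4) J)) :: 'k))"
    by (simp only: koszul_append koszul_Cons append_Cons append_Nil)
  also have "\<dots> = ksign d q * (koszul ds I * koszul ds J * (ksign (sum_list (pick ds I)) q * ksign (sum_list (pick ds I)) d' * (\<Prod>a\<leftarrow>I. cross ds a J)))"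
    unfolding c1 c2 c4 shift by simp
  finally show ?thesis
    by (simp add: ksign_add_left[of d "sum_list (pick ds I)"] algebra_simps)
qed

context based_space
begin

abbreviation bracket_sign :: "nat \<Rightarrow> int list \<Rightarrow> nat list \<Rightarrow> nat list \<Rightarrow> 'k" where
  "bracket_sign i ds I J \<equiv>
     koszul ([- (dg i + sum_list (pick ds I)), - (- dg i - 2 + sum_list (pick ds J)), dg i, - dg i - 2] @ ds)
       ([0, 2] @ map ((+) 4) I @ [1, 3] @ map ((+) 4) J)"

definition bracket_term :: "('v, 'k) form \<Rightarrow> ('v, 'k) form \<Rightarrow> nat list \<Rightarrow> nat list \<Rightarrow> int list \<Rightarrow> 'v list \<Rightarrow> 'k" where
  "bracket_term f g I J ds xs = (\<Sum>i<m.
     bracket_sign i ds I J * f (e i # pick xs I) * g (e' i # pick xs J))"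

lemma pinczon_eq: "pinczon scale W b f g = multi_ext W (\<lambda>ds xs.
    \<Sum>r<max 1 (length xs). \<Sum>k\<le>length xs.
      bracket_term f g (take k (rotate r [0..<length xs])) (drop k (rotate r [0..<length xs])) ds xs)"
proof -
  have d: "hom_deg W (e i) = dg i" "hom_deg W (e' i) = - dg i - 2" if "i < m" for i
    using hom_deg_e'[OF that] by (simp_all add: dg_def)
  show ?thesis
    unfolding pinczon_def chosen prod.case bracket_term_def e_def[symmetric] e'_def[symmetric] m_def[symmetric] Let_def
    by (intro arg_cong[of _ _ "multi_ext W"] ext sum.cong refl) (simp only: d lessThan_iff)
qed

lemma multilinear_pinczon:
  assumes f: "multilinear scale f" and g: "multilinear scale g"
  shows "multilinear scale (pinczon scale W b f g)"
  unfolding pinczon_eq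
proof (rule multilinear_multi_ext)
  fix ds :: "int list" and xs ys :: "'v list"
  let ?n = "length xs + Suc (length ys)"
  have l: "length (xs @ v # ys) = ?n" for v by simp
  have c: "distinct (take k (rotate r [0..<?n]) @ drop k (rotate r [0..<?n]))"
    "length xs \<in> set (take k (rotate r [0..<?n]) @ drop k (rotate r [0..<?n]))" for k r
    by simp_all
  show "lin (\<lambda>v. \<Sum>r<max 1 (length (xs @ v # ys)). \<Sum>k\<le>length (xs @ v # ys).
      bracket_term f g (take k (rotate r [0..<length (xs @ v # ys)])) (drop k (rotate r [0..<length (xs @ v # ys)])) ds (xs @ v # ys))"
    unfolding bracket_term_def l
    by (intro lin_sum_fun lin_pick_product[of f g _ _ _ _ "[e i]" _ "[e' i]" for i, unfolded append_Cons append_Nil] f g c)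
qed

lemma finite_arity_pinczon:
  assumes "finite_arity f" "finite_arity g"
  shows "finite_arity (pinczon scale W b f g)"
proof -
  obtain N M where N: "\<And>xs. N \<le> length xs \<Longrightarrow> f xs = 0" and M: "\<And>xs. M \<le> length xs \<Longrightarrow> g xs = 0"
    using assms by (auto simp: finite_arity_def)
  have "pinczon scale W b f g xs = 0" if n: "N + M \<le> length xs" for xs
    unfolding pinczon_eq bracket_term_def
  proof (intro multi_ext_zero sum.neutral ballI)
    fix ds r k i and ys :: "'v list" assume l: "length ys = length xs" "k \<in> {..length ys}"
    let ?I = "take k (rotate r [0..<length ys])" and ?J = "drop k (rotate r [0..<length ys])"
    have "N \<le> length (e i # pick ys ?I) \<or> M \<le> length (e' i # pick ys ?J)" using n l by auto
    then have "f (e i # pick ys ?I) = 0 \<or> g (e' i # pick ys ?J) = 0" using N M by blast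
    then show "bracket_sign i ds ?I ?J * f (e i # pick ys ?I) * g (e' i # pick ys ?J) = 0"
      by auto
  qed
  then show ?thesis by (auto simp: finite_arity_def)
qed

lemma pinczon_arity:
  assumes "\<alpha> \<in> C2" "\<beta> \<in> C2" "length xs \<noteq> 2"
  shows "pinczon scale W b \<alpha> \<beta> xs = 0"
  unfolding pinczon_eq bracket_term_def
proof (intro multi_ext_zero sum.neutral ballI)
  fix ds r k i and ys :: "'v list" assume l: "length ys = length xs" "k \<in> {..length ys}"
  let ?I = "take k (rotate r [0..<length ys])" and ?J = "drop k (rotate r [0..<length ys])"
  have "length (e i # pick ys ?I) \<noteq> 2 \<or> length (e' i # pick ys ?J) \<noteq> 2" using assms(3) l by auto
  then have "\<alpha> (e i # pick ys ?I) = 0 \<or> \<beta> (e' i # pick ys ?J) = 0"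
    using bilinear_formD(2)[OF assms(1)] bilinear_formD(2)[OF assms(2)] by blast
  then show "bracket_sign i ds ?I ?J * \<alpha> (e i # pick ys ?I) * \<beta> (e' i # pick ys ?J) = 0"
    by auto
qed

text \<open>One slot of \<alpha> is taken by the basis vector, so only blocks of one variable
  contribute. The extra rotation that \<open>max\<close> adds for the empty word vanishes for the
  same reason.\<close>

lemma pinczon_bilinear_left:
  assumes \<alpha>: "\<alpha> \<in> C2" and w: "set w \<subseteq> {..<m}"
  shows "pinczon scale W b \<alpha> g (map e w) =
    (\<Sum>r<length w. bracket_term \<alpha> g [r] ([Suc r..<length w] @ [0..<r]) (map dg w) (map e w))"
proof -
  let ?n = "length w"
  let ?T = "\<lambda>r k. bracket_term \<alpha> g (take k (rotate r [0..<?n])) (drop k (rotate r [0..<?n])) (map dg w) (map e w)"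
  have z: "?T r k = 0" if "k \<le> ?n" "k \<noteq> 1" for r k
    unfolding bracket_term_def using that bilinear_formD(2)[OF \<alpha>] by (intro sum.neutral) auto
  have "pinczon scale W b \<alpha> g (map e w) = (\<Sum>r<max 1 ?n. \<Sum>k\<le>?n. ?T r k)"
    unfolding pinczon_eq multi_ext_basis[OF w] by simp
  also have "\<dots> = (\<Sum>r<?n. \<Sum>k\<le>?n. ?T r k)"
  proof (cases "?n = 0")
    case True
    then show ?thesis using z[of 0 0] by simp
  qed (simp add: max_def Suc_le_eq)
  also have "\<dots> = (\<Sum>r<?n. \<Sum>k\<le>?n. if k = 1 then ?T r 1 else 0)"
    by (intro sum.cong refl) (auto simp: z)
  also have "\<dots> = (\<Sum>r<?n. ?T r 1)"
    by (intro sum.cong refl) auto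
  also have "\<dots> = (\<Sum>r<?n. bracket_term \<alpha> g [r] ([Suc r..<?n] @ [0..<r]) (map dg w) (map e w))"
    by (intro sum.cong refl) (simp add: rotate_upt del: upt_Suc)
  finally show ?thesis .
qed

text \<open>The bilinear form now takes the last variable of the rotated word and \<open>f\<close>
  takes the other \<open>n - 1\<close>; reindexing by that last variable gives sums over positions
  again.\<close>

lemma pinczon_bilinear_right:
  assumes \<alpha>: "\<alpha> \<in> C2" and w: "set w \<subseteq> {..<m}"
  shows "pinczon scale W b f \<alpha> (map e w) =
    (\<Sum>r<length w. bracket_term f \<alpha> ([Suc r..<length w] @ [0..<r]) [r] (map dg w) (map e w))"
proof -
  let ?n = "length w"
  let ?T = "\<lambda>r k. bracket_term f \<alpha> (take k (rotate r [0..<?n])) (drop k (rotate r [0..<?n])) (map dg w) (map e w)"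
  have z: "?T r k = 0" if "k \<le> ?n" "Suc k \<noteq> ?n" for r k
    unfolding bracket_term_def using that bilinear_formD(2)[OF \<alpha>] by (intro sum.neutral) auto
  have "pinczon scale W b f \<alpha> (map e w) = (\<Sum>r<max 1 ?n. \<Sum>k\<le>?n. ?T r k)"
    unfolding pinczon_eq multi_ext_basis[OF w] by simp
  also have "\<dots> = (\<Sum>r<?n. \<Sum>k\<le>?n. ?T r k)"
  proof (cases "?n = 0")
    case True
    then show ?thesis using z[of 0 0] by simp
  qed (simp add: max_def Suc_le_eq)
  also have "\<dots> = (\<Sum>r<?n. \<Sum>k\<le>?n. if k = ?n - 1 then ?T r (?n - 1) else 0)"
    by (intro sum.cong refl) (use z in force)
  also have "\<dots> = (\<Sum>r<?n. ?T r (?n - 1))"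
    by (intro sum.cong refl) auto
  also have "\<dots> = (\<Sum>r<?n. bracket_term f \<alpha> ([Suc r..<?n] @ [0..<r]) [r] (map dg w) (map e w))"
  proof (cases "?n = 0")
    case False
    let ?G = "\<lambda>c. bracket_term f \<alpha> (take (?n - 1) c) (drop (?n - 1) c) (map dg w) (map e w)"
    have "(\<Sum>r<?n. ?T r (?n - 1)) = (\<Sum>s<?n. ?G (([Suc s..<?n] @ [0..<s]) @ [s]))"
      using sum_rotate_shift[of ?n ?G] False by simp
    also have "\<dots> = (\<Sum>r<?n. bracket_term f \<alpha> ([Suc r..<?n] @ [0..<r]) [r] (map dg w) (map e w))"
    proof (intro sum.cong refl)
      fix s assume "s \<in> {..<?n}"
      then have "length ([Suc s..<?n] @ [0..<s]) = ?n - 1" by simp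
      then have "take (?n - 1) (([Suc s..<?n] @ [0..<s]) @ [s]) = [Suc s..<?n] @ [0..<s]"
        "drop (?n - 1) (([Suc s..<?n] @ [0..<s]) @ [s]) = [s]"
        by (simp_all del: upt_Suc)
      then show "?G (([Suc s..<?n] @ [0..<s]) @ [s]) = bracket_term f \<alpha> ([Suc s..<?n] @ [0..<s]) [s] (map dg w) (map e w)"
        by (simp only:)
    qed
    finally show ?thesis .
  qed simp
  finally show ?thesis .
qed

lemma hat_dual:
  assumes f: "multilinear scale f" and w: "set w \<subseteq> {..<m}" and i: "i < m"
  shows "f (e' i # map e w) = (\<Sum>j<m. cas i j * hat f (j # w))"
proof -
  have "f (e' i # map e w) = (\<Sum>j<m. b (e' i) (e' j) * f (e j # map e w))"
    using multilinear_expand[OF f, of "[]" "e' i" "map e w"] by simp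
  also have "\<dots> = (\<Sum>j<m. cas i j * hat f (j # w))"
    using w by (intro sum.cong refl) (simp add: cas_def hat_def)
  finally show ?thesis .
qed

definition mat :: "('v, 'k) form \<Rightarrow> nat \<Rightarrow> nat \<Rightarrow> 'k" where
  "mat \<alpha> i j = hat \<alpha> [i, j]"

lemma hom_mat_mat: "multilinear scale \<alpha> \<Longrightarrow> form_deg W a \<alpha> \<Longrightarrow> hom_mat a (mat \<alpha>)"
  using form_deg_iff[of \<alpha> a] by (auto simp: hom_mat_def mat_def)

lemma parity_hat: "multilinear scale f \<Longrightarrow> form_deg W p f \<Longrightarrow> parity p (hat f)"
  using form_deg_iff[of f p] by (auto simp: parity_def)

lemma der_act_bad:
  assumes "\<not> set w \<subseteq> {..<m}"
  shows "der a (act A) (hat f) w = 0"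
  unfolding der_sum_nth
proof (intro sum.neutral ballI)
  fix r k assume r: "r \<in> {..<length w}"
  show "act A k (w ! r) * (ksign a (dg k + wd (drop (Suc r) w)) * hat f (take r w @ k # drop (Suc r) w)) = 0"
  proof (cases "w ! r < m")
    case True
    obtain x where x: "x \<in> set w" "\<not> x < m" using assms by auto
    have "x \<in> set (take r w @ w ! r # drop (Suc r) w)"
      using r x(1) id_take_nth_drop[of r w] by (metis lessThan_iff)
    then have "x \<in> set (take r w @ k # drop (Suc r) w)" using x(2) True by auto
    then have "\<not> set (take r w @ k # drop (Suc r) w) \<subseteq> {..<m}" using x(2) by blast
    then show ?thesis by (simp only: hat_bad mult_zero_right not_False_eq_True)
  qed (simp add: act_def)
qed

lemma pick_indices:
  assumes "r < length w"
  shows "pick w ([0..<r] @ [Suc r..<length w]) = take r w @ drop (Suc r) w"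
    "wd (pick w ([Suc r..<length w] @ [0..<r])) = wd (take r w) + wd (drop (Suc r) w)"
    "pick (map dg w) [0..<r] = map dg (take r w)"
    "pick (map dg w) [Suc r..<length w] = map dg (drop (Suc r) w)"
  using assms pick_upt[of r w 0] pick_upt[of "length w" w "Suc r"]
    pick_upt[of r "map dg w" 0] pick_upt[of "length w" "map dg w" "Suc r"]
  by (simp_all add: take_map drop_map del: upt_Suc)

lemma koszul_pick_sym:
  assumes f: "wsym (hat f)" and w: "set w \<subseteq> {..<m}" and r: "r < length w"
  shows "hat f (i # pick w ([Suc r..<length w] @ [0..<r])) =
    koszul (map dg w) ([Suc r..<length w] @ [0..<r]) * hat f (i # take r w @ drop (Suc r) w)"
proof -
  have "set ([Suc r..<length w] @ [0..<r]) \<subseteq> {..<length w}" using r by auto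
  from wsym_sort[OF f this, of "[i]"] show ?thesis
    unfolding sort_rotated[OF r] pick_indices(1)[OF r] by simp
qed

text \<open>The rotation starting at \<open>r\<close> feeds the variable at \<open>r\<close> to
  \<alpha> and the others to \<open>f\<close>. Symmetry of \<open>f\<close> restores their order and
  moves the letter coming from \<open>e' i\<close> to position \<open>r\<close>, so the term becomes
  the replacement of the letter at \<open>r\<close>.\<close>

lemma hat_pinczon_left:
  assumes \<alpha>: "\<alpha> \<in> C2" "form_deg W a \<alpha>" and f: "f \<in> S"
  shows "hat (pinczon scale W b \<alpha> f) = der a (act (mat \<alpha>)) (hat f)"
proof
  fix w show "hat (pinczon scale W b \<alpha> f) w = der a (act (mat \<alpha>)) (hat f) w"
  proof (cases "set w \<subseteq> {..<m}")
    case w: True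
    let ?n = "length w"
    note f' = sym_formsD[OF f] and \<alpha>' = sym_formsD[OF bilinear_formD(1)[OF \<alpha>(1)]]
    have "bracket_term \<alpha> f [r] ([Suc r..<?n] @ [0..<r]) (map dg w) (map e w) =
        (\<Sum>k<m. act (mat \<alpha>) k (w ! r) * (ksign a (dg k + wd (drop (Suc r) w)) * hat f (take r w @ k # drop (Suc r) w)))"
      if r: "r < ?n" for r
    proof -
      let ?J = "[Suc r..<?n] @ [0..<r]"
      let ?t = "wd (take r w)" and ?d = "wd (drop (Suc r) w)" and ?x = "dg (w ! r)"
      let ?h = "\<lambda>k. hat f (k # take r w @ drop (Suc r) w)" and ?h' = "\<lambda>k. hat f (take r w @ k # drop (Suc r) w)"
      \<comment> \<open>The factors in order: \<open>e i\<close> and the variable at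
        \<open>r\<close> pass \<open>f\<close>; that variable passes \<open>e' i\<close>; and it
        passes the variables originally before it.\<close>
      let ?s = "\<lambda>i. ksign (dg i + ?x) (- dg i - 2 + (?t + ?d)) * ksign ?x (- dg i - 2) * ksign ?x ?t"
      have J: "set ?J \<subseteq> {..<?n}" using r by auto
      have wr: "w ! r < m" using w r nth_mem by blast
      have dj: "sum_list (pick (map dg w) ?J) = ?t + ?d"
        using sum_list_pick[OF J] pick_indices(2)[OF r] by simp
      have "bracket_term \<alpha> f [r] ?J (map dg w) (map e w) =
         (\<Sum>i<m. \<Sum>k<m. ?s i * mat \<alpha> i (w ! r) * cas i k * ?h k)"
        unfolding bracket_term_def
      proof (intro sum.cong refl)
        fix i assume "i \<in> {..<m}"
        then have i: "i < m" by simp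
        have 1: "\<alpha> (e i # pick (map e w) [r]) = mat \<alpha> i (w ! r)"
          using i wr r by (simp add: mat_def hat_def)
        \<comment> \<open>Expanding \<open>e' i\<close> introduces the letter \<open>k\<close> with
          coefficient \<open>cas i k\<close>. Sorting the other variables produces a
          \<open>koszul\<close> that cancels the one in the bracket sign.\<close>
        have 2: "f (e' i # pick (map e w) ?J) = (\<Sum>k<m. cas i k * (koszul (map dg w) ?J * ?h k))"
          using pick_basis[OF w J] hat_dual[OF f'(1) _ i, of "pick w ?J"] koszul_pick_sym[OF f'(3) w r]
          by (simp add: pick_map[OF J] del: pick_simps upt_Suc)
        have 3: "bracket_sign i (map dg w) [r] ?J =
           ?s i * (koszul (map dg w) ?J :: 'k)"
          unfolding koszul_bracket[of _ _ "dg i"] ksign_minus unfolding dj using r cross_take[OF r, of "map dg w", unfolded pick_indices(3)[OF r], where 'k = 'k]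
          by (simp add: koszul_Cons wd_def del: upt_Suc cross_simps(3) pick_simps(3))
        show "bracket_sign i (map dg w) [r] ?J * \<alpha> (e i # pick (map e w) [r]) * f (e' i # pick (map e w) ?J) =
           (\<Sum>k<m. ?s i * mat \<alpha> i (w ! r) * cas i k * ?h k)"
          unfolding 1 2 3 sum_distrib_left
          by (intro sum.cong refl) (simp only: mult_ac koszul_square koszul_cancel)
      qed
      \<comment> \<open>Signs need to agree only where the coefficients are nonzero, and there the
        parity relations eliminate \<open>dg i\<close>. The factor \<open>ksign ?t (dg k)\<close> is
        the cost of moving \<open>k\<close> to position \<open>r\<close>.\<close>
      also have "\<dots> = (\<Sum>i<m. \<Sum>k<m. ksign ?x (dg k) * mat \<alpha> i (w ! r) * cas i k *
          (ksign a (dg k + ?d) * (ksign ?t (dg k) * ?h k)))"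
      proof (intro sum.cong refl)
        fix i k assume ik: "i \<in> {..<m}" "k \<in> {..<m}"
        show "?s i * mat \<alpha> i (w ! r) * cas i k * ?h k =
          ksign ?x (dg k) * mat \<alpha> i (w ! r) * cas i k *
          (ksign a (dg k + ?d) * (ksign ?t (dg k) * ?h k))"
        proof (cases "mat \<alpha> i (w ! r) = 0 \<or> cas i k = 0")
          case False
          then have p: "even (a + dg i + ?x)" "even (dg i + dg k)"
            using hom_mat_mat[OF \<alpha>'(1) \<alpha>(2)] cas_parity[of i k] ik by (auto simp: hom_mat_def)
          have "?s i =
            ksign ?x (dg k) * ksign a (dg k + ?d) * (ksign ?t (dg k) :: 'k)"
            using p unfolding ksign_def by (auto simp del: One_nat_def)
          then show ?thesis by (simp only: mult_ac)
        qed auto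
      qed
      also have "\<dots> = (\<Sum>k<m. act (mat \<alpha>) k (w ! r) * (ksign a (dg k + ?d) * ?h' k))"
        unfolding wsym_move[OF f'(3), symmetric]
        by (subst sum.swap) (simp add: act_def wr sum_distrib_right)
      finally show ?thesis .
    qed
    then have "pinczon scale W b \<alpha> f (map e w) = der a (act (mat \<alpha>)) (hat f) w"
      unfolding pinczon_bilinear_left[OF \<alpha>(1) w] der_sum_nth by (intro sum.cong refl) simp
    then show ?thesis using w by (simp add: hat_def)
  next
    case False
    then show ?thesis by (simp add: hat_bad der_act_bad)
  qed
qed

text \<open>Now \<open>e i\<close> goes to \<open>f\<close> and \<open>e' i\<close> to \<alpha>, so
  \<open>cas\<close> appears with its indices exchanged; its antisymmetry yields the overall minus
  sign. The degree of \<open>f\<close> converts the remaining difference into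
  \<open>ksign p a\<close>.\<close>

lemma hat_pinczon_right:
  assumes \<alpha>: "\<alpha> \<in> C2" "form_deg W a \<alpha>"
    and f: "f \<in> S" "form_deg W p f"
  shows "hat (pinczon scale W b f \<alpha>) = form_scale (- ksign p a) (der a (act (mat \<alpha>)) (hat f))"
proof
  fix w show "hat (pinczon scale W b f \<alpha>) w = form_scale (- ksign p a) (der a (act (mat \<alpha>)) (hat f)) w"
  proof (cases "set w \<subseteq> {..<m}")
    case w: True
    let ?n = "length w"
    note f' = sym_formsD[OF f(1)] and \<alpha>' = sym_formsD[OF bilinear_formD(1)[OF \<alpha>(1)]]
    have "bracket_term f \<alpha> ([Suc r..<?n] @ [0..<r]) [r] (map dg w) (map e w) =
        - ksign p a * (\<Sum>k<m. act (mat \<alpha>) k (w ! r) * (ksign a (dg k + wd (drop (Suc r) w)) * hat f (take r w @ k # drop (Suc r) w)))"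
      if r: "r < ?n" for r
    proof -
      let ?I = "[Suc r..<?n] @ [0..<r]"
      let ?h = "\<lambda>i. hat f (i # take r w @ drop (Suc r) w)"
      let ?t = "wd (take r w)" and ?d = "wd (drop (Suc r) w)" and ?x = "dg (w ! r)"
      let ?s = "\<lambda>i. ksign (dg i + (?t + ?d)) (- dg i - 2 + ?x) * ksign (?t + ?d) (- dg i - 2) * ksign ?d ?x"
      have I: "set ?I \<subseteq> {..<?n}" using r by auto
      have wr: "w ! r < m" using w r nth_mem by blast
      have di: "sum_list (pick (map dg w) ?I) = ?t + ?d"
        using sum_list_pick[OF I] pick_indices(2)[OF r] by simp
      have "bracket_term f \<alpha> ?I [r] (map dg w) (map e w) =
         (\<Sum>i<m. \<Sum>k<m. ?s i * (?h i * (cas i k * mat \<alpha> k (w ! r))))"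
        unfolding bracket_term_def
      proof (intro sum.cong refl)
        fix i assume "i \<in> {..<m}"
        then have i: "i < m" by simp
        have 1: "\<alpha> (e' i # pick (map e w) [r]) = (\<Sum>k<m. cas i k * mat \<alpha> k (w ! r))"
          using hat_dual[OF \<alpha>'(1) _ i, of "[w ! r]"] wr r by (simp add: mat_def)
        have 2: "f (e i # pick (map e w) ?I) = koszul (map dg w) ?I * ?h i"
          using pick_basis[OF w I] koszul_pick_sym[OF f'(3) w r, of i] i
          by (simp add: pick_map[OF I] hat_def del: pick_simps upt_Suc)
        have 3: "bracket_sign i (map dg w) ?I [r] =
           ?s i * (koszul (map dg w) ?I :: 'k)"
          unfolding koszul_bracket[of _ _ "dg i"] ksign_minus unfolding di
          using r cross_drop[OF r, of "map dg w", unfolded pick_indices(4)[OF r], where 'k = 'k]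
          by (simp add: koszul_Cons wd_def del: upt_Suc map_append)
        show "bracket_sign i (map dg w) ?I [r] * f (e i # pick (map e w) ?I) * \<alpha> (e' i # pick (map e w) [r]) =
          (\<Sum>k<m. ?s i * (?h i * (cas i k * mat \<alpha> k (w ! r))))"
          unfolding 1 2 3 sum_distrib_left
          by (intro sum.cong refl) (simp only: mult_ac koszul_square koszul_cancel)
      qed
      also have "\<dots> = (\<Sum>i<m. \<Sum>k<m. - ksign p a * (ksign ?x (dg i) * mat \<alpha> k (w ! r) * cas k i *
          (ksign a (dg i + ?d) * (ksign ?t (dg i) * ?h i))))"
      proof (intro sum.cong refl)
        fix i k assume ik: "i \<in> {..<m}" "k \<in> {..<m}"
        show "?s i * (?h i * (cas i k * mat \<alpha> k (w ! r))) =
          - ksign p a * (ksign ?x (dg i) * mat \<alpha> k (w ! r) * cas k i *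
          (ksign a (dg i + ?d) * (ksign ?t (dg i) * ?h i)))"
        proof (cases "mat \<alpha> k (w ! r) = 0 \<or> cas k i = 0 \<or> ?h i = 0")
          case False
          then have p: "even (a + dg k + ?x)" "even (dg k + dg i)" "even (p + (dg i + (?t + ?d)))"
            using hom_mat_mat[OF \<alpha>'(1) \<alpha>(2)] cas_parity[of k i] ik parity_hat[OF f'(1) f(2)]
            by (force simp: hom_mat_def parity_def)+
          \<comment> \<open>The extra factor on the left is the sign from exchanging the indices of
            \<open>cas\<close>; the third parity relation expresses the total degree of the letters
            in \<open>f\<close> by \<open>p\<close>.\<close>
          have "?s i * ksign (dg i) (dg k) =
            ksign p a * ksign ?x (dg i) * ksign a (dg i + ?d) * (ksign ?t (dg i) :: 'k)"
            using p unfolding ksign_def by (auto simp del: One_nat_def)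
          then have "- (?s i * ksign (dg i) (dg k))
              * (cas k i * mat \<alpha> k (w ! r) * ?h i) =
            - (ksign p a * ksign ?x (dg i) * ksign a (dg i + ?d) * (ksign ?t (dg i) :: 'k))
              * (cas k i * mat \<alpha> k (w ! r) * ?h i)"
            by (simp only:)
          moreover have "cas i k = - ksign (dg i) (dg k) * cas k i" using ik by (intro cas_swap) auto
          ultimately show ?thesis by (simp only: mult_ac mult_minus_left mult_minus_right)
        next
          case True
          moreover have "cas i k = - ksign (dg i) (dg k) * cas k i" using ik by (intro cas_swap) auto
          ultimately show ?thesis by auto
        qed
      qed
      also have "\<dots> = - ksign p a * (\<Sum>k<m. act (mat \<alpha>) k (w ! r) * (ksign a (dg k + ?d) * hat f (take r w @ k # drop (Suc r) w)))"
        unfolding wsym_move[OF f'(3), symmetric] sum_distrib_left[symmetric]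
        by (simp add: act_def wr sum_distrib_right)
      finally show ?thesis .
    qed
    then have "pinczon scale W b f \<alpha> (map e w) = - ksign p a * der a (act (mat \<alpha>)) (hat f) w"
      unfolding pinczon_bilinear_right[OF \<alpha>(1) w] der_sum_nth sum_distrib_left[of "- ksign p a" _ "{..<length w}"]
      by (intro sum.cong refl) simp
    then show ?thesis using w by (simp add: hat_def form_scale_apply)
  next
    case False
    then show ?thesis by (simp add: hat_bad der_act_bad form_scale_apply)
  qed
qed

lemma wsym_scale: "wsym f \<Longrightarrow> wsym (form_scale c f)"
  unfolding wsym_def form_scale_apply by (metis mult.left_commute)

lemma pinczon_left_closed:
  assumes "\<alpha> \<in> C2" "form_deg W a \<alpha>" "f \<in> S"
  shows "pinczon scale W b \<alpha> f \<in> S"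
proof -
  note \<alpha> = sym_formsD[OF bilinear_formD(1)[OF assms(1)]] and f = sym_formsD[OF assms(3)]
  show ?thesis
    by (intro sym_formsI multilinear_pinczon finite_arity_pinczon \<alpha> f)
      (simp add: hat_pinczon_left[OF assms] wsym_der f hom_mat_act hom_mat_mat[OF \<alpha>(1) assms(2)])
qed

lemma pinczon_right_closed:
  assumes "\<alpha> \<in> C2" "form_deg W a \<alpha>" "f \<in> S" "form_deg W p f"
  shows "pinczon scale W b f \<alpha> \<in> S"
proof -
  note \<alpha> = sym_formsD[OF bilinear_formD(1)[OF assms(1)]] and f = sym_formsD[OF assms(3)]
  show ?thesis
    by (intro sym_formsI multilinear_pinczon finite_arity_pinczon \<alpha> f)
      (simp add: hat_pinczon_right[OF assms] wsym_scale wsym_der f hom_mat_act hom_mat_mat[OF \<alpha>(1) assms(2)])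
qed

lemma pinczon_bilinear_closed:
  assumes "\<alpha> \<in> C2" "form_deg W a \<alpha>" "\<beta> \<in> C2"
  shows "pinczon scale W b \<alpha> \<beta> \<in> C2"
  using pinczon_left_closed[OF assms(1,2) bilinear_formD(1)[OF assms(3)]] pinczon_arity[OF assms(1,3)]
  by (simp add: sym_bilinear_forms_def)

section \<open>Degrees of products, brackets and tensors\<close>

lemma form_deg_sym_prod:
  assumes "multilinear scale f" "form_deg W p f" "multilinear scale g" "form_deg W q g"
  shows "form_deg W (p + q) (sym_prod W f g)"
proof -
  have "shuf f g w \<noteq> 0 \<Longrightarrow> \<forall>w. f w \<noteq> 0 \<longrightarrow> p = - wd w \<Longrightarrow> \<forall>w. g w \<noteq> 0 \<longrightarrow> q = - wd w \<Longrightarrow> p + q = - wd w"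
    for f g :: "nat list \<Rightarrow> 'k" and w
  proof (induction w arbitrary: f g p q)
    case (Cons x w)
    have 1: "\<forall>w. contr x f w \<noteq> 0 \<longrightarrow> p + dg x = - wd w" "\<forall>w. contr x g w \<noteq> 0 \<longrightarrow> q + dg x = - wd w"
      using Cons.prems(2,3) by (force simp: contr_def)+
    have 2: "\<forall>w. twist (dg x) g w \<noteq> 0 \<longrightarrow> q = - wd w" using Cons.prems(3) by (auto simp: twist_def)
    from Cons.prems(1) consider "shuf f (contr x g) w \<noteq> 0" | "shuf (contr x f) (twist (dg x) g) w \<noteq> 0" by fastforce
    then show ?case
      using Cons.IH[OF _ Cons.prems(2) 1(2)] Cons.IH[OF _ 1(1) 2] by cases auto
  qed auto
  then show ?thesis
    using assms by (simp add: form_deg_iff multilinear_sym_prod hat_sym_prod)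
qed

lemma cas_degree: assumes "i < m" "j < m" "cas i j \<noteq> 0" shows "dg i + dg j = - 2"
proof -
  have "e' i \<in> V (- 1 - dg i)" "e' j \<in> V (- 1 - dg j)"
    using e'_in[OF assms(1)] e'_in[OF assms(2)] by (auto simp: shift_def)
  then have "- 1 - dg i + (- 1 - dg j) = 0"
    using degree_zero assms(3) unfolding cas_def by blast
  then show ?thesis by linarith
qed

text \<open>Here parities do not suffice. The argument \<open>i\<close> contracted in \<alpha> and
  the new letter \<open>k\<close> satisfy \<open>dg i + dg k = - 2\<close> exactly, and this is the
  amount by which the degree drops.\<close>

lemma der_degree:
  assumes "multilinear scale \<alpha>" "form_deg W a \<alpha>" "\<And>w. h w \<noteq> 0 \<Longrightarrow> p = - wd w" "der a (act (mat \<alpha>)) h w \<noteq> 0"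
  shows "p + a - 2 = - wd w"
  using assms(3,4)
proof (induction w arbitrary: h p)
  case (Cons x w)
  show ?case
  proof (cases "der a (act (mat \<alpha>)) (contr x h) w = 0")
    case True
    then obtain k where k: "act (mat \<alpha>) k x \<noteq> 0" "twist a h (k # w) \<noteq> 0"
      using Cons.prems(2) by (auto elim!: sum.not_neutral_contains_not_neutral)
    then obtain i where "i < m" "k < m" "mat \<alpha> i x \<noteq> 0" "cas i k \<noteq> 0"
      by (auto simp: act_def elim!: sum.not_neutral_contains_not_neutral split: if_splits)
    then have "dg i + dg k = - 2" "a = - wd [i, x]"
      using cas_degree form_deg_iff[OF assms(1)] assms(2) by (auto simp: mat_def)
    moreover have "p = - wd (k # w)" using Cons.prems(1) k(2) by (auto simp: twist_def)
    ultimately show ?thesis by simp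
  next
    case False
    have "p + dg x = - wd v" if "contr x h v \<noteq> 0" for v
      using Cons.prems(1)[of "x # v"] that by (simp add: contr_def)
    from Cons.IH[OF this False] show ?thesis by simp
  qed
qed simp

lemma form_deg_pinczon_left:
  assumes "\<alpha> \<in> C2" "form_deg W a \<alpha>" "f \<in> S" "form_deg W p f"
  shows "form_deg W (p + a - 2) (pinczon scale W b \<alpha> f)"
proof -
  note \<alpha> = sym_formsD[OF bilinear_formD(1)[OF assms(1)]] and f = sym_formsD[OF assms(3)]
  show ?thesis
    using der_degree[OF \<alpha>(1) assms(2)] assms(4) form_deg_iff[OF f(1)]
    by (auto simp: form_deg_iff multilinear_pinczon \<alpha> f hat_pinczon_left[OF assms(1-3)])
qed

lemma form_deg_pinczon_right:
  assumes "\<alpha> \<in> C2" "form_deg W a \<alpha>" "f \<in> S" "form_deg W p f"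
  shows "form_deg W (p + a - 2) (pinczon scale W b f \<alpha>)"
proof -
  note \<alpha> = sym_formsD[OF bilinear_formD(1)[OF assms(1)]] and f = sym_formsD[OF assms(3)]
  show ?thesis
    using der_degree[OF \<alpha>(1) assms(2)] assms(4) form_deg_iff[OF f(1)]
    by (auto simp: form_deg_iff multilinear_pinczon \<alpha> f hat_pinczon_right[OF assms] form_scale_apply)
qed

lemma form_deg_tensor:
  assumes "\<alpha> \<in> C2" "form_deg W a \<alpha>" "f \<in> S" "form_deg W p f"
  shows "form_deg W (p + a) (tensor W f \<alpha>)"
proof -
  note \<alpha> = sym_formsD[OF bilinear_formD(1)[OF assms(1)]] and f = sym_formsD[OF assms(3)]
  have "p + a = - wd w" if w: "hat (tensor W f \<alpha>) w \<noteq> 0" for w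
  proof (cases "2 \<le> length w")
    case True
    then obtain v i j where v: "w = v @ [i, j]" using last_two by blast
    then have "hat f v \<noteq> 0" "hat \<alpha> [i, j] \<noteq> 0" using w by (auto simp: hat_tensor[OF assms(1)])
    then have "p = - wd v" "a = - wd [i, j]"
      using assms(2,4) form_deg_iff[OF f(1)] form_deg_iff[OF \<alpha>(1)] by blast+
    then show ?thesis by (simp add: v)
  next
    case False
    then show ?thesis using w tensor_short[OF assms(1)] by (simp add: hat_def split: if_splits)
  qed
  then show ?thesis by (simp add: form_deg_iff multilinear_tensor \<alpha> f)
qed

end

section \<open>The Lie algebra of bi-symmetric forms\<close>

lemma vector_space_form_scale: "vector_space (form_scale :: 'k::field \<Rightarrow> ('v, 'k) form \<Rightarrow> ('v, 'k) form)"
  by unfold_locales (auto simp: form_scale_def fun_eq_iff algebra_simps)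

lemma subspace_form_scale_iff:
  "module.subspace form_scale S \<longleftrightarrow> 0 \<in> S \<and> (\<forall>f\<in>S. \<forall>g\<in>S. f + g \<in> S) \<and> (\<forall>c. \<forall>f\<in>S. form_scale c f \<in> S)"
  for S :: "('v, 'k::field) form set"
proof -
  interpret vector_space "form_scale :: 'k \<Rightarrow> ('v, 'k) form \<Rightarrow> ('v, 'k) form"
    by (rule vector_space_form_scale)
  show ?thesis by (simp add: subspace_def)
qed

context based_space
begin

lemma nabla_tensor_form:
  assumes "\<alpha> \<in> C2" "form_deg W a \<alpha>"
  shows "nabla (hat (tensor W \<Omega> \<alpha>)) h = mshuf (hat \<Omega>) (der a (act (mat \<alpha>)) h)"
  by (rule nabla_tensor) (simp_all add: coe_tensor[OF assms(1)] mat_def[symmetric]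
    hom_mat_mat[OF sym_formsD(1)[OF bilinear_formD(1)[OF assms(1)]] assms(2)])

definition bracket_formula where
  "bracket_formula p a p' a' \<Omega> \<alpha> \<Omega>' \<alpha>' =
     form_scale (koszul [p, a, p', a'] [0, 1, 2, 3])
       (tensor W (sym_prod W \<Omega> (pinczon scale W b \<alpha> \<Omega>')) \<alpha>')
   + form_scale (koszul [p, a, p', a'] [2, 0, 3, 1])
       (tensor W (sym_prod W \<Omega>' (pinczon scale W b \<Omega> \<alpha>')) \<alpha>)
   + form_scale (koszul [p, a, p', a'] [0, 2, 1, 3])
       (tensor W (sym_prod W \<Omega> \<Omega>') (pinczon scale W b \<alpha> \<alpha>'))"

lemma bisym_add: "F \<in> P \<Longrightarrow> G \<in> P \<Longrightarrow> F + G \<in> P"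
proof (rule bisym_formsI)
  assume F: "F \<in> P" and G: "G \<in> P"
  note F = bisym_formsD[OF F] and G = bisym_formsD[OF G]
  show "multilinear scale (F + G)" by (intro multilinear_add F G)
  obtain N M where "\<And>xs. N \<le> length xs \<Longrightarrow> F xs = 0" "\<And>xs. M \<le> length xs \<Longrightarrow> G xs = 0"
    using F(2) G(2) by (auto simp: finite_arity_def)
  then have "\<forall>xs. max N M \<le> length xs \<longrightarrow> (F + G) xs = 0" by auto
  then show "finite_arity (F + G)" unfolding finite_arity_def by blast
  show "wbisym (hat (F + G))"
    using F(3) G(3) unfolding wbisym_def hat_simps plus_fun_apply distrib_left by metis
  show "(F + G) xs = 0" if "length xs < 2" for xs using F(4) G(4) that by simp
qed

lemma bisym_scale: "F \<in> P \<Longrightarrow> form_scale c F \<in> P"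
proof (rule bisym_formsI)
  assume F: "F \<in> P"
  note F = bisym_formsD[OF F]
  show "multilinear scale (form_scale c F)" by (intro multilinear_scale F)
  show "finite_arity (form_scale c F)"
    using F(2) unfolding finite_arity_def form_scale_apply by (metis mult_zero_right)
  show "wbisym (hat (form_scale c F))"
    using F(3) unfolding wbisym_def hat_simps form_scale_apply by (metis mult.left_commute)
  show "form_scale c F xs = 0" if "length xs < 2" for xs using F(4) that by (simp add: form_scale_apply)
qed

lemma bisym_zero: "0 \<in> P"
  by (rule bisym_formsI) (auto simp: multilinear_0 finite_arity_def wbisym_def)

abbreviation L :: "int \<Rightarrow> ('v, 'k) form set" where "L \<equiv> bisym_grading scale W"

lemma L_iff: "F \<in> L d \<longleftrightarrow> F \<in> P \<and> (\<forall>w. hat F w \<noteq> 0 \<longrightarrow> d + 2 = - wd w)"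
  using form_deg_iff[OF bisym_formsD(1)] by (auto simp: bisym_grading_def)

lemma L_bisym: "F \<in> L d \<Longrightarrow> F \<in> P"
  by (simp add: L_iff)

lemma L_add: "F \<in> L d \<Longrightarrow> G \<in> L d \<Longrightarrow> F + G \<in> L d"
  by (auto simp: L_iff bisym_add) (metis add.right_neutral)

lemma L_scale: "F \<in> L d \<Longrightarrow> form_scale c F \<in> L d"
  by (auto simp: L_iff bisym_scale form_scale_apply)

lemma L_zero: "0 \<in> L d"
  by (auto simp: L_iff bisym_zero)

lemma L_parity: "F \<in> L d \<Longrightarrow> parity d (hat F)"
  unfolding parity_def
proof (intro allI impI)
  fix w assume "F \<in> L d" "hat F w \<noteq> 0"
  then have "d + 2 = - wd w" by (auto simp: L_iff)
  then have "d + wd w = - 2" by linarith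
  then show "even (d + wd w)" by simp
qed

lemma L_tensor:
  assumes "\<alpha> \<in> C2" "form_deg W a \<alpha>" "f \<in> S" "form_deg W p f" "p + a = d + 2"
  shows "tensor W f \<alpha> \<in> L d"
  using form_deg_tensor[OF assms(1-4)] tensor_closed[OF assms(3,1)] assms(5) by (simp add: bisym_grading_def)

lemma bracket_formula_in:
  assumes \<alpha>: "\<alpha> \<in> C2" "form_deg W a \<alpha>" "\<alpha>' \<in> C2" "form_deg W a' \<alpha>'"
    and \<Omega>: "\<Omega> \<in> S" "form_deg W p \<Omega>" "\<Omega>' \<in> S" "form_deg W p' \<Omega>'"
    and "p + a = i + 2" "p' + a' = j + 2"
  shows "bracket_formula p a p' a' \<Omega> \<alpha> \<Omega>' \<alpha>' \<in> L (i + j)"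
proof -
  note bi = bilinear_formD(1)[OF \<alpha>(1)] bilinear_formD(1)[OF \<alpha>(3)]
  note cl = pinczon_left_closed[OF \<alpha>(1,2) \<Omega>(3)] pinczon_right_closed[OF \<alpha>(3,4) \<Omega>(1,2)]
  note ml = sym_formsD(1)[OF \<Omega>(1)] sym_formsD(1)[OF \<Omega>(3)] cl[THEN sym_formsD(1)]
  have "tensor W (sym_prod W \<Omega> (pinczon scale W b \<alpha> \<Omega>')) \<alpha>' \<in> L (i + j)"
    using assms(9,10)
    by (intro L_tensor[where p = "p + (p' + a - 2)" and a = a'] \<alpha> sym_prod_closed \<Omega> cl form_deg_sym_prod ml
        form_deg_pinczon_left[OF \<alpha>(1,2) \<Omega>(3,4)]) simp
  moreover have "tensor W (sym_prod W \<Omega>' (pinczon scale W b \<Omega> \<alpha>')) \<alpha> \<in> L (i + j)"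
    using assms(9,10)
    by (intro L_tensor[where p = "p' + (p + a' - 2)" and a = a] \<alpha> sym_prod_closed \<Omega> cl form_deg_sym_prod ml
        form_deg_pinczon_right[OF \<alpha>(3,4) \<Omega>(1,2)]) simp
  moreover have "tensor W (sym_prod W \<Omega> \<Omega>') (pinczon scale W b \<alpha> \<alpha>') \<in> L (i + j)"
    using assms(9,10)
    by (intro L_tensor[where p = "p + p'" and a = "a' + a - 2"] pinczon_bilinear_closed[OF \<alpha>(1,2,3)]
        sym_prod_closed \<Omega> form_deg_sym_prod ml form_deg_pinczon_left[OF \<alpha>(1,2) bi(2) \<alpha>(4)]) simp
  ultimately show ?thesis
    unfolding bracket_formula_def by (intro L_add L_scale)
qed

text \<open>The three terms are matched with those of \<open>mshuf_der_commutator\<close>; for the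
  third, \<open>act_der\<close> identifies the matrix of the bracket of the two bilinear forms with
  the commutator matrix.\<close>

lemma nabla_bracket_formula:
  assumes \<alpha>: "\<alpha> \<in> C2" "form_deg W a \<alpha>" "\<alpha>' \<in> C2" "form_deg W a' \<alpha>'"
    and \<Omega>: "\<Omega> \<in> S" "form_deg W p \<Omega>" "\<Omega>' \<in> S" "form_deg W p' \<Omega>'"
  defines "f \<equiv> hat (tensor W \<Omega> \<alpha>)" and "g \<equiv> hat (tensor W \<Omega>' \<alpha>')"
  shows "nabla (hat (bracket_formula p a p' a' \<Omega> \<alpha> \<Omega>' \<alpha>')) h =
    nabla f (nabla g h) - form_scale (ksign (p + a) (p' + a')) (nabla g (nabla f h))"
proof -
  let ?A = "act (mat \<alpha>)" and ?A' = "act (mat \<alpha>')" and ?\<gamma> = "pinczon scale W b \<alpha> \<alpha>'"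
  let ?C = "\<lambda>l x. ksign a a' * (\<Sum>k<m. ?A' l k * ?A k x) - (\<Sum>k<m. ?A l k * ?A' k x)"
  note bi = bilinear_formD(1)[OF \<alpha>(1)] bilinear_formD(1)[OF \<alpha>(3)]
  note hm = hom_mat_mat[OF sym_formsD(1)[OF bi(1)] \<alpha>(2)] hom_mat_mat[OF sym_formsD(1)[OF bi(2)] \<alpha>(4)]
  have K: "koszul [p, a, p', a'] [0, 1, 2, 3] = (1 :: 'k)"
    "koszul [p, a, p', a'] [2, 0, 3, 1] = ksign p' p * ksign p' a * (ksign a' a :: 'k)"
    "koszul [p, a, p', a'] [0, 2, 1, 3] = (ksign a p' :: 'k)"
    by (simp_all add: koszul_Cons ksign_commute)
  have sym: "mat \<alpha> i j = ksign (dg i) (dg j) * mat \<alpha> j i" for i j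
    using wsymD[OF sym_formsD(3)[OF bi(1)], of "[]" i j "[]"] by (simp add: mat_def)
  have C: "act (mat ?\<gamma>) k x = ?C k x" if "k < m" for k x
  proof (cases "x < m")
    case True
    have "mat ?\<gamma> = (\<lambda>i j. der a ?A (hat \<alpha>') [i, j])"
      by (intro ext) (simp only: mat_def hat_pinczon_left[OF \<alpha>(1,2) bi(2)])
    then show ?thesis
      using act_der[OF hm sym mat_def[symmetric] that True] by (simp only:)
  qed (simp add: act_def)
  \<comment> \<open>The bracket of \<alpha> and \<alpha>' has degree \<open>a' + a - 2\<close>, but
    a derivation depends only on the parity of its degree.\<close>
  have d: "der (a' + a - 2) (act (mat ?\<gamma>)) h = der (a + a') ?C h"
    by (rule der_cong) (auto simp: C)
  have 1: "nabla (hat (tensor W (sym_prod W \<Omega> (pinczon scale W b \<alpha> \<Omega>')) \<alpha>')) h =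
      mshuf (shuf (hat \<Omega>) (der a ?A (hat \<Omega>'))) (der a' ?A' h)"
    by (simp add: nabla_tensor_form[OF \<alpha>(3,4)] hat_sym_prod hat_pinczon_left[OF \<alpha>(1,2) \<Omega>(3)])
  have 2: "nabla (hat (tensor W (sym_prod W \<Omega>' (pinczon scale W b \<Omega> \<alpha>')) \<alpha>)) h =
      form_scale (- ksign p a') (mshuf (shuf (hat \<Omega>') (der a' ?A' (hat \<Omega>))) (der a ?A h))"
    by (simp add: nabla_tensor_form[OF \<alpha>(1,2)] hat_sym_prod hat_pinczon_right[OF \<alpha>(3,4) \<Omega>(1,2)]
        shuf_scale_right mshuf_scale_left)
  have 3: "nabla (hat (tensor W (sym_prod W \<Omega> \<Omega>') ?\<gamma>)) h = mshuf (shuf (hat \<Omega>) (hat \<Omega>')) (der (a + a') ?C h)"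
    by (simp add: nabla_tensor_form[OF pinczon_bilinear_closed[OF \<alpha>(1,2,3)] form_deg_pinczon_left[OF \<alpha>(1,2) bi(2) \<alpha>(4)]]
        hat_sym_prod d)
  \<comment> \<open>The Koszul sign of the second term, times the sign from writing the bracket of
    \<Omega> with \<alpha>' as a derivation, is minus the sign of exchanging the two
    operators.\<close>
  have s: "ksign p' p * ksign p' a * ksign a' a * - ksign p a' = - (ksign (p + a) (p' + a') :: 'k)"
    by (auto simp: ksign_def)
  have neg: "form_scale (- c) u = - form_scale c u" for c and u :: "nat list \<Rightarrow> 'k"
    by (rule ext) (simp add: form_scale_apply)
  have "nabla (hat (bracket_formula p a p' a' \<Omega> \<alpha> \<Omega>' \<alpha>')) h =
      mshuf (shuf (hat \<Omega>) (der a ?A (hat \<Omega>'))) (der a' ?A' h)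
      + form_scale (ksign p' p * ksign p' a * ksign a' a * - ksign p a')
          (mshuf (shuf (hat \<Omega>') (der a' ?A' (hat \<Omega>))) (der a ?A h))
      + form_scale (ksign a p') (mshuf (shuf (hat \<Omega>) (hat \<Omega>')) (der (a + a') ?C h))"
    by (simp only: bracket_formula_def K hat_simps nabla_add_left nabla_scale_left 1 2 3 form_scale_1 form_scale_form_scale)
  also have "\<dots> = nabla f (nabla g h) - form_scale (ksign (p + a) (p' + a')) (nabla g (nabla f h))"
    unfolding f_def g_def nabla_tensor_form[OF \<alpha>(1,2)] nabla_tensor_form[OF \<alpha>(3,4)] s neg
    using mshuf_der_commutator[OF hm[THEN hom_mat_act] parity_hat[OF sym_formsD(1)[OF \<Omega>(1)] \<Omega>(2)]
      parity_hat[OF sym_formsD(1)[OF \<Omega>(3)] \<Omega>(4)], of h] by simp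
  finally show ?thesis .
qed

text \<open>Faithfulness settles words of length at least two over the basis; on shorter words
  bi-symmetric forms vanish by definition.\<close>

lemma nabla_unique:
  assumes "F \<in> P" "G \<in> P" "\<And>h. nabla (hat F) h = nabla (hat G) h"
  shows "F = G"
proof -
  define D where "D = F + form_scale (- 1) G"
  have D: "D \<in> P" unfolding D_def by (intro bisym_add bisym_scale assms)
  have "nabla (hat D) h = 0" for h
    by (rule ext) (simp add: D_def nabla_add_left nabla_scale_left assms(3) form_scale_apply)
  then have 0: "hat D (w @ [i, j]) = 0" if "i < m" "j < m" for w i j
    using nabla_faithful that by blast
  have "hat D w = 0" for w
  proof (cases "2 \<le> length w")
    case True
    then obtain v i j where w: "w = v @ [i, j]" using last_two by blast
    show ?thesis
    proof (cases "i < m \<and> j < m")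
      case False
      then have "\<not> set w \<subseteq> {..<m}" by (auto simp: w)
      then show ?thesis by (rule hat_bad)
    qed (simp add: w 0)
  next
    case False
    then show ?thesis using bisym_formsD(4)[OF D] by (simp add: hat_def)
  qed
  then have "hat D = hat 0" by (auto simp: fun_eq_iff)
  then have "D = 0" by (intro multilinear_eqI bisym_formsD[OF D] multilinear_0)
  then show ?thesis by (auto simp: D_def fun_eq_iff form_scale_apply)
qed

section \<open>Bi-symmetric forms as sums of tensors\<close>

definition elem :: "nat \<Rightarrow> nat \<Rightarrow> ('v, 'k) form" where
  "elem i j xs = (if length xs = 2 then b (xs ! 0) (e' i) * b (xs ! 1) (e' j) +
     ksign (dg i) (dg j) * b (xs ! 0) (e' j) * b (xs ! 1) (e' i) else 0)"

lemma multilinear_elem: "multilinear scale (elem i j)"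
proof (rule multilinearI)
  fix xs ys :: "'v list"
  consider "length xs + Suc (length ys) \<noteq> 2" | y where "xs = []" "ys = [y]" | x where "xs = [x]" "ys = []"
  proof (cases xs)
    case Nil
    then show ?thesis using that by (cases ys; cases "tl ys") auto
  next
    case (Cons x xs')
    then show ?thesis using that by (cases xs'; cases ys) auto
  qed
  then show "lin (\<lambda>v. elem i j (xs @ v # ys))"
    by cases (auto simp: elem_def lin_iff b_simps algebra_simps)
qed

text \<open>The functions \<open>b x (e' i)\<close> are the coordinates in the basis, so
  \<open>elem i j\<close> is a symmetrized product of two coordinates. For \<open>i = j\<close> both
  summands apply: they add up to 2 in even degree and cancel in odd degree.\<close>

lemma hat_elem: "k < m \<Longrightarrow> l < m \<Longrightarrow> i < m \<Longrightarrow> j < m \<Longrightarrow> hat (elem i j) [k, l] =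
    (if k = i \<and> l = j then 1 else 0) + (if k = j \<and> l = i then ksign (dg i) (dg j) else 0)"
proof -
  assume kl: "k < m" "l < m" and ij: "i < m" "j < m"
  have "hat (elem i j) [k, l] = elem i j [e k, e l]"
    using kl by (simp add: hat_def)
  also have "\<dots> = b (e k) (e' i) * b (e l) (e' j) + ksign (dg i) (dg j) * b (e k) (e' j) * b (e l) (e' i)"
    by (simp add: elem_def)
  also have "\<dots> = (if k = i then 1 else 0) * (if l = j then 1 else 0) +
      ksign (dg i) (dg j) * (if k = j then 1 else 0) * (if l = i then 1 else 0)"
    by (simp only: b_dual[OF kl(1) ij(1)] b_dual[OF kl(2) ij(2)] b_dual[OF kl(1) ij(2)] b_dual[OF kl(2) ij(1)])
  finally show ?thesis
    by (cases "k = i"; cases "l = j"; cases "k = j"; cases "l = i"; simp only: if_True if_False simp_thms mult_1_left mult_1_right mult_zero_left mult_zero_right)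
qed

lemma hat_elem_length: "length w \<noteq> 2 \<Longrightarrow> hat (elem i j) w = 0"
  by (simp add: hat_def elem_def)

lemma elem_closed:
  assumes ij: "i < m" "j < m"
  shows "elem i j \<in> C2"
proof -
  have "finite_arity (elem i j)" unfolding finite_arity_def by (rule exI[of _ 3]) (simp add: elem_def)
  moreover have "wsym (hat (elem i j))"
    unfolding wsym_def
  proof (intro allI)
    fix u v :: "nat list" and x y :: nat
    show "hat (elem i j) (u @ x # y # v) = ksign (dg x) (dg y) * hat (elem i j) (u @ y # x # v)"
    proof (cases "u = [] \<and> v = []")
      case True
      show ?thesis
      proof (cases "x < m \<and> y < m")
        case xy: True
        have "hat (elem i j) [x, y] = ksign (dg x) (dg y) * hat (elem i j) [y, x]"
          by (cases "x = i"; cases "y = j"; cases "x = j"; cases "y = i")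
            (simp_all add: hat_elem xy ij ksign_commute[of "dg j" "dg i"] distrib_left)
        then show ?thesis using True by simp
      next
        case False
        then show ?thesis using True by (auto simp: hat_def)
      qed
    next
      case False
      then have "length (u @ x # y # v) \<noteq> 2" "length (u @ y # x # v) \<noteq> 2" by auto
      then show ?thesis using hat_elem_length[of "u @ x # y # v" i j] hat_elem_length[of "u @ y # x # v" i j]
        by (simp only: mult_zero_right not_False_eq_True simp_thms)
    qed
  qed
  ultimately have "elem i j \<in> S" by (intro sym_formsI multilinear_elem)
  then show ?thesis by (auto simp: sym_bilinear_forms_def elem_def)
qed

lemma form_deg_elem:
  assumes ij: "i < m" "j < m"
  shows "form_deg W (- dg i - dg j) (elem i j)"
  unfolding form_deg_iff[OF multilinear_elem]
proof (intro allI impI)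
  fix w assume w: "hat (elem i j) w \<noteq> 0"
  then have "length w = 2" using hat_elem_length by blast
  then obtain k l where kl: "w = [k, l]" by (auto simp: length_Suc_conv numeral_2_eq_2)
  have "k < m" "l < m" using w kl by (auto simp: hat_def split: if_splits)
  then show "- dg i - dg j = - wd w"
    using w ij unfolding kl by (auto simp: hat_elem split: if_splits)
qed

definition slice :: "('v, 'k) form \<Rightarrow> nat \<Rightarrow> nat \<Rightarrow> ('v, 'k) form" where
  "slice F i j = (\<lambda>xs. F (xs @ [e i, e j]))"

lemma hat_slice: "i < m \<Longrightarrow> j < m \<Longrightarrow> hat (slice F i j) w = hat F (w @ [i, j])"
  by (simp add: hat_def slice_def)

lemma slice_closed:
  assumes F: "F \<in> P" and ij: "i < m" "j < m"
  shows "slice F i j \<in> S"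
proof (rule sym_formsI)
  note F' = bisym_formsD[OF F]
  show "multilinear scale (slice F i j)"
    unfolding slice_def using multilinear_context[OF F'(1), of "[]" "[e i, e j]"] by simp
  show "finite_arity (slice F i j)"
  proof -
    obtain N where N: "\<And>xs. N \<le> length xs \<Longrightarrow> F xs = 0" using F'(2) by (auto simp: finite_arity_def)
    have "slice F i j xs = 0" if "N \<le> length xs" for xs
      unfolding slice_def by (rule N) (use that in simp)
    then show ?thesis unfolding finite_arity_def by blast
  qed
  show "wsym (hat (slice F i j))"
    unfolding wsym_def hat_slice[OF ij]
  proof (intro allI)
    fix u v :: "nat list" and x y :: nat
    have "2 \<le> length (v @ [i, j])" by simp
    then have "hat F (u @ x # y # v @ [i, j]) = ksign (dg x) (dg y) * hat F (u @ y # x # v @ [i, j])"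
      using F'(3) unfolding wbisym_def by blast
    then show "hat F ((u @ x # y # v) @ [i, j]) = ksign (dg x) (dg y) * hat F ((u @ y # x # v) @ [i, j])"
      by (simp only: append_assoc append_Cons)
  qed
qed

lemma form_deg_slice:
  assumes F: "F \<in> L d" and ij: "i < m" "j < m"
  shows "form_deg W (d + 2 + dg i + dg j) (slice F i j)"
  unfolding form_deg_iff[OF sym_formsD(1)[OF slice_closed[OF L_bisym[OF F] ij]]] hat_slice[OF ij]
proof (intro allI impI)
  fix w assume "hat F (w @ [i, j]) \<noteq> 0"
  then have "d + 2 = - wd (w @ [i, j])" using F unfolding L_iff by blast
  then show "d + 2 + dg i + dg j = - wd w" by simp
qed

text \<open>Every bi-symmetric form is a sum of tensors: the factor \<open>1/2\<close> appears because
  \<open>elem i j\<close> and \<open>elem j i\<close> agree up to sign.\<close>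

lemma bisym_expand:
  assumes F: "F \<in> L d"
  shows "F = (\<Sum>i<m. \<Sum>j<m. tensor W
    (form_scale (ksign (dg i + dg j) (d + dg i + dg j) / 2) (slice F i j)) (elem i j))"
    (is "F = (\<Sum>i<m. \<Sum>j<m. ?T i j)")
proof (rule multilinear_eqI)
  note F' = bisym_formsD[OF L_bisym[OF F]]
  have mT: "multilinear scale (?T i j)" if "i < m" "j < m" for i j
    by (intro multilinear_tensor multilinear_scale multilinear_elem sym_formsD(1)[OF slice_closed[OF L_bisym[OF F] that]])
  have ms: "multilinear scale (\<Sum>i\<in>I. f i)" if "\<And>i. i \<in> I \<Longrightarrow> multilinear scale (f i)" for I :: "nat set" and f
    using that by (induction I rule: infinite_finite_induct) (simp_all add: multilinear_0 multilinear_add)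
  show "multilinear scale F" by (rule F')
  show "multilinear scale (\<Sum>i<m. \<Sum>j<m. ?T i j)" by (intro ms mT) auto
  show "hat F = hat (\<Sum>i<m. \<Sum>j<m. ?T i j)"
  proof
    fix w
    have R: "hat (\<Sum>i<m. \<Sum>j<m. ?T i j) w = (\<Sum>i<m. \<Sum>j<m. hat (?T i j) w)"
      by (simp only: hat_sum sum_fun_apply)
    show "hat F w = hat (\<Sum>i<m. \<Sum>j<m. ?T i j) w"
    proof (cases "set w \<subseteq> {..<m} \<and> 2 \<le> length w")
      case True
      then obtain v k l where w: "w = v @ [k, l]" using last_two by blast
      with True have kl: "k < m" "l < m" by auto
      have "hat (?T i j) w = (if i = k \<and> j = l then hat F (v @ [k, l]) / 2 else 0)
          + (if i = l \<and> j = k then ksign (dg k) (dg l) * hat F (v @ [l, k]) / 2 else 0)"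
        if ij: "i < m" "j < m" for i j
      proof -
        \<comment> \<open>The sign put into the first factor cancels that of \<open>tensor\<close>:
          on a form in \<open>L d\<close>, the rest \<open>v\<close> of the word has degree
          \<open>- d - 2 - dg i - dg j\<close>.\<close>
        have "ksign (dg k + dg l) (wd v) * ksign (dg i + dg j) (d + dg i + dg j) = (1 :: 'k)
          \<or> hat F (v @ [i, j]) = 0 \<or> hat (elem i j) [k, l] = 0"
        proof (cases "hat F (v @ [i, j]) = 0 \<or> hat (elem i j) [k, l] = 0")
          case False
          then have "d + 2 = - wd (v @ [i, j])" using F unfolding L_iff by blast
          then have v: "wd v = - d - 2 - dg i - dg j" by simp
          have "dg k + dg l = dg i + dg j"
            using False hat_elem[OF kl ij] by (auto split: if_splits)
          then show ?thesis unfolding v by (auto simp: ksign_def)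
        qed auto
        then have "hat (?T i j) w = hat F (v @ [i, j]) / 2 * hat (elem i j) [k, l]"
          unfolding w hat_tensor[OF elem_closed[OF ij]] hat_simps form_scale_apply hat_slice[OF ij] by auto
        also have "\<dots> = (if i = k \<and> j = l then hat F (v @ [k, l]) / 2 else 0)
          + (if i = l \<and> j = k then ksign (dg k) (dg l) * hat F (v @ [l, k]) / 2 else 0)"
          unfolding hat_elem[OF kl ij]
          by (cases "i = k"; cases "j = l"; cases "i = l"; cases "j = k")
            (simp_all add: ksign_commute[of "dg l" "dg k"] distrib_left)
        finally show ?thesis .
      qed
      then have "(\<Sum>i<m. \<Sum>j<m. hat (?T i j) w) = (\<Sum>i<m. \<Sum>j<m. (if i = k \<and> j = l then hat F (v @ [k, l]) / 2 else 0)
          + (if i = l \<and> j = k then ksign (dg k) (dg l) * hat F (v @ [l, k]) / 2 else 0))"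
        by (intro sum.cong refl) simp
      also have "\<dots> = (\<Sum>i<m. (if i = k then hat F (v @ [k, l]) / 2 else 0)
          + (if i = l then ksign (dg k) (dg l) * hat F (v @ [l, k]) / 2 else 0))"
        using kl by (intro sum.cong refl) (auto simp: sum.distrib)
      also have "\<dots> = hat F (v @ [k, l]) / 2 + ksign (dg k) (dg l) * hat F (v @ [l, k]) / 2"
        using kl by (simp add: sum.distrib)
      \<comment> \<open>Symmetry in the last two variables makes the contributions of
        \<open>elem k l\<close> and \<open>elem l k\<close> equal, so the two halves add up.\<close>
      also have "ksign (dg k) (dg l) * hat F (v @ [l, k]) = hat F (v @ [k, l])"
        using F'(3) unfolding wbisym_def by metis
      finally have "(\<Sum>i<m. \<Sum>j<m. hat (?T i j) w) = hat F (v @ [k, l])"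
        by (simp flip: add_divide_distrib)
      then show ?thesis unfolding R using w by (simp only:)
    next
      case False
      have "hat F w = 0 \<and> hat (?T i j) w = 0" if "i < m" "j < m" for i j
      proof (cases "set w \<subseteq> {..<m}")
        case True
        then have "length w < 2" using False by simp
        then show ?thesis using F'(4) tensor_short[OF elem_closed[OF that]] by (simp add: hat_def)
      qed (simp add: hat_bad)
      moreover have "hat F w = 0"
      proof (cases "set w \<subseteq> {..<m}")
        case True
        then have "length w < 2" using False by simp
        then show ?thesis using F'(4) by (simp add: hat_def)
      qed (simp add: hat_bad)
      ultimately show ?thesis unfolding R by simp
    qed
  qed
qed

text \<open>Scalars are absorbed into the first factor, so closure under sums suffices, and the
  tensors in \<open>bisym_expand\<close> all have the total degree of \<open>F\<close>.\<close>

lemma L_tensor_induct [consumes 1, case_names zero tensor add]: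
  assumes F: "F \<in> L d" and zero: "Q 0"
    and tensor: "\<And>\<Omega> \<alpha> p a. \<Omega> \<in> S \<Longrightarrow> \<alpha> \<in> C2 \<Longrightarrow>
      form_deg W p \<Omega> \<Longrightarrow> form_deg W a \<alpha> \<Longrightarrow> p + a = d + 2 \<Longrightarrow> Q (tensor W \<Omega> \<alpha>)"
    and add: "\<And>F G. F \<in> L d \<Longrightarrow> G \<in> L d \<Longrightarrow> Q F \<Longrightarrow> Q G \<Longrightarrow> Q (F + G)"
  shows "Q F"
proof -
  let ?\<Omega> = "\<lambda>i j. form_scale (ksign (dg i + dg j) (d + dg i + dg j) / 2) (slice F i j)"
  have sum: "(\<Sum>i\<in>I. f i) \<in> L d \<and> Q (\<Sum>i\<in>I. f i)" if "\<And>i. i \<in> I \<Longrightarrow> f i \<in> L d \<and> Q (f i)" for I :: "nat set" and f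
    using that by (induction I rule: infinite_finite_induct) (simp_all add: L_zero zero L_add add)
  have \<Omega>: "?\<Omega> i j \<in> S" "form_deg W (d + 2 + dg i + dg j) (?\<Omega> i j)" if "i < m" "j < m" for i j
  proof -
    note s = slice_closed[OF L_bisym[OF F] that]
    note s' = sym_formsD[OF s]
    have "finite_arity (?\<Omega> i j)"
      using s'(2) unfolding finite_arity_def form_scale_apply by (metis mult_zero_right)
    then show "?\<Omega> i j \<in> S"
      by (intro sym_formsI multilinear_scale s') (simp_all add: wsym_scale s')
    show "form_deg W (d + 2 + dg i + dg j) (?\<Omega> i j)"
      using form_deg_slice[OF F that] unfolding form_deg_def form_scale_apply by auto
  qed
  have "tensor W (?\<Omega> i j) (elem i j) \<in> L d \<and> Q (tensor W (?\<Omega> i j) (elem i j))" if "i < m" "j < m" for i j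
    using L_tensor[OF elem_closed[OF that] form_deg_elem[OF that] \<Omega>[OF that], of d]
      tensor[OF \<Omega>(1)[OF that] elem_closed[OF that] \<Omega>(2)[OF that] form_deg_elem[OF that]] by simp
  then have "Q (\<Sum>i<m. \<Sum>j<m. tensor W (?\<Omega> i j) (elem i j))"
    by (intro sum[THEN conjunct2] sum) simp
  then show ?thesis using bisym_expand[OF F] by simp
qed

text \<open>Keeps arguments of total degree \<open>- (d + 2)\<close>: a form has the degree opposite
  to that of its arguments, and the grading is shifted by 2.\<close>

definition component :: "('v, 'k) form \<Rightarrow> int \<Rightarrow> ('v, 'k) form" where
  "component F d = multi_ext W (\<lambda>ds xs. if sum_list ds = - (d + 2) then F xs else 0)"

lemma hat_component: "hat (component F d) w = (if wd w = - (d + 2) then hat F w else 0)"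
  by (simp add: hat_def component_def multi_ext_basis wd_def)

lemma component_L:
  assumes F: "F \<in> P"
  shows "component F d \<in> L d"
  unfolding L_iff
proof (intro conjI allI impI bisym_formsI)
  note F' = bisym_formsD[OF F]
  show "multilinear scale (component F d)"
    unfolding component_def
  proof (rule multilinear_multi_ext)
    fix ds and xs ys :: "'v list"
    show "lin (\<lambda>v. if sum_list ds = - (d + 2) then F (xs @ v # ys) else 0)"
      by (cases "sum_list ds = - (d + 2)") (simp_all only: if_True if_False simp_thms multilinearD[OF F'(1)] lin_intros(1))
  qed
  obtain N where "\<And>xs. N \<le> length xs \<Longrightarrow> F xs = 0" using F'(2) by (auto simp: finite_arity_def)
  then have "component F d xs = 0" if "N \<le> length xs" for xs
    unfolding component_def using that by (intro multi_ext_zero) simp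
  then show "finite_arity (component F d)" unfolding finite_arity_def by blast
  show "component F d xs = 0" if "length xs < 2" for xs
    unfolding component_def using that F'(4) by (intro multi_ext_zero) simp
  show "wbisym (hat (component F d))"
    unfolding wbisym_def hat_component
  proof (intro conjI allI impI)
    fix u v :: "nat list" and x y :: nat
    assume "2 \<le> length v"
    then have "hat F (u @ x # y # v) = ksign (dg x) (dg y) * hat F (u @ y # x # v)"
      using F'(3) unfolding wbisym_def by blast
    then show "(if wd (u @ x # y # v) = - (d + 2) then hat F (u @ x # y # v) else 0) =
        ksign (dg x) (dg y) * (if wd (u @ y # x # v) = - (d + 2) then hat F (u @ y # x # v) else 0)"
      by (simp add: add.left_commute)
  next
    fix u :: "nat list" and x y :: nat
    have "hat F (u @ [x, y]) = ksign (dg x) (dg y) * hat F (u @ [y, x])"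
      using F'(3) unfolding wbisym_def by blast
    then show "(if wd (u @ [x, y]) = - (d + 2) then hat F (u @ [x, y]) else 0) =
        ksign (dg x) (dg y) * (if wd (u @ [y, x]) = - (d + 2) then hat F (u @ [y, x]) else 0)"
      by (simp add: add.commute)
  qed
  show "d + 2 = - wd w" if "hat (component F d) w \<noteq> 0" for w
    using that by (simp add: hat_component split: if_splits)
qed

lemma sum_forms: "(\<And>i. i \<in> I \<Longrightarrow> F i \<in> P) \<Longrightarrow> (\<Sum>i\<in>I. F i) \<in> P"
  by (induction I rule: infinite_finite_induct) (simp_all add: bisym_zero bisym_add)

lemma component_decomposition:
  assumes F: "F \<in> P"
  shows "is_decomposition L F (component F)"
proof -
  note F' = bisym_formsD[OF F]
  obtain N where N: "\<And>xs. N \<le> length xs \<Longrightarrow> F xs = 0" using F'(2) by (auto simp: finite_arity_def)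
  let ?D = "{d. component F d \<noteq> 0}"
  \<comment> \<open>There are only finitely many basis words within the arity bound, hence finitely
    many degrees.\<close>
  have "?D \<subseteq> (\<lambda>w. - wd w - 2) ` {w. set w \<subseteq> {..<m} \<and> length w \<le> N}"
  proof
    fix d assume "d \<in> ?D"
    then have "component F d \<noteq> 0" by simp
    then have "hat (component F d) \<noteq> hat 0"
      using multilinear_eqI[OF bisym_formsD(1)[OF L_bisym[OF component_L[OF F]]] multilinear_0] by blast
    then obtain w where w: "hat (component F d) w \<noteq> 0" by (auto simp: fun_eq_iff)
    then have "d = - wd w - 2" "hat F w \<noteq> 0" by (auto simp: hat_component split: if_splits)
    moreover from this have "set w \<subseteq> {..<m} \<and> length w \<le> N"
      using N[of "map e w"] by (cases "N \<le> length w") (auto simp: hat_def split: if_splits)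
    ultimately show "d \<in> (\<lambda>w. - wd w - 2) ` {w. set w \<subseteq> {..<m} \<and> length w \<le> N}" by blast
  qed
  then have fin: "finite ?D"
    by (rule finite_subset) (intro finite_imageI finite_lists_length_le finite_lessThan)
  have "F = (\<Sum>d\<in>?D. component F d)"
  proof (rule multilinear_eqI)
    show "multilinear scale (\<Sum>d\<in>?D. component F d)"
      by (intro bisym_formsD(1)[OF sum_forms] L_bisym[OF component_L[OF F]])
    show "hat F = hat (\<Sum>d\<in>?D. component F d)"
    proof
      fix w
      have "hat (\<Sum>d\<in>?D. component F d) w = (\<Sum>d\<in>?D. if d = - wd w - 2 then hat F w else 0)"
        unfolding hat_sum sum_fun_apply hat_component by (intro sum.cong) auto
      also have "\<dots> = (if - wd w - 2 \<in> ?D then hat F w else 0)"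
        using fin by simp
      also have "\<dots> = hat F w"
      proof (cases "- wd w - 2 \<in> ?D")
        case False
        then have "hat (component F (- wd w - 2)) w = 0" by simp
        then show ?thesis by (simp add: hat_component)
      qed simp
      finally show "hat F w = hat (\<Sum>d\<in>?D. component F d) w" ..
    qed
  qed (rule F')
  then show ?thesis
    using fin component_L[OF F] by (simp add: is_decomposition_def)
qed

lemma decomposition_component:
  assumes F: "F \<in> P" and c: "is_decomposition L F c"
  shows "c = component F"
proof
  fix d
  have c': "\<And>d. c d \<in> L d" "finite {d. c d \<noteq> 0}" "F = (\<Sum>d | c d \<noteq> 0. c d)"
    using c by (auto simp: is_decomposition_def)
  show "c d = component F d"
  proof (rule multilinear_eqI)
    show "multilinear scale (c d)" "multilinear scale (component F d)"
      using bisym_formsD(1) L_bisym c'(1) component_L[OF F] by blast+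
    show "hat (c d) = hat (component F d)"
    proof
      fix w
      have z: "hat (c d') w = 0" if "d' \<noteq> - wd w - 2" for d'
        using c'(1)[of d'] that unfolding L_iff by force
      have "hat F w = (\<Sum>d' | c d' \<noteq> 0. hat (c d') w)"
        by (subst c'(3)) (simp add: sum_fun_apply)
      also have "\<dots> = (\<Sum>d' | c d' \<noteq> 0. if d' = - wd w - 2 then hat (c (- wd w - 2)) w else 0)"
        using z by (intro sum.cong) auto
      also have "\<dots> = hat (c (- wd w - 2)) w"
        using c'(2) by auto
      finally show "hat (c d) w = hat (component F d) w"
        using z[of d] by (auto simp: hat_component)
    qed
  qed
qed

lemma bisym_is_grading: "is_grading form_scale P L"
  unfolding is_grading_def subspace_form_scale_iff
proof (intro conjI ballI allI)
  fix F assume F: "F \<in> P"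
  show "\<exists>!c. is_decomposition L F c"
    by (intro ex1I[of _ "component F"] component_decomposition[OF F] decomposition_component[OF F])
qed (auto simp: bisym_zero bisym_add bisym_scale L_zero L_add L_scale L_bisym)

lemma bisym_tensor_induct [consumes 1, case_names zero tensor add]:
  assumes F: "F \<in> P" and zero: "Q 0"
    and tensor: "\<And>\<Omega> \<alpha> p a. \<Omega> \<in> S \<Longrightarrow> \<alpha> \<in> C2 \<Longrightarrow>
      form_deg W p \<Omega> \<Longrightarrow> form_deg W a \<alpha> \<Longrightarrow> Q (tensor W \<Omega> \<alpha>)"
    and add: "\<And>F G. F \<in> P \<Longrightarrow> G \<in> P \<Longrightarrow> Q F \<Longrightarrow> Q G \<Longrightarrow> Q (F + G)"
  shows "Q F"
proof -
  have L: "Q G" if "G \<in> L d" for G d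
    using that
  proof (rule L_tensor_induct[where Q = Q])
    fix X Y assume "X \<in> L d" "Y \<in> L d" "Q X" "Q Y"
    then show "Q (X + Y)" by (intro add L_bisym)
  qed (rule zero, rule tensor)
  have "(\<Sum>d\<in>D. component F d) \<in> P \<and> Q (\<Sum>d\<in>D. component F d)" for D
    by (induction D rule: infinite_finite_induct)
      (simp_all only: sum.infinite sum.empty sum.insert not_False_eq_True simp_thms
        zero bisym_zero add bisym_add L[OF component_L[OF F]] L_bisym[OF component_L[OF F]])
  moreover have "F = (\<Sum>d | component F d \<noteq> 0. component F d)"
    using component_decomposition[OF F] by (simp add: is_decomposition_def)
  ultimately show ?thesis by metis
qed

section \<open>Graded commutators of operators and the forms that realize them\<close>

definition evens :: "(nat list \<Rightarrow> 'k) \<Rightarrow> nat list \<Rightarrow> 'k" where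
  "evens g = (\<lambda>w. if even (wd w) then g w else 0)"

definition odds :: "(nat list \<Rightarrow> 'k) \<Rightarrow> nat list \<Rightarrow> 'k" where
  "odds g = (\<lambda>w. if odd (wd w) then g w else 0)"

lemma evens_odds_simps: "evens (f + g) = evens f + evens g" "evens (form_scale c f) = form_scale c (evens f)"
  "odds (f + g) = odds f + odds g" "odds (form_scale c f) = form_scale c (odds f)"
  by (auto simp: evens_def odds_def form_scale_def fun_eq_iff)

text \<open>The graded commutator of \<open>nabla f\<close> and \<open>nabla g\<close>. As \<open>twist 1\<close> is the parity operator, the
  signs are right on homogeneous arguments and the definition stays bilinear.\<close>

definition commutator :: "(nat list \<Rightarrow> 'k) \<Rightarrow> (nat list \<Rightarrow> 'k) \<Rightarrow> (nat list \<Rightarrow> 'k) \<Rightarrow> nat list \<Rightarrow> 'k" where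
  "commutator f g h = nabla f (nabla g h) - nabla (evens g) (nabla f h) - nabla (odds g) (nabla (twist 1 f) h)"

lemmas nabla_simps = nabla_add_left nabla_add_right nabla_scale_left nabla_scale_right

lemma commutator_add: "commutator (f + f') g h = commutator f g h + commutator f' g h"
  "commutator f (g + g') h = commutator f g h + commutator f g' h"
  by (simp_all add: commutator_def evens_odds_simps nabla_simps)

lemma commutator_scale: "commutator (form_scale c f) g h = form_scale c (commutator f g h)"
  "commutator f (form_scale c g) h = form_scale c (commutator f g h)"
  by (simp_all only: commutator_def evens_odds_simps nabla_simps twist_simps)
    (auto simp: form_scale_def fun_eq_iff algebra_simps)

lemma commutator_homogeneous:
  assumes f: "parity p f" and g: "parity q g"
  shows "commutator f g h = nabla f (nabla g h) - form_scale (ksign p q) (nabla g (nabla f h))"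
proof (cases "even q")
  case True
  have "even (q + wd w) \<longleftrightarrow> even (wd w)" for w using True by simp
  then have "evens g = g" "odds g = 0"
    using g by (auto simp: evens_def odds_def parity_def fun_eq_iff)
  then show ?thesis using True by (simp add: commutator_def ksign_def)
next
  case False
  have "even (q + wd w) \<longleftrightarrow> odd (wd w)" for w using False by simp
  then have "evens g = 0" "odds g = g"
    using g by (auto simp: evens_def odds_def parity_def fun_eq_iff)
  then show ?thesis using False by (simp add: commutator_def twist_parity[OF f] nabla_simps ksign_def)
qed

text \<open>\<open>X\<close> will be either all of \<open>P\<close> or one graded piece; the second
  choice also yields the degree of the bracket.\<close>

abbreviation realized :: "('v, 'k) form set \<Rightarrow> (nat list \<Rightarrow> 'k) \<Rightarrow> (nat list \<Rightarrow> 'k) \<Rightarrow> bool" where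
  "realized X f g \<equiv> \<exists>K\<in>X. \<forall>h. nabla (hat K) h = commutator f g h"

lemma realized_zero: assumes "0 \<in> X" shows "realized X 0 g" "realized X f 0"
proof -
  have "commutator 0 g h = 0" "commutator f 0 h = 0" for h
    using commutator_scale(1)[of 0 0 g h] commutator_scale(2)[of f 0 0 h] by simp_all
  then show "realized X 0 g" "realized X f 0" using assms by (auto intro!: bexI[of _ 0])
qed

lemma realized_add:
  assumes X: "\<And>K K'. K \<in> X \<Longrightarrow> K' \<in> X \<Longrightarrow> K + K' \<in> X"
  shows "realized X f g \<Longrightarrow> realized X f' g \<Longrightarrow> realized X (f + f') g"
    "realized X f g \<Longrightarrow> realized X f g' \<Longrightarrow> realized X f (g + g')"
proof -
  have *: "realized X f'' g''" if "realized X f g" "realized X f1 g1"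
    "\<And>h. commutator f'' g'' h = commutator f g h + commutator f1 g1 h" for f g f1 g1 f'' g''
  proof -
    obtain K K' where "K \<in> X" "K' \<in> X" and K: "\<And>h. nabla (hat K) h = commutator f g h"
      "\<And>h. nabla (hat K') h = commutator f1 g1 h"
      using \<open>realized X f g\<close> \<open>realized X f1 g1\<close> by blast
    then show ?thesis
      by (intro bexI[of _ "K + K'"] X allI) (simp_all only: hat_simps nabla_simps that(3) K)
  qed
  show "realized X f g \<Longrightarrow> realized X f' g \<Longrightarrow> realized X (f + f') g"
    "realized X f g \<Longrightarrow> realized X f g' \<Longrightarrow> realized X f (g + g')"
    by (erule (1) *, rule commutator_add)+
qed

text \<open>The commutator is additive in both arguments, so two nested inductions reduce to
  tensors, where \<open>bracket_formula\<close> is an explicit witness of the right degree.\<close>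

lemma commutator_exists_L:
  assumes F: "F \<in> L i" and G: "G \<in> L j"
  shows "realized (L (i + j)) (hat F) (hat G)"
  using F
proof (induction rule: L_tensor_induct)
  case zero
  show ?case unfolding hat_simps by (intro realized_zero L_zero)
next
  case (add F F')
  then show ?case unfolding hat_simps by (intro realized_add L_add)
next
  case (tensor \<Omega> \<alpha> p a)
  note t = tensor
  show ?case using G
  proof (induction rule: L_tensor_induct)
    case zero
    show ?case unfolding hat_simps by (intro realized_zero L_zero)
  next
    case (add G G')
    then show ?case unfolding hat_simps by (intro realized_add L_add)
  next
    case (tensor \<Omega>' \<alpha>' p' a')
    have par: "parity (p + a) (hat (tensor W \<Omega> \<alpha>))" "parity (p' + a') (hat (tensor W \<Omega>' \<alpha>'))"
      using t tensor
      by (intro parity_hat form_deg_tensor bisym_formsD(1)[OF tensor_closed]; simp)+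
    show ?case
      using bracket_formula_in[OF t(2,4) tensor(2,4) t(1,3) tensor(1,3) t(5) tensor(5)]
        nabla_bracket_formula[OF t(2,4) tensor(2,4) t(1,3) tensor(1,3)]
      by (intro bexI[of _ "bracket_formula p a p' a' \<Omega> \<alpha> \<Omega>' \<alpha>'"]) (simp_all add: commutator_homogeneous[OF par])
  qed
qed

lemma commutator_exists:
  assumes F: "F \<in> P" and G: "G \<in> P"
  shows "realized P (hat F) (hat G)"
  using F
proof (induction rule: bisym_tensor_induct)
  case zero
  show ?case unfolding hat_simps by (intro realized_zero bisym_zero)
next
  case (add F F')
  then show ?case unfolding hat_simps by (intro realized_add bisym_add)
next
  case (tensor \<Omega> \<alpha> p a)
  have T: "tensor W \<Omega> \<alpha> \<in> L (p + a - 2)"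
    using tensor by (intro L_tensor[of \<alpha> a \<Omega> p]) auto
  show ?case using G
  proof (induction rule: bisym_tensor_induct)
    case zero
    show ?case unfolding hat_simps by (intro realized_zero bisym_zero)
  next
    case (add G G')
    then show ?case unfolding hat_simps by (intro realized_add bisym_add)
  next
    case (tensor \<Omega>' \<alpha>' p' a')
    have "tensor W \<Omega>' \<alpha>' \<in> L (p' + a' - 2)"
      using tensor by (intro L_tensor[of \<alpha>' a' \<Omega>' p']) auto
    from commutator_exists_L[OF T this] show ?case using L_bisym by blast
  qed
qed

text \<open>No decomposition into tensors enters the definition. \<open>commutator_exists\<close>
  provides a form with the required operator, and by \<open>nabla_unique\<close> the choice is the
  only possible one.\<close>

definition br :: "('v, 'k) form \<Rightarrow> ('v, 'k) form \<Rightarrow> ('v, 'k) form" where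
  "br F G = (SOME K. K \<in> P \<and> (\<forall>h. nabla (hat K) h = commutator (hat F) (hat G) h))"

lemma br:
  assumes "F \<in> P" "G \<in> P"
  shows "br F G \<in> P" "nabla (hat (br F G)) h = commutator (hat F) (hat G) h"
  using someI_ex[OF commutator_exists[OF assms, unfolded Bex_def]] unfolding br_def by blast+

lemma br_eqI:
  assumes "F \<in> P" "G \<in> P" "K \<in> P"
    "\<And>h. nabla (hat K) h = commutator (hat F) (hat G) h"
  shows "br F G = K"
  by (rule nabla_unique) (simp_all add: br[OF assms(1,2)] assms)

section \<open>The bracket on tensors and its Lie algebra identities\<close>

lemma br_bilinear: "bilinear_on form_scale P br"
  unfolding bilinear_on_def
  by (intro conjI ballI allI; intro br_eqI bisym_add bisym_scale br; simp add: nabla_simps commutator_add commutator_scale br)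

lemma br_tensor:
  assumes "\<Omega> \<in> S" "\<Omega>' \<in> S"
    "\<alpha> \<in> C2" "\<alpha>' \<in> C2"
    "form_deg W p \<Omega>" "form_deg W a \<alpha>" "form_deg W p' \<Omega>'" "form_deg W a' \<alpha>'"
  shows "br (tensor W \<Omega> \<alpha>) (tensor W \<Omega>' \<alpha>') = bracket_formula p a p' a' \<Omega> \<alpha> \<Omega>' \<alpha>'"
proof (rule br_eqI)
  have par: "parity (p + a) (hat (tensor W \<Omega> \<alpha>))" "parity (p' + a') (hat (tensor W \<Omega>' \<alpha>'))"
    using assms by (intro parity_hat form_deg_tensor bisym_formsD(1)[OF tensor_closed]; simp)+
  show "tensor W \<Omega> \<alpha> \<in> P" "tensor W \<Omega>' \<alpha>' \<in> P"
    by (intro tensor_closed assms)+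
  show "bracket_formula p a p' a' \<Omega> \<alpha> \<Omega>' \<alpha>' \<in> P"
    by (rule L_bisym[OF bracket_formula_in[OF assms(3,6,4,8,1,5,2,7), of "p + a - 2" "p' + a' - 2"]]) simp_all
  show "nabla (hat (bracket_formula p a p' a' \<Omega> \<alpha> \<Omega>' \<alpha>')) h = commutator (hat (tensor W \<Omega> \<alpha>)) (hat (tensor W \<Omega>' \<alpha>')) h" for h
    by (simp add: commutator_homogeneous[OF par] nabla_bracket_formula[OF assms(3,6,4,8,1,5,2,7)])
qed

lemma br_is_bracket: "is_bisym_pinczon_bracket scale W b br"
  unfolding is_bisym_pinczon_bracket_def
  by (intro conjI ballI allI impI br_bilinear, elim conjE) (rule br_tensor[unfolded bracket_formula_def])

lemma br_degree:
  assumes F: "F \<in> L i" and G: "G \<in> L j"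
  shows "br F G \<in> L (i + j)"
proof -
  obtain K where K: "K \<in> L (i + j)" "\<And>h. nabla (hat K) h = commutator (hat F) (hat G) h"
    using commutator_exists_L[OF assms] by blast
  then have "br F G = K" by (intro br_eqI L_bisym[OF F] L_bisym[OF G] L_bisym[OF K(1)])
  then show ?thesis using K by simp
qed

lemma nabla_br:
  assumes F: "F \<in> L i" and G: "G \<in> L j"
  shows "nabla (hat (br F G)) h =
    nabla (hat F) (nabla (hat G) h) - form_scale (ksign i j) (nabla (hat G) (nabla (hat F) h))"
  using br(2)[OF L_bisym[OF F] L_bisym[OF G]] commutator_homogeneous[OF L_parity[OF F] L_parity[OF G]] by simp

lemma br_antisymmetric:
  assumes F: "F \<in> L i" and G: "G \<in> L j"
  shows "br F G = form_scale (- ksign i j) (br G F)"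
proof (rule nabla_unique)
  show "br F G \<in> P" "form_scale (- ksign i j) (br G F) \<in> P"
    by (intro bisym_scale br L_bisym[OF F] L_bisym[OF G])+
  show "nabla (hat (br F G)) h = nabla (hat (form_scale (- ksign i j) (br G F))) h" for h
    by (rule ext) (simp add: nabla_simps nabla_br[OF F G] nabla_br[OF G F] form_scale_apply
        ksign_commute[of j i] right_diff_distrib)
qed

lemma nabla_diff: "nabla f (g - h) = nabla f g - nabla f h"
  using nabla_add_right[of f "g - h" h] by (simp add: algebra_simps)

text \<open>The graded Jacobi identity for commutators of operators under composition. The inner
  brackets are homogeneous by \<open>br_degree\<close>, so their signs are known.\<close>

lemma br_jacobi_homogeneous:
  assumes F: "F \<in> L i" and G: "G \<in> L j" and H: "H \<in> L k"
  shows "br F (br G H) = br (br F G) H + form_scale (ksign i j) (br G (br F H))"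
proof (rule nabla_unique)
  note B = L_bisym[OF F] L_bisym[OF G] L_bisym[OF H]
  show "br F (br G H) \<in> P" "br (br F G) H + form_scale (ksign i j) (br G (br F H)) \<in> P"
    by (intro bisym_add bisym_scale br B)+
  fix h
  show "nabla (hat (br F (br G H))) h = nabla (hat (br (br F G) H + form_scale (ksign i j) (br G (br F H)))) h"
  proof
    fix w
    let ?X = "nabla (hat F)" and ?Y = "nabla (hat G)" and ?Z = "nabla (hat H)"
    show "nabla (hat (br F (br G H))) h w = nabla (hat (br (br F G) H + form_scale (ksign i j) (br G (br F H)))) h w"
      unfolding hat_simps nabla_simps nabla_br[OF F br_degree[OF G H]] nabla_br[OF br_degree[OF F G] H]
        nabla_br[OF G br_degree[OF F H]] nabla_br[OF F G] nabla_br[OF G H] nabla_br[OF F H] nabla_diff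
      unfolding plus_fun_apply fun_diff_def form_scale_apply
      by (simp add: ksign_add_left ksign_add_right ksign_commute[of j i] algebra_simps)
  qed
qed

text \<open>The definition of a graded Lie algebra leaves the third argument inhomogeneous; both
  sides are additive in it, which reduces to tensors with homogeneous factors.\<close>

lemma br_jacobi:
  assumes F: "F \<in> L i" and G: "G \<in> L j" and "H \<in> P"
  shows "br F (br G H) = br (br F G) H + form_scale (ksign i j) (br G (br F H))"
  using assms(3)
proof (induction rule: bisym_tensor_induct)
  note B = L_bisym[OF F] L_bisym[OF G]
  have sum: "br X (Y + Z) = br X Y + br X Z" if "X \<in> P" "Y \<in> P" "Z \<in> P" for X Y Z
    using br_bilinear that by (simp add: bilinear_on_def)
  case (add H H')
  then have "br F (br G (H + H')) = (br (br F G) H + form_scale (ksign i j) (br G (br F H))) +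
      (br (br F G) H' + form_scale (ksign i j) (br G (br F H')))"
    by (simp only: sum B br(1))
  also have "\<dots> = br (br F G) (H + H') + form_scale (ksign i j) (br G (br F (H + H')))"
    using add by (simp only: sum B br(1) form_scale_add add_ac)
  finally show "br F (br G (H + H')) = br (br F G) (H + H') + form_scale (ksign i j) (br G (br F (H + H')))" .
next
  case zero
  show ?case using br_jacobi_homogeneous[OF F G L_zero] .
next
  case (tensor \<Omega> \<alpha> p a)
  then have "tensor W \<Omega> \<alpha> \<in> L (p + a - 2)" by (intro L_tensor[of \<alpha> a \<Omega> p]) auto
  then show ?case by (rule br_jacobi_homogeneous[OF F G])
qed

lemma br_graded_Lie_algebra: "graded_Lie_algebra form_scale P L br"
  unfolding graded_Lie_algebra_def
  by (intro conjI allI ballI vector_space_form_scale bisym_is_grading br_bilinear br_degree br_antisymmetric br_jacobi)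

lemma bracket_unique:
  assumes br': "is_bisym_pinczon_bracket scale W b br'"
    and F: "F \<in> P" and G: "G \<in> P"
  shows "br' F G = br F G"
proof -
  have bil: "bilinear_on form_scale P c" if "c \<in> {br, br'}" for c
    using that br_bilinear br' by (auto simp: is_bisym_pinczon_bracket_def)
  \<comment> \<open>Bilinearity on \<open>P\<close> includes the scalar 0, which settles the zero
    cases of the inductions.\<close>
  have null: "c 0 X = 0" "c X 0 = 0" if "c \<in> {br, br'}" "X \<in> P" for c X
  proof -
    have "c (form_scale 0 0) X = form_scale 0 (c 0 X)" "c X (form_scale 0 0) = form_scale 0 (c X 0)"
      using bil[OF that(1)] that(2) bisym_zero unfolding bilinear_on_def by blast+
    then show "c 0 X = 0" "c X 0 = 0" by simp_all
  qed
  have sum: "c (X + Y) Z = c X Z + c Y Z" "c Z (X + Y) = c Z X + c Z Y"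
    if "c \<in> {br, br'}" "X \<in> P" "Y \<in> P" "Z \<in> P" for c X Y Z
    using bil[OF that(1)] that(2-) unfolding bilinear_on_def by blast+
  show ?thesis using F
  proof (induction rule: bisym_tensor_induct)
    case zero
    show "br' 0 G = br 0 G" using null[OF _ G] by simp
  next
    case (add X Y)
    then show "br' (X + Y) G = br (X + Y) G" using sum(1)[OF _ add(1,2) G] by simp
  next
    case (tensor \<Omega> \<alpha> p a)
    note t = tensor
    have T: "tensor W \<Omega> \<alpha> \<in> P" by (intro tensor_closed t)
    show ?case using G
    proof (induction rule: bisym_tensor_induct)
      case zero
      show "br' (tensor W \<Omega> \<alpha>) 0 = br (tensor W \<Omega> \<alpha>) 0" using null[OF _ T] by simp
    next
      case (add X Y)
      then show "br' (tensor W \<Omega> \<alpha>) (X + Y) = br (tensor W \<Omega> \<alpha>) (X + Y)" using sum(2)[OF _ add(1,2) T] by simp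
    next
      case (tensor \<Omega>' \<alpha>' p' a')
      show ?case
        using br' t tensor by (simp only: is_bisym_pinczon_bracket_def br_tensor[OF t(1) tensor(1) t(2) tensor(2) t(3,4) tensor(3,4)] bracket_formula_def)
    qed
  qed
qed

end

theorem corollary7p6:
  fixes scale :: "'k::field_char_0 \<Rightarrow> 'v::ab_group_add \<Rightarrow> 'v"
    and V :: "int \<Rightarrow> 'v set" and b :: "'v \<Rightarrow> 'v \<Rightarrow> 'k"
  assumes "quadratic_graded_space scale V b"
  shows "\<exists>br. is_bisym_pinczon_bracket scale (shift V) b br \<and>
      graded_Lie_algebra form_scale (bisym_forms scale (shift V)) (bisym_grading scale (shift V)) br \<and>
      (\<forall>br'. is_bisym_pinczon_bracket scale (shift V) b br' \<longrightarrow>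
         (\<forall>F \<in> bisym_forms scale (shift V). \<forall>G \<in> bisym_forms scale (shift V). br' F G = br F G))"
proof -
  interpret quadratic_graded_space scale V b by (rule assms)
  obtain es es' where chosen: "(SOME B. dual_bases scale (shift V) b B) = (es, es')" by fastforce
  then have "dual_bases scale (shift V) b (es, es')"
    using someI_ex[OF dual_basis_exists] by simp
  then interpret based_space scale V b es es'
    using chosen by unfold_locales
  show ?thesis
    using br_is_bracket br_graded_Lie_algebra bracket_unique by blast
qed

end
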